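(* Let $d\ge 1$, let $R_d=\mathbb{Z}[x_1^{\pm1},\dots,x_d^{\pm1}]$, and let $f\in R_d$ be irreducible and atoral. For every integer $H\ge 1$ there exists a number $M=M(f,H)\ge 1$ with the following property. Suppose that $(\mathcal{S}_i)_{i\in I}$ is a finite or infinite collection of nonempty subsets of $\mathbb{Z}^d$ with $\operatorname{dist}(\mathcal{S}_i,\mathcal{S}_j)\ge M$ whenever $i\ne j$. Let $F$ be an arbitrary finite subset of $I$ and let $p_i\in\mathcal{P}(\mathcal{S}_i,H)$ for every $i\in F$. If $f$ divides $\sum_{i\in F}p_i$ in $R_d$, then $f$ divides $p_i$ in $R_d$ for every $i\in F$.
   Context: $R_d$ is the ring of Laurent polynomials with integer coefficients in $d$ commuting variables. An element is written $f=\sum_{\mathbf{n}\in\mathbb{Z}^d}f_{\mathbf{n}}\mathbf{x}^{\mathbf{n}}$, where $\mathbf{x}^{\mathbf{n}}=x_1^{n_1}\cdots x_d^{n_d}$ and $f_{\mathbf{n}}\in\mathbb{Z}$ is zero for all but finitely many $\mathbf{n}$. The units of $R_d$ are the elements $\pm\mathbf{x}^{\mathbf{n}}$; an element is irreducible if it is neither a unit nor a product of two non-units of $R_d$. The support of $f$ is $\operatorname{supp}f=\{\mathbf{n}\in\mathbb{Z}^d: f_{\mathbf{n}}\neq 0\}$, and $\|f\|_\infty=\max_{\mathbf{n}}|f_{\mathbf{n}}|$. For $\mathbf{n}\in\mathbb{Z}^d$ put $\|\mathbf{n}\|=\max_{1\le j\le d}|n_j|$. For nonempty $\mathcal{S},\mathcal{T}\subset\mathbb{Z}^d$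 put $\operatorname{dist}(\mathcal{S},\mathcal{T})=\min_{\mathbf{m}\in\mathcal{S},\,\mathbf{n}\in\mathcal{T}}\|\mathbf{m}-\mathbf{n}\|$. For nonempty $\mathcal{S}\subset\mathbb{Z}^d$ and an integer $H\ge1$, $$\mathcal{P}(\mathcal{S},H)=\{p\in R_d: \operatorname{supp}(p)\subseteq\mathcal{S}\text{ and }\|p\|_\infty\le H\}.$$ With $\mathbb{T}=\mathbb{R}/\mathbb{Z}$, the unitary variety of $f\in R_d$ is $$\mathsf{U}(f)=\{(t_1,\dots,t_d)\in\mathbb{T}^d: f(e^{2\pi i t_1},\dots,e^{2\pi i t_d})=0\}.$$ Under the identification of $\mathbb{T}^d$ with $\{z\in\mathbb{C}:|z|=1\}^d$, this is a real semialgebraic set, hence a finite disjoint union of cells, and its dimension $\dim\mathsf{U}(f)$ is the maximal dimension of these cells (independent of the cell decomposition). The polynomial $f$ is atoral if $\dim\mathsf{U}(f)\le d-2$; this includes the possibility $\mathsf{U}(f)=\varnothing$ (for every $d\ge 1$). *)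

theory Defs
  imports
    "HOL-Analysis.Analysis"
    "HOL-Library.Poly_Mapping"
    "HOL-Computational_Algebra.Factorial_Ring"
begin

text \<open>
  Laurent polynomials over the integers in variables indexed by \<open>'d\<close> are the finitely supported
  functions from \<open>int ^ 'd\<close> to \<open>int\<close> with the convolution product. The number of
  variables is \<open>CARD('d)\<close>, which is at least 1. Divisibility, units (\<open>_ dvd 1\<close>) and
  \<open>irreducible\<close> are the library notions in this commutative ring.
\<close>

type_synonym 'd laurent = "(int ^ 'd) \<Rightarrow>\<^sub>0 int"

definition laurent_eval :: "'d::finite laurent \<Rightarrow> complex ^ 'd \<Rightarrow> complex" where
  "laurent_eval f z =
     (\<Sum>n \<in> Poly_Mapping.keys f.
        of_int (Poly_Mapping.lookup f n) * (\<Prod>j\<in>UNIV. (z $ j) powi (n $ j)))"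

definition sup_coeff :: "'d::finite laurent \<Rightarrow> int" where
  "sup_coeff f = Max (range (\<lambda>n. \<bar>Poly_Mapping.lookup f n\<bar>))"

definition lattice_norm :: "int ^ 'd::finite \<Rightarrow> int" where
  "lattice_norm n = Max (range (\<lambda>j. \<bar>n $ j\<bar>))"

text \<open>For nonempty arguments the infimum below is one of a nonempty set of nonnegative integers,
  hence a minimum.\<close>

definition lattice_dist :: "(int ^ 'd::finite) set \<Rightarrow> (int ^ 'd) set \<Rightarrow> int" where
  "lattice_dist S T = Inf {lattice_norm (m - n) | m n. m \<in> S \<and> n \<in> T}"

definition bounded_laurent :: "(int ^ 'd::finite) set \<Rightarrow> int \<Rightarrow> 'd laurent set" where
  "bounded_laurent S H = {p. Poly_Mapping.keys p \<subseteq> S \<and> sup_coeff p \<le> H}"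

text \<open>The torus of dimension \<open>CARD('d)\<close>, as a product of unit circles, sits in the real Euclidean
  space \<open>complex ^ 'd\<close> of dimension \<open>2 * CARD('d)\<close>.\<close>

definition unitary_variety :: "'d::finite laurent \<Rightarrow> (complex ^ 'd) set" where
  "unitary_variety f = {z. (\<forall>j. cmod (z $ j) = 1) \<and> laurent_eval f z = 0}"

text \<open>Semialgebraic sets: the Boolean algebra of sets generated by real polynomial inequalities.
  (Equations \<open>p x = 0\<close> are covered as the complement of \<open>p x * p x > 0\<close>.)\<close>

inductive semialgebraic :: "'a::real_normed_vector set \<Rightarrow> bool" where
  pos: "real_polynomial_function p \<Longrightarrow> semialgebraic {x. p x > 0}"
| compl: "semialgebraic A \<Longrightarrow> semialgebraic (- A)"
| inter: "semialgebraic A \<Longrightarrow> semialgebraic B \<Longrightarrow> semialgebraic (A \<inter> B)"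

text \<open>The open unit cube of dimension \<open>card B\<close> in the coordinate subspace spanned by \<open>B\<close>. Every
  \<open>k \<le> DIM('a)\<close> is the cardinality of some \<open>B \<subseteq> Basis\<close>, and for \<open>B = {}\<close> the cube is a point.\<close>

definition open_cube :: "'a::euclidean_space set \<Rightarrow> 'a set" where
  "open_cube B = {x. (\<forall>b\<in>B. 0 < x \<bullet> b \<and> x \<bullet> b < 1) \<and> (\<forall>b\<in>Basis - B. x \<bullet> b = 0)}"

text \<open>A cell of dimension \<open>k\<close> is a semialgebraic set that is semialgebraically homeomorphic to the
  open unit cube of dimension \<open>k\<close>. The inverse of a bijection with semialgebraic graph has
  semialgebraic graph, so no condition on \<open>g\<close> is needed.\<close>

definition semialg_cell :: "'a::euclidean_space set \<Rightarrow> nat \<Rightarrow> bool" where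
  "semialg_cell C k \<longleftrightarrow>
     semialgebraic C \<and>
     (\<exists>(B :: 'a set) h g. B \<subseteq> Basis \<and> card B = k \<and> homeomorphism C (open_cube B) h g \<and>
              semialgebraic ((\<lambda>x. (x, h x)) ` C))"

text \<open>\<open>semialg_dim S k\<close>: some decomposition of \<open>S\<close> into finitely many disjoint cells has \<open>k\<close> as the
  maximal dimension of its cells. Every semialgebraic set has such a decomposition, and \<open>k\<close> does
  not depend on it. The empty set has dimension \<open>-1\<close>.\<close>

definition semialg_dim :: "'a::euclidean_space set \<Rightarrow> int \<Rightarrow> bool" where
  "semialg_dim S k \<longleftrightarrow>
     (\<exists>\<C> \<delta>. finite \<C> \<and> disjoint \<C> \<and> \<Union>\<C> = S \<and>
            (\<forall>C\<in>\<C>. semialg_cell C (\<delta> C)) \<and>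
            k = (if \<C> = {} then -1 else int (Max (\<delta> ` \<C>))))"

definition atoral :: "'d::finite laurent \<Rightarrow> bool" where
  "atoral f \<longleftrightarrow> (\<exists>k. semialg_dim (unitary_variety f) k \<and> k \<le> int CARD('d) - 2)"

text \<open>Only finitely many members of a collection \<open>(S\<^sub>i)\<close> enter the separation property at a time, so
  a constant \<open>M\<close> that works for collections indexed by sets of natural numbers works for collections
  indexed by sets of any type. The theorem uses natural numbers as indices so that \<open>M\<close> is chosen
  before the index set.\<close>

lemma index_type_irrelevant:
  fixes f :: "'d::finite laurent" and I :: "'i set" and p :: "'i \<Rightarrow> 'd laurent"
  assumes nat: "\<And>(I :: nat set) (S :: nat \<Rightarrow> (int ^ 'd) set) F (p :: nat \<Rightarrow> 'd laurent).
      (\<forall>i\<in>I. S i \<noteq> {}) \<Longrightarrow>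
      (\<forall>i\<in>I. \<forall>j\<in>I. i \<noteq> j \<longrightarrow> M \<le> real_of_int (lattice_dist (S i) (S j))) \<Longrightarrow>
      finite F \<Longrightarrow> F \<subseteq> I \<Longrightarrow> (\<forall>i\<in>F. p i \<in> bounded_laurent (S i) H) \<Longrightarrow>
      f dvd (\<Sum>i\<in>F. p i) \<Longrightarrow> (\<forall>i\<in>F. f dvd p i)"
    and "\<forall>i\<in>I. S i \<noteq> {}"
    and "\<forall>i\<in>I. \<forall>j\<in>I. i \<noteq> j \<longrightarrow> M \<le> real_of_int (lattice_dist (S i) (S j))"
    and "finite F" "F \<subseteq> I" "\<forall>i\<in>F. p i \<in> bounded_laurent (S i) H"
    and "f dvd (\<Sum>i\<in>F. p i)"
  shows "\<forall>i\<in>F. f dvd p i"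
proof -
  obtain h where h: "bij_betw h {0..<card F} F"
    using ex_bij_betw_nat_finite[OF \<open>finite F\<close>] by blast
  then have inj: "inj_on h {0..<card F}" and im: "h ` {0..<card F} = F"
    by (auto simp: bij_betw_def)
  have mem: "h i \<in> F" "h i \<in> I" if "i \<in> {0..<card F}" for i
    using that im \<open>F \<subseteq> I\<close> by auto
  have sum_eq: "(\<Sum>i\<in>{0..<card F}. (p \<circ> h) i) = (\<Sum>i\<in>F. p i)"
    using sum.reindex_bij_betw[OF h, of p] by simp
  have "\<forall>i\<in>{0..<card F}. f dvd (p \<circ> h) i"
  proof (rule nat[of "{0..<card F}" "S \<circ> h"])
    show "\<forall>i\<in>{0..<card F}. \<forall>j\<in>{0..<card F}. i \<noteq> j \<longrightarrow>
        M \<le> real_of_int (lattice_dist ((S \<circ> h) i) ((S \<circ> h) j))"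
      using assms(3) mem inj unfolding inj_on_def comp_def by blast
    show "f dvd (\<Sum>i\<in>{0..<card F}. (p \<circ> h) i)"
      using assms(7) sum_eq by argo
  qed (use assms mem in auto)
  then show ?thesis
    unfolding comp_def using im by (metis imageE)
qed

end

theory Submission
  imports Defs
begin

text \<open>
  Since \<open>f\<close> is prime, it suffices to find \<open>g\<close>, not divisible by \<open>f\<close>, such that \<open>g / f\<close> has absolutely
  summable Fourier coefficients \<open>w\<close>. If \<open>f\<close> divides \<open>\<Sum> p\<^sub>i\<close>, then \<open>\<Sum> p\<^sub>i * w\<close> is integer valued, and when the
  supports are far apart each \<open>p\<^sub>i * w\<close> is close to an integer everywhere. Rounding it gives a Laurent
  polynomial \<open>q\<^sub>i\<close> such that \<open>f * q\<^sub>i - p\<^sub>i * g\<close> is integer valued and smaller than 1 in absolute value,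
  hence \<open>f * q\<^sub>i = p\<^sub>i * g\<close>, and \<open>f\<close> divides \<open>p\<^sub>i\<close>.

  A high power of \<open>g\<^sub>0\<close> can be taken for \<open>g\<close> if \<open>|g\<^sub>0|\<^sup>2 \<le> C |f|\<close> on the torus and \<open>f\<close> does not divide \<open>g\<^sub>0\<close>.
  If \<open>f\<close> does not divide its complex conjugate \<open>f(1/x)\<close>, then the latter is such a \<open>g\<^sub>0\<close>. Otherwise \<open>f\<close> is,
  up to a character, a real function on the torus. Its zero set has codimension at least 2 and so does
  not separate, hence the function does not change sign, and \<open>|\<phi>'|\<^sup>2 \<le> C |\<phi>|\<close> for \<open>C\<^sup>2\<close> functions \<open>\<phi>\<close> of
  constant sign. So a logarithmic derivative of \<open>f\<close> serves as \<open>g\<^sub>0\<close>.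
\<close>

subsection \<open>Factorisation in Laurent polynomial extensions\<close>

text \<open>The high power of \<open>g\<^sub>0\<close> is a matter of smoothness. Near zeros of
  \<open>f\<close> the quotient is only as regular as the number of factors \<open>g\<^sub>0\<close>
  allows: two of them absorb a factor \<open>1 / f\<close>, and every further differentiation uses
  up two more. About \<open>2 * d\<close> derivatives then make the coefficients summable over a
  lattice of rank \<open>d\<close>. Atorality provides cells up to homeomorphism only, without
  smooth parametrisations, so the non-separation argument has to be topological. It takes place in
  the covering space \<open>real ^ 'd\<close> of the torus, because the factor that makes
  \<open>f\<close> real is a square root of a character and need not be periodic. A logarithmic
  derivative of \<open>f\<close> may itself be divisible by \<open>f\<close>. If this happens in
  every variable, comparison of supports shows that \<open>f\<close> is an integer times a monomial;
  it then has no zeros on the torus, and \<open>g\<^sub>0 = 1\<close> serves.\<close>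

lemma dvd_unit_mult_iff:
  fixes u :: "'a::comm_semiring_1"
  assumes "u dvd 1" shows "a dvd u * b \<longleftrightarrow> a dvd b"
proof
  obtain v where "u * v = 1" using assms by (metis dvdE)
  then have "v * (u * b) = b" by (metis mult.assoc mult.commute mult.left_neutral)
  moreover assume "a dvd u * b"
  ultimately show "a dvd b" by (metis dvd_mult)
qed (rule dvd_mult)

text \<open>Subrings as sets allow a whole tower of Laurent rings to live in one type. By
  \<open>cofactor_mem\<close> quotients by nonzero elements stay inside, so \<open>dvd\<close> and
  \<open>dvd 1\<close> in the ambient domain agree on \<open>A\<close> with divisibility and units
  in \<open>A\<close>.\<close>

locale saturated_subring =
  fixes A :: "'a::idom set"
  assumes zero_mem: "0 \<in> A" and one_mem: "1 \<in> A"
    and add_mem: "a \<in> A \<Longrightarrow> b \<in> A \<Longrightarrow> a + b \<in> A"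
    and diff_mem: "a \<in> A \<Longrightarrow> b \<in> A \<Longrightarrow> a - b \<in> A"
    and mult_mem: "a \<in> A \<Longrightarrow> b \<in> A \<Longrightarrow> a * b \<in> A"
    and cofactor_mem: "a \<in> A \<Longrightarrow> a \<noteq> 0 \<Longrightarrow> a * c \<in> A \<Longrightarrow> c \<in> A"
begin

lemma power_mem: "a \<in> A \<Longrightarrow> a ^ n \<in> A"
  by (induction n) (auto simp: one_mem mult_mem)

lemma sum_mem: "(\<And>i. i \<in> I \<Longrightarrow> g i \<in> A) \<Longrightarrow> (\<Sum>i\<in>I. g i) \<in> A"
  by (induction I rule: infinite_finite_induct) (auto simp: zero_mem add_mem)

lemma prod_mset_mem: "(\<And>p. p \<in># P \<Longrightarrow> p \<in> A) \<Longrightarrow> prod_mset P \<in> A"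
  by (induction P) (auto simp: one_mem mult_mem)

definition prime_in :: "'a \<Rightarrow> bool" where
  "prime_in p \<longleftrightarrow> p \<in> A \<and> p \<noteq> 0 \<and> \<not> p dvd 1 \<and>
     (\<forall>a\<in>A. \<forall>b\<in>A. p dvd a * b \<longrightarrow> p dvd a \<or> p dvd b)"

text \<open>A factorisation into primes, rather than irreducibles, already contains uniqueness. This
  single predicate therefore expresses unique factorisation and can be passed up the tower.\<close>

definition factorable :: "'a \<Rightarrow> bool" where
  "factorable u \<longleftrightarrow> (\<exists>v P. v \<in> A \<and> v dvd 1 \<and> (\<forall>p\<in>#P. prime_in p) \<and> u = v * prod_mset P)"

lemma factorable_unit: "u \<in> A \<Longrightarrow> u dvd 1 \<Longrightarrow> factorable u"
  unfolding factorable_def by (rule exI[of _ u], rule exI[of _ "{#}"]) auto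

lemma factorable_prime: "prime_in u \<Longrightarrow> factorable u"
  unfolding factorable_def by (rule exI[of _ 1], rule exI[of _ "{#u#}"]) (auto simp: one_mem)

lemma factorable_mult:
  assumes "factorable u" "factorable u'" shows "factorable (u * u')"
proof -
  obtain v P v' P' where "v \<in> A" "v dvd 1" "\<forall>p\<in>#P. prime_in p" "u = v * prod_mset P"
    "v' \<in> A" "v' dvd 1" "\<forall>p\<in>#P'. prime_in p" "u' = v' * prod_mset P'"
    using assms unfolding factorable_def by metis
  moreover from this have "v * v' dvd 1"
    using mult_dvd_mono[of v 1 v' 1] by simp
  ultimately show ?thesis unfolding factorable_def
    by (intro exI[of _ "v * v'"] exI[of _ "P + P'"]) (auto simp: mult_mem)
qed

lemma prime_in_dvd_prod_mset:
  assumes "prime_in p" "p dvd prod_mset P" "\<And>q. q \<in># P \<Longrightarrow> q \<in> A"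
  shows "\<exists>q\<in>#P. p dvd q"
  using assms(2,3)
proof (induction P)
  case empty
  then show ?case using assms(1) by (auto simp: prime_in_def)
next
  case (add q P)
  have "q \<in> A" "prod_mset P \<in> A"
    using add.prems by (auto intro!: prod_mset_mem)
  then have "p dvd q \<or> p dvd prod_mset P"
    using add.prems(1) assms(1) by (auto simp: prime_in_def)
  then show ?case using add by auto
qed

section \<open>Polynomials with coefficients in a saturated subring\<close>

definition poly_over :: "'a poly \<Rightarrow> bool" where
  "poly_over p \<longleftrightarrow> (\<forall>i. coeff p i \<in> A)"

lemma poly_over_simps:
  "poly_over 0" "poly_over 1"
  "poly_over p \<Longrightarrow> poly_over q \<Longrightarrow> poly_over (p + q)"
  "poly_over p \<Longrightarrow> poly_over q \<Longrightarrow> poly_over (p - q)"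
  "poly_over p \<Longrightarrow> poly_over q \<Longrightarrow> poly_over (p * q)"
  "a \<in> A \<Longrightarrow> poly_over p \<Longrightarrow> poly_over (smult a p)"
  "a \<in> A \<Longrightarrow> poly_over (monom a n)"
  by (auto simp: poly_over_def zero_mem one_mem add_mem diff_mem mult_mem coeff_mult
      intro!: sum_mem split: if_splits)

lemma poly_over_monom_mult_iff: "poly_over (monom 1 n * p) \<longleftrightarrow> poly_over p"
proof
  assume "poly_over (monom 1 n * p)"
  then have "coeff (monom 1 n * p) (n + i) \<in> A" for i
    by (simp add: poly_over_def)
  then show "poly_over p"
    by (simp add: poly_over_def coeff_monom_mult)
qed (simp add: poly_over_simps one_mem)

lemma pseudo_division:
  assumes r: "poly_over r" "r \<noteq> 0" and p: "poly_over p"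
  shows "\<exists>c q s. c \<in> A \<and> c \<noteq> 0 \<and> poly_over q \<and> poly_over s \<and> smult c p = q * r + s \<and>
    (s = 0 \<or> degree s < degree r)"
  using p
proof (induction "degree p" arbitrary: p rule: less_induct)
  case less
  show ?case
  proof (cases "p = 0 \<or> degree p < degree r")
    case True
    then show ?thesis
      by (intro exI[of _ 1] exI[of _ 0] exI[of _ p])
         (auto simp: less.prems poly_over_simps one_mem)
  next
    case False
    define k where "k = degree p - degree r"
    define p' where "p' = smult (lead_coeff r) p - monom (lead_coeff p) k * r"
    have lc: "lead_coeff r \<in> A" "lead_coeff p \<in> A"
      using r less.prems by (auto simp: poly_over_def)
    have p': "poly_over p'"
      unfolding p'_def using r less.prems lc by (intro poly_over_simps) auto
    have deg_le: "degree p' \<le> degree p"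
      unfolding p'_def
      using False degree_mult_le[of "monom (lead_coeff p) k" r] degree_monom_le[of "lead_coeff p" k]
      by (intro degree_diff_le) (auto simp: k_def)
    have "coeff p' (degree p) = 0"
      using False by (simp add: p'_def k_def coeff_monom_mult)
    then have "p' = 0 \<or> degree p' < degree p"
      using deg_le by (metis le_neq_implies_less leading_coeff_0_iff)
    then consider "p' = 0" | "degree p' < degree p" by blast
    then obtain c q s where s: "c \<in> A" "c \<noteq> 0" "poly_over q" "poly_over s"
      "smult c p' = q * r + s" "s = 0 \<or> degree s < degree r"
    proof cases
      case 1
      then show ?thesis using that[of 1 0 0] by (auto simp: poly_over_simps one_mem)
    next
      case 2
      then show ?thesis using less.hyps[OF 2 p'] that by blast
    qed
    have "smult (c * lead_coeff r) p = (q + smult c (monom (lead_coeff p) k)) * r + s"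
      using s(5) by (simp add: p'_def smult_diff_right algebra_simps)
    moreover have "poly_over (q + smult c (monom (lead_coeff p) k))"
      using s lc by (intro poly_over_simps) auto
    moreover have "c * lead_coeff r \<in> A" "c * lead_coeff r \<noteq> 0"
      using s r lc by (auto intro: mult_mem)
    ultimately show ?thesis using s by blast
  qed
qed

text \<open>Gauss's lemma. With \<open>i\<close> and \<open>j\<close> the least indices at which
  \<open>p\<close> does not divide the coefficient of \<open>F\<close> and of \<open>G\<close>,
  every term of \<open>coeff (F * G) (i + j)\<close> other than \<open>coeff F i * coeff G j\<close>
  is divisible by \<open>p\<close>.\<close>

lemma prime_in_dvd_coeffs:
  assumes p: "prime_in p" and "poly_over F" "poly_over G"
    and dvd: "\<And>i. p dvd coeff (F * G) i"
  shows "(\<forall>i. p dvd coeff F i) \<or> (\<forall>i. p dvd coeff G i)"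
proof (rule ccontr)
  assume not: "\<not> ?thesis"
  define i where "i = (LEAST i. \<not> p dvd coeff F i)"
  define j where "j = (LEAST j. \<not> p dvd coeff G j)"
  have i: "\<not> p dvd coeff F i" "\<And>k. k < i \<Longrightarrow> p dvd coeff F k"
    using not LeastI_ex[of "\<lambda>i. \<not> p dvd coeff F i"] not_less_Least unfolding i_def by blast+
  have j: "\<not> p dvd coeff G j" "\<And>k. k < j \<Longrightarrow> p dvd coeff G k"
    using not LeastI_ex[of "\<lambda>i. \<not> p dvd coeff G i"] not_less_Least unfolding j_def by blast+
  have "coeff (F * G) (i + j) =
      coeff F i * coeff G j + (\<Sum>k\<in>{..i+j}-{i}. coeff F k * coeff G (i + j - k))"
    unfolding coeff_mult by (subst sum.remove[of _ i]) auto
  moreover have "p dvd (\<Sum>k\<in>{..i+j}-{i}. coeff F k * coeff G (i + j - k))"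
  proof (rule dvd_sum)
    fix k assume "k \<in> {..i+j} - {i}"
    then have "k < i \<or> i + j - k < j" by auto
    then show "p dvd coeff F k * coeff G (i + j - k)"
      using i(2) j(2) by (auto intro: dvd_mult dvd_mult2)
  qed
  ultimately have "p dvd coeff F i * coeff G j"
    using dvd[of "i + j"] by (simp add: dvd_add_left_iff)
  then show False
    using p i(1) j(1) assms(2,3) unfolding prime_in_def poly_over_def by blast
qed

end

section \<open>Adjoining one invertible variable\<close>

text \<open>\<open>B\<close> is \<open>A[x, 1/x]\<close> inside the ambient domain, with
  \<open>y\<close> in the role of \<open>1/x\<close>. The assumption \<open>factorable_base\<close>
  is the induction hypothesis for a tower of such extensions.\<close>

locale laurent_extension = A: saturated_subring A + B: saturated_subring B
  for A B :: "'a::idom set" +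
  fixes x y :: 'a
  assumes sub: "A \<subseteq> B" and x_mem: "x \<in> B" and y_mem: "y \<in> B" and xy: "x * y = 1"
    and representable: "b \<in> B \<Longrightarrow> \<exists>m p. A.poly_over p \<and> x ^ m * b = poly p x"
    and transcendental: "A.poly_over p \<Longrightarrow> poly p x = 0 \<Longrightarrow> p = 0"
    and factorable_base: "\<And>a. a \<in> A \<Longrightarrow> a \<noteq> 0 \<Longrightarrow> A.factorable a"
begin

lemma x_nonzero: "x \<noteq> 0" using xy by auto

lemma x_power_unit: "x ^ n dvd 1"
  by (metis dvd_triv_left power_mult_distrib power_one xy)

lemma poly_mem: "A.poly_over p \<Longrightarrow> poly p x \<in> B"
  unfolding poly_altdef A.poly_over_def
  using sub x_mem by (auto intro!: B.sum_mem B.mult_mem B.power_mem)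

lemma poly_inject: "A.poly_over p \<Longrightarrow> A.poly_over q \<Longrightarrow> poly p x = poly q x \<Longrightarrow> p = q"
  using transcendental[of "p - q"] by (simp add: A.poly_over_simps)

text \<open>The cofactor may contain negative powers of \<open>x\<close>. Once \<open>x ^ m\<close>
  has cleared them, transcendence of \<open>x\<close> permits a comparison of coefficients, shifted
  by \<open>m\<close>.\<close>

lemma dvd_poly_imp_dvd_coeff:
  assumes a: "a \<in> A" "a \<noteq> 0" and F: "A.poly_over F" and dvd: "a dvd poly F x"
  shows "a dvd coeff F i"
proof -
  obtain c where c: "poly F x = a * c" using dvd by blast
  then have "c \<in> B"
    using a sub poly_mem[OF F] by (auto intro: B.cofactor_mem[of a])
  then obtain m C where C: "A.poly_over C" "x ^ m * c = poly C x"
    using representable by blast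
  have "poly (monom 1 m * F) x = poly (smult a C) x"
    using c C(2) by (simp add: poly_monom algebra_simps)
  then have "monom 1 m * F = smult a C"
    using F C a by (intro poly_inject) (simp_all add: A.poly_over_simps A.one_mem)
  then have "coeff (monom 1 m * F) (m + i) = coeff (smult a C) (m + i)" by simp
  then have "coeff F i = a * coeff C (m + i)" by (simp add: coeff_monom_mult)
  then show ?thesis by simp
qed

lemma dvd_poly_iff:
  assumes "a \<in> A" "a \<noteq> 0" "A.poly_over F"
  shows "a dvd poly F x \<longleftrightarrow> (\<forall>i. a dvd coeff F i)"
  using dvd_poly_imp_dvd_coeff[OF assms] by (auto simp: poly_altdef intro!: dvd_sum)

lemma dvd_x_power_mult_iff: "a dvd x ^ m * b \<longleftrightarrow> a dvd b"
  by (rule dvd_unit_mult_iff[OF x_power_unit])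

lemma prime_in_extension:
  assumes p: "A.prime_in p" shows "B.prime_in p"
proof -
  have "p dvd a \<or> p dvd b" if ab: "a \<in> B" "b \<in> B" and dvd: "p dvd a * b" for a b
  proof -
    obtain m n F G where F: "A.poly_over F" "x ^ m * a = poly F x"
      and G: "A.poly_over G" "x ^ n * b = poly G x"
      using representable ab by meson
    have "poly (F * G) x = x ^ (m + n) * (a * b)"
      by (simp add: F(2)[symmetric] G(2)[symmetric] power_add mult_ac)
    then have "p dvd poly (F * G) x" using dvd by simp
    then have "p dvd coeff (F * G) i" for i
      using p F(1) G(1) by (intro dvd_poly_imp_dvd_coeff) (auto simp: A.poly_over_simps A.prime_in_def)
    then have "p dvd poly F x \<or> p dvd poly G x"
      using A.prime_in_dvd_coeffs[OF p F(1) G(1)] p F(1) G(1)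
      by (auto simp: dvd_poly_iff A.prime_in_def)
    then show ?thesis by (simp add: F(2)[symmetric] G(2)[symmetric] dvd_x_power_mult_iff)
  qed
  then show ?thesis
    using p sub unfolding A.prime_in_def B.prime_in_def by auto
qed

definition primitive :: "'a \<Rightarrow> bool" where
  "primitive f \<longleftrightarrow> f \<in> B \<and> f \<noteq> 0 \<and> (\<forall>p. A.prime_in p \<longrightarrow> \<not> p dvd f)"

text \<open>Each prime in \<open>P\<close> remains prime in \<open>B\<close>, so it can be cancelled
  against \<open>q\<close> or against \<open>r\<close>; \<open>c\<close> and \<open>d\<close>
  collect what is taken from either. In this way a factorisation of \<open>f\<close> up to constants
  becomes one of \<open>f\<close> itself, without passing to a fraction field.\<close>

lemma primitive_split_primes:
  assumes f: "primitive f" and P: "\<forall>p\<in>#P. A.prime_in p"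
    and eq: "prod_mset P * f = q * r" and qr: "q \<in> B" "r \<in> B"
  shows "\<exists>c d q' r'. c \<in> A \<and> d \<in> A \<and> c \<noteq> 0 \<and> d \<noteq> 0 \<and> q' \<in> B \<and> r' \<in> B \<and>
     q = c * q' \<and> r = d * r' \<and> f = q' * r'"
  using P eq qr
proof (induction P arbitrary: q r)
  case empty
  then show ?case
    by (intro exI[of _ 1] exI[of _ 1] exI[of _ q] exI[of _ r]) (simp add: A.one_mem)
next
  case (add p P)
  have p: "A.prime_in p" "p \<in> A" "p \<in> B" "p \<noteq> 0"
    using add.prems sub by (auto simp: A.prime_in_def)
  have "p dvd q * r"
    using add.prems(2) by (metis dvd_triv_left mult.assoc prod_mset.add_mset)
  then have "p dvd q \<or> p dvd r"
    using prime_in_extension[OF p(1)] add.prems unfolding B.prime_in_def by blast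
  then show ?case
  proof
    assume "p dvd q"
    then obtain q1 where q1: "q = p * q1" by blast
    then have "q1 \<in> B" using p add.prems B.cofactor_mem by blast
    moreover have "prod_mset P * f = q1 * r"
      using add.prems(2) p(4) by (simp add: q1 mult.assoc)
    ultimately obtain c d q' r' where *: "c \<in> A" "d \<in> A" "c \<noteq> 0" "d \<noteq> 0" "q' \<in> B" "r' \<in> B"
      "q1 = c * q'" "r = d * r'" "f = q' * r'"
      using add.IH[of q1 r] add.prems by auto
    then show ?thesis using p q1
      by (intro exI[of _ "p * c"] exI[of _ d] exI[of _ q'] exI[of _ r'])
         (auto simp: A.mult_mem mult.assoc)
  next
    assume "p dvd r"
    then obtain r1 where r1: "r = p * r1" by blast
    then have "r1 \<in> B" using p add.prems B.cofactor_mem by blast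
    moreover have "prod_mset P * f = q * r1"
      using add.prems(2) p(4) by (simp add: r1 mult.assoc mult.left_commute[of q])
    ultimately obtain c d q' r' where *: "c \<in> A" "d \<in> A" "c \<noteq> 0" "d \<noteq> 0" "q' \<in> B" "r' \<in> B"
      "q = c * q'" "r1 = d * r'" "f = q' * r'"
      using add.IH[of q r1] add.prems by auto
    then show ?thesis using p r1
      by (intro exI[of _ c] exI[of _ "p * d"] exI[of _ q'] exI[of _ r'])
         (auto simp: A.mult_mem mult.assoc)
  qed
qed

lemma primitive_split:
  assumes f: "primitive f" and c: "c \<in> A" "c \<noteq> 0"
    and eq: "c * f = q * r" and qr: "q \<in> B" "r \<in> B"
  shows "\<exists>c d q' r'. c \<in> A \<and> d \<in> A \<and> c \<noteq> 0 \<and> d \<noteq> 0 \<and> q' \<in> B \<and> r' \<in> B \<and>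
     q = c * q' \<and> r = d * r' \<and> f = q' * r'"
proof -
  obtain v P where P: "v \<in> A" "v dvd 1" "\<forall>p\<in>#P. A.prime_in p" "c = v * prod_mset P"
    using factorable_base[OF c] unfolding A.factorable_def by blast
  obtain w where w: "v * w = 1" using P(2) by (metis dvdE)
  have "w \<in> A" using P w A.one_mem c by (intro A.cofactor_mem[of v w]) auto
  then have "w * q \<in> B" using sub qr by (auto intro: B.mult_mem)
  moreover have "prod_mset P * f = (w * q) * r"
  proof -
    have "(w * q) * r = (v * w) * (prod_mset P * f)"
      using eq unfolding P(4) by (simp add: mult_ac)
    then show ?thesis by (simp add: w)
  qed
  ultimately obtain c d q' r' where *: "c \<in> A" "d \<in> A" "c \<noteq> 0" "d \<noteq> 0" "q' \<in> B" "r' \<in> B"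
     "w * q = c * q'" "r = d * r'" "f = q' * r'"
    using primitive_split_primes[OF f P(3), of "w * q" r] qr by blast
  have "q = (v * c) * q'"
    using *(7) w by (metis mult.assoc mult.left_neutral)
  moreover have "v * c \<noteq> 0" "v * c \<in> A" using * P w by (auto intro: A.mult_mem)
  ultimately show ?thesis using * by blast
qed

text \<open>A prime of \<open>A\<close> dividing \<open>f * k\<close> divides \<open>k\<close>,
  since it is prime in \<open>B\<close> and does not divide the primitive \<open>f\<close>. So the
  primes in \<open>c\<close> can be cancelled one at a time.\<close>

lemma primitive_cancel:
  assumes f: "primitive f" and c: "c \<in> A" "c \<noteq> 0" and h: "h \<in> B" and dvd: "f dvd c * h"
  shows "f dvd h"
proof -
  obtain v P where P: "v dvd 1" "\<forall>p\<in>#P. A.prime_in p" "c = v * prod_mset P"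
    using factorable_base[OF c] unfolding A.factorable_def by blast
  have "f dvd prod_mset P * h"
    using dvd dvd_unit_mult_iff[OF P(1)] P(3) by (simp add: mult.assoc)
  with P(2) show ?thesis
  proof (induction P)
    case (add p P)
    have p: "A.prime_in p" "p \<in> B" "p \<noteq> 0"
      using add.prems sub by (auto simp: A.prime_in_def)
    obtain k where k: "p * (prod_mset P * h) = f * k"
      using add.prems(2) by (metis dvdE mult.assoc prod_mset.add_mset)
    have PB: "prod_mset P * h \<in> B"
      using add.prems h sub by (auto simp: A.prime_in_def intro!: B.mult_mem B.prod_mset_mem)
    then have "f * k \<in> B"
      using p by (simp add: k[symmetric] B.mult_mem)
    then have "k \<in> B" using f B.cofactor_mem[of f k] by (auto simp: primitive_def)
    then have "p dvd k"
      using prime_in_extension[OF p(1)] p(1) f k unfolding B.prime_in_def primitive_def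
      by (metis dvd_triv_left)
    then obtain k' where "k = p * k'" by blast
    then have "prod_mset P * h = f * k'"
      using k p(3) by (simp add: mult.left_commute[of f])
    then have "f dvd prod_mset P * h" by simp
    then show ?case using add by simp
  qed simp
qed

text \<open>For \<open>f dvd g * h\<close>, pseudo-division by an element \<open>r\<close> of minimal degree in the ideal \<open>(f, g)\<close> shows
  that \<open>r\<close> divides both \<open>f\<close> and \<open>g\<close> up to constants of \<open>A\<close>, and \<open>f\<close> is coprime to these constants. So no
  greatest common divisors or contents are needed.\<close>

lemma primitive_irreducible_imp_prime:
  assumes f: "primitive f" and nu: "\<not> f dvd 1"
    and irr: "\<And>a b. a \<in> B \<Longrightarrow> b \<in> B \<Longrightarrow> f = a * b \<Longrightarrow> a dvd 1 \<or> b dvd 1"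
  shows "B.prime_in f"
proof -
  have fB: "f \<in> B" "f \<noteq> 0" using f by (auto simp: primitive_def)
  have "f dvd g \<or> f dvd h" if gh: "g \<in> B" "h \<in> B" and dvd: "f dvd g * h" for g h
  proof -
    define ideal where "ideal u \<longleftrightarrow> (\<exists>a\<in>B. \<exists>b\<in>B. u = a * f + b * g)" for u
    have ideal_f: "ideal f" unfolding ideal_def
      by (rule bexI[of _ 1], rule bexI[of _ 0]) (auto simp: B.one_mem B.zero_mem)
    have ideal_g: "ideal g" unfolding ideal_def
      by (rule bexI[of _ 0], rule bexI[of _ 1]) (auto simp: B.one_mem B.zero_mem)
    have ideal_mult: "ideal (c * u)" if u: "ideal u" and c: "c \<in> B" for c u
    proof -
      obtain a b where "a \<in> B" "b \<in> B" "u = a * f + b * g"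
        using u unfolding ideal_def by blast
      then show ?thesis using c unfolding ideal_def
        by (intro bexI[of _ "c * a"] bexI[of _ "c * b"]) (auto simp: B.mult_mem algebra_simps)
    qed
    have ideal_diff: "ideal (u - u')" if ii: "ideal u" "ideal u'" for u u'
    proof -
      obtain a b a' b' where "a \<in> B" "b \<in> B" "u = a * f + b * g" "a' \<in> B" "b' \<in> B" "u' = a' * f + b' * g"
        using ii unfolding ideal_def by blast
      then show ?thesis unfolding ideal_def
        by (intro bexI[of _ "a - a'"] bexI[of _ "b - b'"]) (auto simp: B.diff_mem algebra_simps)
    qed
    have ideal_dvd: "f dvd u * h" if "ideal u" for u
    proof -
      obtain a b where "u = a * f + b * g" using \<open>ideal u\<close> by (auto simp: ideal_def)
      then have "u * h = f * (a * h) + b * (g * h)" by (simp add: algebra_simps)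
      then show ?thesis using dvd by (auto intro: dvd_add dvd_mult)
    qed
    define Rs where "Rs = {r. A.poly_over r \<and> r \<noteq> 0 \<and> ideal (poly r x)}"
    obtain mF F where F: "A.poly_over F" "x ^ mF * f = poly F x"
      using representable fB by blast
    obtain mG G where G: "A.poly_over G" "x ^ mG * g = poly G x"
      using representable gh by blast
    have "F \<in> Rs" using F fB x_nonzero ideal_mult[OF ideal_f B.power_mem[OF x_mem], of mF]
      by (auto simp: Rs_def)
    then obtain r where r: "r \<in> Rs" "\<And>s. s \<in> Rs \<Longrightarrow> degree r \<le> degree s"
      using ex_has_least_nat[of "\<lambda>r. r \<in> Rs" F degree] by auto
    have rA: "A.poly_over r" "r \<noteq> 0" "ideal (poly r x)" using r by (auto simp: Rs_def)
    have reduce: "\<exists>c q. c \<in> A \<and> c \<noteq> 0 \<and> A.poly_over q \<and> smult c p = q * r"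
      if p: "A.poly_over p" "ideal (poly p x)" for p
    proof -
      obtain c q s where s: "c \<in> A" "c \<noteq> 0" "A.poly_over q" "A.poly_over s" "smult c p = q * r + s"
        "s = 0 \<or> degree s < degree r"
        using A.pseudo_division[OF rA(1,2) p(1)] by blast
      have "poly s x = c * poly p x - poly q x * poly r x"
        using arg_cong[OF s(5), of "\<lambda>p. poly p x"] by simp
      then have "ideal (poly s x)"
        using s sub p rA by (auto intro!: ideal_diff ideal_mult poly_mem)
      then have "s \<in> Rs" if "s \<noteq> 0" using that s(4) by (simp add: Rs_def)
      then have "s = 0" using r(2)[of s] s(6) by fastforce
      then show ?thesis using s by auto
    qed
    have "ideal (poly F x)"
      using ideal_mult[OF ideal_f B.power_mem[OF x_mem], of mF] F by simp
    then obtain c q where cq: "c \<in> A" "c \<noteq> 0" "A.poly_over q" "smult c F = q * r"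
      using reduce F by blast
    have "c * f = (y ^ mF * poly q x) * poly r x"
    proof -
      have "c * (x ^ mF * f) = poly q x * poly r x"
        using arg_cong[OF cq(4), of "\<lambda>p. poly p x"] F by simp
      then have "y ^ mF * (poly q x * poly r x) = (x * y) ^ mF * (c * f)"
        by (simp only: power_mult_distrib) (metis mult.assoc mult.commute)
      then show ?thesis by (simp add: xy mult.assoc)
    qed
    moreover have "y ^ mF * poly q x \<in> B" "poly r x \<in> B"
      using cq rA by (auto intro!: B.mult_mem B.power_mem y_mem poly_mem)
    ultimately obtain c1 d q' r' where "c1 \<in> A \<and> d \<in> A \<and> c1 \<noteq> 0 \<and> d \<noteq> 0 \<and> q' \<in> B \<and> r' \<in> B \<and>
      y ^ mF * poly q x = c1 * q' \<and> poly r x = d * r' \<and> f = q' * r'"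
      using primitive_split[OF f cq(1,2)] by blast
    then have *: "d \<in> A" "d \<noteq> 0" "q' \<in> B" "r' \<in> B" "poly r x = d * r'" "f = q' * r'"
      by auto
    \<comment> \<open>If \<open>r'\<close> is a unit, the constant \<open>d\<close> lies in the
      ideal, hence \<open>f\<close> divides \<open>d * h\<close> and then \<open>h\<close>. If
      \<open>q'\<close> is a unit, \<open>f\<close> is an associate of \<open>r'\<close>, which
      divides \<open>g\<close> up to a constant.\<close>
    consider "q' dvd 1" | "r' dvd 1" using irr * by blast
    then show ?thesis
    proof cases
      case 2
      then obtain s where s: "1 = r' * s" by blast
      then have "s \<in> B" using * s B.one_mem by (intro B.cofactor_mem[of r' s]) auto
      have "d = s * poly r x" using * s by (metis mult.assoc mult.commute mult.right_neutral)
      then have "ideal d" using ideal_mult rA \<open>s \<in> B\<close> by metis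
      then have "f dvd h" using primitive_cancel[OF f] * gh ideal_dvd by blast
      then show ?thesis ..
    next
      case 1
      have "ideal (poly G x)"
        using ideal_mult[OF ideal_g B.power_mem[OF x_mem], of mG] G by simp
      then obtain e k where e: "e \<in> A" "e \<noteq> 0" "A.poly_over k" "smult e G = k * r"
        using reduce G by blast
      have "f dvd r'" using dvd_unit_mult_iff[OF 1, of f r'] * by simp
      then have "f dvd poly k x * poly r x" by (metis *(5) dvd_mult)
      then have "f dvd x ^ mG * (e * g)"
        using arg_cong[OF e(4), of "\<lambda>p. poly p x"] G by (simp add: mult.left_commute)
      then have "f dvd g"
        using primitive_cancel[OF f] e gh by (simp add: dvd_x_power_mult_iff)
      then show ?thesis ..
    qed
  qed
  then show ?thesis using fB nu by (auto simp: B.prime_in_def)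
qed

text \<open>Powers of \<open>x\<close> are units, so a polynomial representing \<open>b\<close> is
  determined only up to such powers. A nonzero constant coefficient singles one out
  (\<open>normalized_product\<close>) and gives \<open>b\<close> a degree.\<close>

lemma representable_normalized:
  assumes "b \<in> B" "b \<noteq> 0"
  shows "\<exists>m n p. A.poly_over p \<and> coeff p 0 \<noteq> 0 \<and> x ^ m * b = x ^ n * poly p x"
proof -
  obtain m p where p: "A.poly_over p" "x ^ m * b = poly p x" using representable assms by blast
  have "p \<noteq> 0" using p assms x_nonzero by auto
  obtain p' where p': "p = monom 1 (order 0 p) * p'"
    using order_1[of 0 p] by (auto simp: monom_altdef)
  have "\<not> [:-0, 1:] ^ Suc (order 0 p) dvd p" using \<open>p \<noteq> 0\<close> order_2 by blast
  moreover have "[:-0, 1:] ^ Suc (order 0 p) dvd p" if "coeff p' 0 = 0"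
  proof -
    have "[:-0, 1:] dvd p'" using that by (simp add: dvd_iff_poly_eq_0 poly_0_coeff_0)
    then have "[:-0, 1:] ^ order 0 p * [:-0, 1:] dvd [:-0, 1:] ^ order 0 p * p'"
      by (intro mult_dvd_mono) auto
    also have "[:-0, 1:] ^ order 0 p * p' = p" using p' by (simp add: monom_altdef)
    finally show ?thesis by (simp only: power_Suc2)
  qed
  ultimately have "coeff p' 0 \<noteq> 0" by blast
  moreover have "A.poly_over p'" using p(1) p' A.poly_over_monom_mult_iff by metis
  moreover have "x ^ m * b = x ^ order 0 p * poly p' x"
    using p(2) arg_cong[OF p', of "\<lambda>p. poly p x"] by (simp add: poly_monom)
  ultimately show ?thesis by blast
qed

lemma normalized_product:
  assumes "A.poly_over U" "A.poly_over V" "coeff U 0 \<noteq> 0" "coeff V 0 \<noteq> 0"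
    and eq: "x ^ m * poly U x = x ^ n * poly V x"
  shows "U = V"
proof -
  have "monom 1 m * U = monom 1 n * V"
    using assms by (intro poly_inject) (simp_all add: poly_monom A.poly_over_simps A.one_mem)
  moreover have "coeff (monom 1 m * U) (min m n) = (if m \<le> n then coeff U 0 else 0)"
     "coeff (monom 1 n * V) (min m n) = (if n \<le> m then coeff V 0 else 0)"
    by (auto simp: coeff_monom_mult)
  ultimately have "m = n" using assms(3,4)
    by (metis nle_le)
  then show ?thesis using \<open>monom 1 m * U = monom 1 n * V\<close> by (simp add: monom_eq_0_iff)
qed

text \<open>Two nested inductions: on the degree, and in fixed degree on the number of primes in the
  leading coefficient. If a prime of \<open>A\<close> divides the polynomial, splitting it off uses
  up one of these primes. Otherwise the polynomial is primitive, and it is a unit, a prime, or a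
  product of polynomials of smaller degree.\<close>

lemma factorable_poly:
  assumes "A.poly_over U" "coeff U 0 \<noteq> 0"
  shows "B.factorable (poly U x)"
  using assms
proof (induction "degree U" arbitrary: U rule: less_induct)
  case (less U)
  have "B.factorable (poly W x)"
    if "\<forall>p\<in>#P. A.prime_in p" "v \<in> A" "v dvd 1" "lead_coeff W = v * prod_mset P" "A.poly_over W"
      "coeff W 0 \<noteq> 0" "degree W = degree U" for W v P
    using that
  proof (induction "size P" arbitrary: P W v rule: less_induct)
    case (less P W v)
    note outer = \<open>\<And>U'. degree U' < degree U \<Longrightarrow> A.poly_over U' \<Longrightarrow> coeff U' 0 \<noteq> 0 \<Longrightarrow> B.factorable (poly U' x)\<close>
    have WB: "poly W x \<in> B" "poly W x \<noteq> 0"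
      using poly_mem[OF \<open>A.poly_over W\<close>] transcendental[OF \<open>A.poly_over W\<close>] less.prems by auto
    show ?case
    proof (cases "\<exists>p. A.prime_in p \<and> p dvd poly W x")
      case True
      then obtain p where p: "A.prime_in p" "p dvd poly W x" by blast
      have pA: "p \<in> A" "p \<noteq> 0" "\<not> p dvd 1" using p by (auto simp: A.prime_in_def)
      have dv: "p dvd coeff W i" for i
        using dvd_poly_imp_dvd_coeff[OF pA(1,2) \<open>A.poly_over W\<close> p(2)] .
      then have "[:p:] dvd W" by (simp add: const_poly_dvd_iff)
      then obtain W' where W': "W = smult p W'" by (auto elim: dvdE)
      have W'A: "A.poly_over W'"
        using \<open>A.poly_over W\<close> A.cofactor_mem[OF pA(1,2)] by (auto simp: A.poly_over_def W')
      have "p dvd prod_mset P"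
        using dv[of "degree W"] dvd_unit_mult_iff[OF less.prems(3)] less.prems(4) by simp
      then obtain q where q: "q \<in># P" "p dvd q"
        using A.prime_in_dvd_prod_mset[OF p(1)] less.prems(1) by (auto simp: A.prime_in_def)
      then obtain t where t: "q = p * t" by blast
      have qp: "A.prime_in q" using q less.prems by blast
      then have qA: "q \<in> A" "q \<noteq> 0" by (auto simp: A.prime_in_def)
      then have tA: "t \<in> A" "t \<noteq> 0" using t qA pA by (auto intro: A.cofactor_mem[of p t])
      \<comment> \<open>Since both are prime, \<open>p\<close> and \<open>q\<close> differ by the
        factor \<open>t\<close> only, which turns out to be a unit and is absorbed into
        \<open>v\<close>.\<close>
      have "\<not> q dvd t"
      proof
        assume "q dvd t"
        then obtain s where "t = q * s" by blast
        then have "t * 1 = t * (p * s)" using t by (simp add: mult_ac)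
        then have "1 = p * s" using tA by (metis mult_left_cancel)
        then show False using pA by (metis dvd_triv_left)
      qed
      moreover have "q dvd p \<or> q dvd t"
        using qp pA tA t unfolding A.prime_in_def by (metis dvd_refl)
      ultimately obtain s where "p = q * s" by (auto elim: dvdE)
      then have "p * 1 = p * (t * s)" using t by (simp add: mult_ac)
      then have "1 = t * s" using pA by (metis mult_left_cancel)
      then have tu: "t dvd 1" by (metis dvd_triv_left)
      have PQ: "prod_mset P = q * prod_mset (P - {#q#})"
        using q(1) by (metis insert_DiffM prod_mset.add_mset)
      have "p * lead_coeff W' = lead_coeff W" using pA by (simp add: W')
      also have "\<dots> = v * ((p * t) * prod_mset (P - {#q#}))"
        by (simp only: less.prems(4) PQ t[symmetric])
      finally have "p * lead_coeff W' = p * ((v * t) * prod_mset (P - {#q#}))"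
        by (simp only: mult_ac)
      then have lc: "lead_coeff W' = (v * t) * prod_mset (P - {#q#})"
        using pA by (metis mult_left_cancel)
      have "B.factorable (poly W' x)"
      proof (rule less.hyps[of "P - {#q#}" "v * t" W'])
        show "size (P - {#q#}) < size P" using q by (simp add: size_Diff1_less)
        show "\<forall>p\<in>#P - {#q#}. A.prime_in p" using less.prems(1) by (meson in_diffD)
        show "v * t dvd 1" using mult_dvd_mono[OF less.prems(3) tu] by simp
      qed (use lc less.prems tA W'A W' pA in \<open>auto intro: A.mult_mem\<close>)
      moreover have "poly W x = p * poly W' x" by (simp add: W')
      ultimately show ?thesis
        using B.factorable_mult B.factorable_prime prime_in_extension p(1) by metis
    next
      case False
      then have prim: "primitive (poly W x)" using WB by (auto simp: primitive_def)
      show ?thesis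
      proof (cases "poly W x dvd 1")
        case True
        then show ?thesis using WB B.factorable_unit by blast
      next
        case nu: False
        show ?thesis
        proof (cases "\<forall>a\<in>B. \<forall>b\<in>B. poly W x = a * b \<longrightarrow> a dvd 1 \<or> b dvd 1")
          case True
          then show ?thesis
            using primitive_irreducible_imp_prime[OF prim nu] B.factorable_prime by blast
        next
          case notirr: False
          then obtain a b where ab: "a \<in> B" "b \<in> B" "poly W x = a * b" "\<not> a dvd 1" "\<not> b dvd 1"
            by blast
          have "a \<noteq> 0" "b \<noteq> 0" using ab WB by auto
          obtain m n F where F: "A.poly_over F" "coeff F 0 \<noteq> 0" "x ^ m * a = x ^ n * poly F x"
            using representable_normalized[OF ab(1) \<open>a \<noteq> 0\<close>] by blast
          obtain k l G where G: "A.poly_over G" "coeff G 0 \<noteq> 0" "x ^ k * b = x ^ l * poly G x"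
            using representable_normalized[OF ab(2) \<open>b \<noteq> 0\<close>] by blast
          have WFG: "W = F * G"
          proof (rule normalized_product[of _ _ "m + k" "n + l"])
            have "x ^ (m + k) * poly W x = (x ^ m * a) * (x ^ k * b)"
              by (simp add: ab power_add mult_ac)
            also have "\<dots> = (x ^ n * poly F x) * (x ^ l * poly G x)"
              by (simp only: F(3) G(3))
            finally show "x ^ (m + k) * poly W x = x ^ (n + l) * poly (F * G) x"
              by (simp add: power_add mult_ac)
          qed (use F G less.prems in \<open>auto simp: A.poly_over_simps coeff_mult_0\<close>)
          \<comment> \<open>A nonunit factor of degree 0 is a constant of \<open>A\<close> and
            contains a prime of \<open>A\<close>, against primitivity. Hence both factors have
            positive degree, and thus smaller degree than the product.\<close>
          have pos: "degree K > 0"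
            if K: "A.poly_over K" "coeff K 0 \<noteq> 0" "poly K x dvd poly W x" "\<not> poly K x dvd 1" for K
          proof (rule ccontr)
            assume "\<not> degree K > 0"
            then obtain c where c: "K = [:c:]" using degree_eq_zeroE by blast
            then have "c \<in> A" "c \<noteq> 0" using K(1,2) by (auto simp: A.poly_over_def coeff_pCons split: nat.splits)
            then obtain v P where "v dvd 1" "\<forall>p\<in>#P. A.prime_in p" "c = v * prod_mset P"
              using factorable_base unfolding A.factorable_def by blast
            moreover have "P \<noteq> {#}" using calculation K c by auto
            ultimately obtain p where "A.prime_in p" "p dvd c"
              by (metis dvd_mult dvd_prod_mset multiset_nonemptyE)
            then show False using False K c by (auto intro: dvd_trans)
          qed
          have "poly F x dvd 1 \<longleftrightarrow> a dvd 1"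
            using F(3) by (metis dvd_triv_left dvd_trans mult.commute dvd_x_power_mult_iff mult_unit_dvd_iff x_power_unit)
          moreover have "poly G x dvd 1 \<longleftrightarrow> b dvd 1"
            using G(3) by (metis dvd_triv_left dvd_trans mult.commute dvd_x_power_mult_iff mult_unit_dvd_iff x_power_unit)
          ultimately have "degree F > 0" "degree G > 0"
            using pos[of F] pos[of G] F G ab by (auto simp: WFG)
          moreover have "degree W = degree F + degree G"
            using F(2) G(2) WFG by (metis coeff_0 degree_mult_eq)
          ultimately have "degree F < degree U" "degree G < degree U"
            using less.prems by auto
          then have "B.factorable (poly F x)" "B.factorable (poly G x)"
            using outer F G by blast+
          then show ?thesis using B.factorable_mult by (simp add: WFG)
        qed
      qed
    qed
  qed
  moreover have "lead_coeff U \<in> A" "lead_coeff U \<noteq> 0"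
    using less.prems by (auto simp: A.poly_over_def)
  then obtain v P where "v \<in> A" "v dvd 1" "\<forall>p\<in>#P. A.prime_in p" "lead_coeff U = v * prod_mset P"
    using factorable_base unfolding A.factorable_def by blast
  ultimately show ?case using less.prems by blast
qed

theorem factorable_extension:
  assumes "b \<in> B" "b \<noteq> 0" shows "B.factorable b"
proof -
  obtain m n p where p: "A.poly_over p" "coeff p 0 \<noteq> 0" "x ^ m * b = x ^ n * poly p x"
    using representable_normalized assms by blast
  have "y ^ m * (x ^ m * b) = (x * y) ^ m * b" by (simp only: power_mult_distrib mult_ac)
  then have "b = (y ^ m * x ^ n) * poly p x"
    by (simp add: p(3) xy mult.assoc)
  moreover have "y ^ m * x ^ n dvd 1"
    by (metis dvd_triv_right mult_dvd_mono mult_1 power_mult_distrib power_one x_power_unit xy)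
  moreover have "y ^ m * x ^ n \<in> B" by (intro B.mult_mem B.power_mem x_mem y_mem)
  ultimately show ?thesis
    using B.factorable_mult[OF B.factorable_unit factorable_poly[OF p(1,2)]] by metis
qed

end

subsection \<open>Laurent polynomial rings\<close>

abbreviation lookup where "lookup \<equiv> Poly_Mapping.lookup"
abbreviation keys where "keys \<equiv> Poly_Mapping.keys"

text \<open>The linear extension of \<open>w\<close> from exponents to formal sums. Evaluation on
  the torus and convolution on the lattice are both instances.\<close>

definition linear_eval :: "('k \<Rightarrow>\<^sub>0 int) \<Rightarrow> ('k \<Rightarrow> 'b::comm_ring_1) \<Rightarrow> 'b" where
  "linear_eval p w = (\<Sum>k\<in>keys p. of_int (lookup p k) * w k)"

lemma linear_eval_superset:
  assumes "finite K" "keys p \<subseteq> K"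
  shows "linear_eval p w = (\<Sum>k\<in>K. of_int (lookup p k) * w k)"
  unfolding linear_eval_def using assms
  by (intro sum.mono_neutral_left) (auto simp: in_keys_iff)

lemma linear_eval_add: "linear_eval (p + q) w = linear_eval p w + linear_eval q w"
proof -
  have "keys (p + q) \<subseteq> keys p \<union> keys q" by (rule keys_add)
  then show ?thesis
    by (simp add: linear_eval_superset[of "keys p \<union> keys q"] lookup_add distrib_right sum.distrib)
qed

lemma linear_eval_diff: "linear_eval (p - q) w = linear_eval p w - linear_eval q w"
  using linear_eval_add[of "p - q" q w] by simp

lemma linear_eval_0 [simp]: "linear_eval 0 w = 0"
  by (simp add: linear_eval_def)

lemma linear_eval_single: "linear_eval (Poly_Mapping.single k a) w = of_int a * w k"
  by (simp add: linear_eval_def)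

lemma linear_eval_frag_of [simp]: "linear_eval (frag_of k) w = w k"
  by (simp add: linear_eval_def)

lemma linear_eval_sum: "linear_eval (sum p I) w = (\<Sum>i\<in>I. linear_eval (p i) w)"
  by (induction I rule: infinite_finite_induct) (auto simp: linear_eval_add)

lemma linear_eval_diff_right: "linear_eval p (\<lambda>k. v k - w k) = linear_eval p v - linear_eval p w"
  by (simp add: linear_eval_def right_diff_distrib sum_subtractf)

text \<open>As an additive group the Laurent ring is free on the monomials \<open>frag_of k\<close>,
  so additive identities need checking on monomials only.\<close>

lemma laurent_induct [case_names zero monomial diff]:
  assumes "P 0" "\<And>k. P (frag_of k)" "\<And>p q. P p \<Longrightarrow> P q \<Longrightarrow> P (p - q)"
  shows "P (p :: 'k \<Rightarrow>\<^sub>0 int)"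
  using frag_induction[of p UNIV P] assms by auto

text \<open>The functions on the lattice become a module over the Laurent ring
  (\<open>conv_mult\<close>). This includes functions of infinite support, such as the Fourier
  coefficients of a quotient.\<close>

definition conv :: "('k::ab_group_add \<Rightarrow>\<^sub>0 int) \<Rightarrow> ('k \<Rightarrow> 'b::comm_ring_1) \<Rightarrow> 'k \<Rightarrow> 'b" where
  "conv p w n = linear_eval p (\<lambda>k. w (n - k))"

lemma conv_diff: "conv (p - q) w = (\<lambda>n. conv p w n - conv q w n)"
  by (simp add: conv_def linear_eval_diff fun_eq_iff)

lemma conv_frag_of: "conv (frag_of k) w n = w (n - k)"
  by (simp add: conv_def)

lemma conv_diff_right: "conv p (\<lambda>n. v n - w n) = (\<lambda>n. conv p v n - conv p w n)"
  by (simp add: conv_def linear_eval_diff_right fun_eq_iff)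

lemma frag_of_mult: "frag_of k * frag_of l = frag_of (k + l :: 'k::monoid_add)"
  by (simp add: mult_single)

lemma conv_mult: "conv (p * q) w = conv p (conv q w)"
proof (induction p rule: laurent_induct)
  case (monomial k)
  show ?case
  proof (induction q rule: laurent_induct)
    case (monomial l)
    then show ?case by (simp add: frag_of_mult conv_frag_of fun_eq_iff diff_diff_eq)
  next
    case (diff p q)
    then show ?case by (simp add: right_diff_distrib conv_diff conv_diff_right)
  qed (simp add: conv_def linear_eval_def fun_eq_iff)
qed (simp_all add: left_diff_distrib conv_diff, simp add: conv_def fun_eq_iff)

lemma lookup_mult_frag_of:
  fixes p :: "'k::ab_group_add \<Rightarrow>\<^sub>0 int"
  shows "lookup (p * frag_of t) l = lookup p (l - t)"
proof (induction p rule: laurent_induct)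
  case (monomial k)
  then show ?case by (auto simp: frag_of_mult)
qed (auto simp: left_diff_distrib lookup_minus)

lemma conv_lookup: "conv p (\<lambda>n. of_int (lookup q n)) n = of_int (lookup (p * q) n)"
proof (induction p rule: laurent_induct)
  case (monomial k)
  then show ?case using lookup_mult_frag_of[of q k n] by (simp add: conv_frag_of mult.commute)
qed (auto simp: conv_diff left_diff_distrib lookup_minus, simp add: conv_def)

lemma frag_extend_mult:
  fixes b :: "'k::monoid_add \<Rightarrow> ('l::comm_monoid_add \<Rightarrow>\<^sub>0 int)"
  assumes "\<And>k l. b (k + l) = b k * b l"
  shows "frag_extend b (p * q) = frag_extend b p * frag_extend b q"
proof (induction p rule: laurent_induct)
  case (monomial k)
  show ?case
    by (induction q rule: laurent_induct)
       (simp_all add: frag_of_mult assms right_diff_distrib frag_extend_diff)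
qed (simp_all add: left_diff_distrib frag_extend_diff)

definition map_exponents :: "('k \<Rightarrow> 'l) \<Rightarrow> ('k \<Rightarrow>\<^sub>0 int) \<Rightarrow> ('l \<Rightarrow>\<^sub>0 int)" where
  "map_exponents \<theta> = frag_extend (\<lambda>k. frag_of (\<theta> k))"

lemma map_exponents_simps [simp]:
  "map_exponents \<theta> 0 = 0" "map_exponents \<theta> (frag_of k) = frag_of (\<theta> k)"
  "map_exponents \<theta> (p - q) = map_exponents \<theta> p - map_exponents \<theta> q"
  by (simp_all add: map_exponents_def frag_extend_diff)

lemma map_exponents_mult:
  fixes \<theta> :: "'k::monoid_add \<Rightarrow> 'l::comm_monoid_add"
  assumes "\<And>k l. \<theta> (k + l) = \<theta> k + \<theta> l"
  shows "map_exponents \<theta> (p * q) = map_exponents \<theta> p * map_exponents \<theta> q"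
  unfolding map_exponents_def by (intro frag_extend_mult) (simp add: assms frag_of_mult)

lemma map_exponents_1:
  assumes "\<theta> 0 = (0::'l::comm_monoid_add)" shows "map_exponents \<theta> 1 = 1"
  using map_exponents_simps(2)[of \<theta> 0] assms by (metis single_one)

lemma map_exponents_compose: "map_exponents \<theta> (map_exponents \<eta> p) = map_exponents (\<theta> \<circ> \<eta>) p"
  by (induction p rule: laurent_induct) simp_all

lemma map_exponents_cong:
  "(\<And>k. k \<in> keys p \<Longrightarrow> \<theta> k = \<eta> k) \<Longrightarrow> map_exponents \<theta> p = map_exponents \<eta> p"
  unfolding map_exponents_def by (intro frag_extend_eq) simp

lemma map_exponents_ident: "map_exponents (\<lambda>k. k) p = p"
  by (induction p rule: laurent_induct) simp_all

lemma keys_map_exponents: "keys (map_exponents \<theta> p) \<subseteq> \<theta> ` keys p"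
  unfolding map_exponents_def using keys_frag_extend[of "\<lambda>k. frag_of (\<theta> k)" p] by auto

lemma lookup_map_exponents:
  assumes "inj \<theta>" shows "lookup (map_exponents \<theta> p) (\<theta> k) = lookup p k"
  by (induction p rule: laurent_induct) (auto simp: lookup_minus inj_eq[OF assms])

lemma map_exponents_dvd:
  fixes \<theta> :: "'k::comm_monoid_add \<Rightarrow> 'l::comm_monoid_add"
  assumes "\<And>k l. \<theta> (k + l) = \<theta> k + \<theta> l" "p dvd q"
  shows "map_exponents \<theta> p dvd map_exponents \<theta> q"
  using assms by (auto simp: map_exponents_mult elim!: dvdE)

text \<open>The exponents \<open>int ^ 'd\<close> carry no linear order, so the library does not provide an \<open>idom\<close>
  instance for \<open>'d laurent\<close>. The exponents below are ordered lexicographically, and their variables are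
  numbered, which allows an induction on the number of variables.\<close>

type_synonym countable_laurent = "(nat \<Rightarrow>\<^sub>0 int) \<Rightarrow>\<^sub>0 int"

definition laurent_in :: "nat \<Rightarrow> countable_laurent set" where
  "laurent_in n = {u. \<forall>k\<in>keys u. \<forall>i\<ge>n. lookup k i = 0}"

lift_definition truncate :: "nat \<Rightarrow> (nat \<Rightarrow>\<^sub>0 int) \<Rightarrow> (nat \<Rightarrow>\<^sub>0 int)"
  is "\<lambda>n k i. if i < n then k i else 0"
  by (rule finite_subset) auto

lemma lookup_truncate [simp]: "lookup (truncate n k) i = (if i < n then lookup k i else 0)"
  by transfer simp

lemma truncate_add: "truncate n (k + l) = truncate n k + truncate n l"
  by (rule poly_mapping_eqI) (simp add: lookup_add)

lemma truncate_eq: "(\<forall>i\<ge>n. lookup k i = 0) \<Longrightarrow> truncate n k = k"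
  by (rule poly_mapping_eqI) auto

lemma map_exponents_truncate: "u \<in> laurent_in n \<Longrightarrow> map_exponents (truncate n) u = u"
  using map_exponents_cong[of u "truncate n" "\<lambda>k. k"]
  by (auto simp: laurent_in_def truncate_eq map_exponents_ident)

lemma saturated_laurent_in: "saturated_subring (laurent_in n)"
proof
  show "a + b \<in> laurent_in n" if "a \<in> laurent_in n" "b \<in> laurent_in n" for a b
    using that keys_add[of a b] by (auto simp: laurent_in_def)
  show "a - b \<in> laurent_in n" if "a \<in> laurent_in n" "b \<in> laurent_in n" for a b
    using that keys_diff[of a b] by (auto simp: laurent_in_def)
  show "a * b \<in> laurent_in n" if "a \<in> laurent_in n" "b \<in> laurent_in n" for a b
    using that keys_mult[of a b] by (fastforce simp: laurent_in_def lookup_add)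
  show "c \<in> laurent_in n" if ac: "a \<in> laurent_in n" "a \<noteq> 0" "a * c \<in> laurent_in n" for a c
  proof -
    \<comment> \<open>Truncating exponents amounts to substituting 1 for the variables from
      \<open>n\<close> on, which is a ring homomorphism. It fixes \<open>a\<close> and
      \<open>a * c\<close>, hence also \<open>c\<close>.\<close>
    have "a * c = a * map_exponents (truncate n) c"
      using map_exponents_truncate[OF ac(3)] map_exponents_truncate[OF ac(1)]
        map_exponents_mult[of "truncate n" a c, OF truncate_add] by metis
    then have "c = map_exponents (truncate n) c" using ac(2) by (metis mult_left_cancel)
    then have "keys c \<subseteq> truncate n ` keys c" using keys_map_exponents by metis
    then show ?thesis by (auto simp: laurent_in_def)
  qed
qed (auto simp: laurent_in_def)

abbreviation laurent_var :: "nat \<Rightarrow> int \<Rightarrow> countable_laurent" where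
  "laurent_var n j \<equiv> frag_of (Poly_Mapping.single n j)"

lemma laurent_var_power: "laurent_var n 1 ^ m = laurent_var n (int m)"
  by (induction m) (simp_all add: frag_of_mult single_add[symmetric] del: single_add)

lemma laurent_in_extension:
  assumes base: "\<And>a. a \<in> laurent_in n \<Longrightarrow> a \<noteq> 0 \<Longrightarrow> saturated_subring.factorable (laurent_in n) a"
  shows "laurent_extension (laurent_in n) (laurent_in (Suc n)) (laurent_var n 1) (laurent_var n (-1))"
proof -
  interpret A: saturated_subring "laurent_in n" by (rule saturated_laurent_in)
  interpret B: saturated_subring "laurent_in (Suc n)" by (rule saturated_laurent_in)
  let ?x = "laurent_var n 1"
  show ?thesis
  proof
    show "laurent_in n \<subseteq> laurent_in (Suc n)" by (auto simp: laurent_in_def)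
    show "laurent_var n 1 \<in> laurent_in (Suc n)" "laurent_var n (- 1) \<in> laurent_in (Suc n)"
      by (auto simp: laurent_in_def lookup_single)
    show "laurent_var n 1 * laurent_var n (- 1) = 1"
      by (simp add: frag_of_mult single_add[symmetric] del: single_add)
    show "\<exists>m p. A.poly_over p \<and> ?x ^ m * b = poly p ?x" if b: "b \<in> laurent_in (Suc n)" for b
    proof -
      have "keys b \<subseteq> {k. \<forall>i\<ge>Suc n. lookup k i = 0}" using b by (auto simp: laurent_in_def)
      then show ?thesis
      proof (induction b rule: frag_induction)
        case zero
        then show ?case by (intro exI[of _ 0] exI[of _ 0]) (auto simp: A.poly_over_simps)
      next
        case (one k)
        define j where "j = lookup k n"
        define m where "m = nat \<bar>j\<bar>"
        define t where "t = truncate n k"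
        have k: "t + Poly_Mapping.single n j = k"
        proof (rule poly_mapping_eqI)
          fix i show "lookup (t + Poly_Mapping.single n j) i = lookup k i"
            using one by (cases i n rule: linorder_cases) (auto simp: t_def lookup_add lookup_single j_def)
        qed
        have "?x ^ m * frag_of k = frag_of t * laurent_var n (int m + j)"
          by (simp add: laurent_var_power frag_of_mult single_add ac_simps k[symmetric])
        also have "laurent_var n (int m + j) = ?x ^ nat (int m + j)"
          by (simp add: laurent_var_power m_def)
        finally have "?x ^ m * frag_of k = poly (monom (frag_of t) (nat (int m + j))) ?x"
          by (simp add: poly_monom)
        moreover have "frag_of t \<in> laurent_in n" by (auto simp: laurent_in_def t_def)
        ultimately show ?case using A.poly_over_simps(7) by blast
      next
        case (diff a b)
        then obtain m p k q where pq: "A.poly_over p" "?x ^ m * a = poly p ?x"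
          "A.poly_over q" "?x ^ k * b = poly q ?x" by blast
        have "?x ^ (m + k) * (a - b) = ?x ^ k * (?x ^ m * a) - ?x ^ m * (?x ^ k * b)"
          by (simp only: power_add left_diff_distrib right_diff_distrib mult_ac)
        also have "\<dots> = poly (monom 1 k * p - monom 1 m * q) ?x"
          by (simp only: pq poly_diff poly_mult poly_monom mult_1)
        finally show ?case using pq(1,3)
          by (intro exI[of _ "m + k"] exI[of _ "monom 1 k * p - monom 1 m * q"])
             (auto simp: A.poly_over_simps A.one_mem)
      qed
    qed
    show "p = 0" if p: "A.poly_over p" "poly p ?x = 0" for p
    proof (rule poly_eqI)
      fix j
      show "coeff p j = coeff 0 j"
      proof (rule poly_mapping_eqI)
        fix k
        have mem: "coeff p i \<in> laurent_in n" for i using p by (auto simp: A.poly_over_def)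
        show "lookup (coeff p j) k = lookup (coeff 0 j) k"
        proof (cases "lookup k n = 0")
          case False
          then have "k \<notin> keys (coeff p j)" using mem by (auto simp: laurent_in_def)
          then show ?thesis by (simp add: in_keys_iff)
        next
          case True
          \<comment> \<open>Exponents of \<open>coeff p i\<close> vanish in position
            \<open>n\<close>. So the part of \<open>poly p ?x\<close> with entry \<open>j\<close> in
            that position comes from the summand \<open>i = j\<close> alone.\<close>
          have other: "lookup (coeff p i) (k + Poly_Mapping.single n (int j) - Poly_Mapping.single n (int i)) = 0"
            if "i \<noteq> j" for i
          proof -
            have "lookup (k + Poly_Mapping.single n (int j) - Poly_Mapping.single n (int i)) n \<noteq> 0"
              using that True by (simp add: lookup_add lookup_minus)
            then have "k + Poly_Mapping.single n (int j) - Poly_Mapping.single n (int i) \<notin> keys (coeff p i)"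
              using mem by (auto simp: laurent_in_def)
            then show ?thesis by (simp add: in_keys_iff)
          qed
          have "0 = lookup (poly p ?x) (k + Poly_Mapping.single n (int j))" by (simp add: p)
          also have "\<dots> = (\<Sum>i\<le>degree p. lookup (coeff p i)
              (k + Poly_Mapping.single n (int j) - Poly_Mapping.single n (int i)))"
            by (simp add: poly_altdef lookup_sum laurent_var_power lookup_mult_frag_of)
          also have "\<dots> = (\<Sum>i\<le>degree p. if i = j then lookup (coeff p j) k else 0)"
            using other by (intro sum.cong) auto
          also have "\<dots> = lookup (coeff p j) k" by (simp add: coeff_eq_0)
          finally show ?thesis by simp
        qed
      qed
    qed
  qed (use base in auto)
qed

lemma of_int_dvd_of_int_iff:
  "(of_int a :: countable_laurent) dvd of_int b \<longleftrightarrow> a dvd b"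
proof
  assume "(of_int a :: countable_laurent) dvd of_int b"
  then obtain c :: countable_laurent where c: "of_int b = of_int a * c" by blast
  have "b = lookup (of_int b :: countable_laurent) 0" by (simp add: lookup_of_int)
  also have "\<dots> = conv (of_int a) (lookup c) 0"
    using conv_lookup[of "of_int a" c 0, where 'a = int] by (simp add: c)
  also have "\<dots> = a * lookup c 0"
    by (simp add: conv_def linear_eval_single single_of_int[symmetric] del: single_of_int)
  finally show "a dvd b" by simp
qed (auto elim!: dvdE)

text \<open>The ring without variables is a copy of the integers, and every further variable is one
  Laurent extension.\<close>

lemma factorable_laurent_in:
  "u \<in> laurent_in n \<Longrightarrow> u \<noteq> 0 \<Longrightarrow> saturated_subring.factorable (laurent_in n) u"
proof (induction n arbitrary: u)
  case 0
  interpret A: saturated_subring "laurent_in 0" by (rule saturated_laurent_in)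
  have const: "\<exists>z. v = of_int z" if "v \<in> laurent_in 0" for v
  proof
    show "v = of_int (lookup v 0)"
    proof (rule poly_mapping_eqI)
      fix k show "lookup v k = lookup (of_int (lookup v 0)) k"
      proof (cases "k = 0")
        case False
        then have "k \<notin> keys v" using that poly_mapping_eqI[of k 0] by (auto simp: laurent_in_def)
        then show ?thesis using False by (simp add: in_keys_iff lookup_of_int)
      qed (simp add: lookup_of_int)
    qed
  qed
  have mem: "of_int z \<in> laurent_in 0" for z
    by (auto simp: laurent_in_def single_of_int[symmetric] simp del: single_of_int split: if_splits)
  have "z \<noteq> 0 \<longrightarrow> A.factorable (of_int z)" for z
  proof (induction z rule: prime_divisors_induct)
    case (unit z)
    then have "(of_int z :: countable_laurent) dvd 1"
      using of_int_dvd_of_int_iff[of z 1] by simp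
    then show ?case using mem A.factorable_unit by blast
  next
    case (factor p z)
    have "A.prime_in (of_int p)"
      unfolding A.prime_in_def
    proof (intro conjI ballI impI)
      show "\<not> (of_int p :: countable_laurent) dvd 1"
        using factor of_int_dvd_of_int_iff[of p 1] not_prime_unit by auto
      fix a b :: countable_laurent
      assume "a \<in> laurent_in 0" "b \<in> laurent_in 0" and dvd: "of_int p dvd a * b"
      then obtain c d where "a = of_int c" "b = of_int d" using const by blast
      then show "of_int p dvd a \<or> of_int p dvd b"
        using dvd factor of_int_dvd_of_int_iff[of p "c * d"]
        by (simp add: of_int_dvd_of_int_iff prime_dvd_mult_iff)
    qed (use factor mem in auto)
    then show ?case using factor A.factorable_mult[OF A.factorable_prime] by auto
  qed simp
  moreover obtain z where "u = of_int z" using const 0 by blast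
  ultimately show ?case using 0 by auto
next
  case (Suc n)
  interpret laurent_extension "laurent_in n" "laurent_in (Suc n)" "laurent_var n 1" "laurent_var n (-1)"
    using Suc.IH by (rule laurent_in_extension)
  show ?case using Suc.prems by (rule factorable_extension)
qed

section \<open>Transfer to exponents in \<open>int ^ 'd\<close>\<close>

text \<open>A numbering of the variables. \<open>E\<close> identifies \<open>'d laurent\<close> with
  the subring \<open>laurent_in N\<close>, and \<open>R\<close> inverts it while being
  multiplicative on the entire ambient ring.\<close>

locale exponent_embedding =
  fixes \<theta> :: "int ^ 'd::finite \<Rightarrow> (nat \<Rightarrow>\<^sub>0 int)" and \<tau> :: "(nat \<Rightarrow>\<^sub>0 int) \<Rightarrow> int ^ 'd" and N :: nat
  assumes \<theta>_add: "\<theta> (k + l) = \<theta> k + \<theta> l" and \<tau>_add: "\<tau> (s + t) = \<tau> s + \<tau> t"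
    and \<tau>_\<theta>: "\<tau> (\<theta> k) = k"
    and \<theta>_\<tau>: "(\<forall>i\<ge>N. lookup s i = 0) \<Longrightarrow> \<theta> (\<tau> s) = s"
    and \<theta>_bound: "i \<ge> N \<Longrightarrow> lookup (\<theta> k) i = 0"
begin

abbreviation "E \<equiv> map_exponents \<theta>"
abbreviation "R \<equiv> map_exponents \<tau>"

lemma \<theta>_inj: "inj \<theta>" using \<tau>_\<theta> by (metis injI)

lemma \<theta>_0: "\<theta> 0 = 0" using \<theta>_add[of 0 0] by simp

lemma R_E: "R (E f) = f"
  by (simp add: map_exponents_compose comp_def \<tau>_\<theta> map_exponents_ident)

lemma E_mem: "E f \<in> laurent_in N"
  using keys_map_exponents[of \<theta> f] \<theta>_bound by (auto simp: laurent_in_def)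

lemma E_R: "u \<in> laurent_in N \<Longrightarrow> E (R u) = u"
  using map_exponents_cong[of u "\<theta> \<circ> \<tau>" "\<lambda>k. k"]
  by (simp add: map_exponents_compose map_exponents_ident \<theta>_\<tau> laurent_in_def)

lemma E_mult: "E (f * g) = E f * E g" by (rule map_exponents_mult[OF \<theta>_add])
lemma R_mult: "R (u * v) = R u * R v" by (rule map_exponents_mult[OF \<tau>_add])

lemma E_eq_0_iff: "E f = 0 \<longleftrightarrow> f = 0"
  using R_E[of f] by auto

lemma E_dvd_iff: "E f dvd E g \<longleftrightarrow> f dvd g"
  using map_exponents_dvd[OF \<theta>_add] map_exponents_dvd[OF \<tau>_add] R_E by metis

lemma dvd_1_iff: "u \<in> laurent_in N \<Longrightarrow> R u dvd 1 \<longleftrightarrow> u dvd 1"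
  using E_dvd_iff[of "R u" 1] E_R[of u] map_exponents_1[of \<theta>, OF \<theta>_0] by simp

text \<open>Pick one prime from the factorisation of \<open>E f\<close>. As \<open>f\<close> is
  irreducible, the remaining cofactor is a unit, so \<open>E f\<close> is an associate of that
  prime.\<close>

lemma irreducible_dvd_mult:
  fixes f a b :: "'d laurent"
  assumes irr: "irreducible f" and dvd: "f dvd a * b"
  shows "f dvd a \<or> f dvd b"
proof -
  interpret S: saturated_subring "laurent_in N" by (rule saturated_laurent_in)
  have "E f \<noteq> 0" using irr E_eq_0_iff[of f] by (simp add: irreducible_def)
  then have "S.factorable (E f)" using factorable_laurent_in E_mem by blast
  then obtain v P where P: "v \<in> laurent_in N" "v dvd 1" "\<forall>p\<in>#P. S.prime_in p" "E f = v * prod_mset P"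
    unfolding S.factorable_def by blast
  have "P \<noteq> {#}"
  proof
    assume "P = {#}"
    then have "E f dvd 1" using P by simp
    then have "f dvd 1" using dvd_1_iff[OF E_mem] R_E by metis
    then show False using irr by (auto simp: irreducible_def)
  qed
  then obtain p Q where PQ: "P = add_mset p Q" by (metis multiset_cases)
  have p: "S.prime_in p" "p \<in> laurent_in N" "\<not> p dvd 1" using P PQ by (auto simp: S.prime_in_def)
  define w where "w = v * prod_mset Q"
  have w: "w \<in> laurent_in N" unfolding w_def
    using P PQ by (auto intro!: S.mult_mem S.prod_mset_mem simp: S.prime_in_def)
  have Ef: "E f = w * p" using P(4) by (simp add: PQ w_def mult_ac)
  then have "f = R w * R p" using R_mult R_E by metis
  then have "R w dvd 1" using irr p dvd_1_iff irreducibleD by blast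
  then have wu: "w dvd 1" using dvd_1_iff w by simp
  have "p dvd E f" by (simp add: Ef)
  also have "E f dvd E a * E b" using dvd E_dvd_iff E_mult by metis
  finally have "p dvd E a \<or> p dvd E b" using p E_mem unfolding S.prime_in_def by blast
  moreover have "E f dvd p" using dvd_unit_mult_iff[OF wu, of "E f" p] Ef by simp
  ultimately show ?thesis using E_dvd_iff dvd_trans by blast
qed

lemma no_zero_divisors: "a * b = 0 \<Longrightarrow> a = 0 \<or> b = 0" for a b :: "'d laurent"
  using E_mult[of a b] E_eq_0_iff by (metis map_exponents_simps(1) mult_eq_0_iff)

end

text \<open>Nothing can cancel at an exponent that arises from a single pair. It is applied to the
  largest and to the smallest exponents in the linear order.\<close>

lemma lookup_mult_extremal:
  fixes u v :: countable_laurent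
  assumes "\<And>k l. k \<in> keys u \<Longrightarrow> l \<in> keys v \<Longrightarrow> k + l = a + b \<Longrightarrow> k = a" and a: "a \<in> keys u"
  shows "lookup (u * v) (a + b) = lookup u a * lookup v b"
proof -
  have "lookup (u * v) (a + b) = (\<Sum>k\<in>keys u. lookup u k * lookup v (a + b - k))"
    using conv_lookup[of u v "a + b", where 'a = int, symmetric]
    by (simp add: conv_def linear_eval_def)
  also have "\<dots> = (\<Sum>k\<in>keys u. if k = a then lookup u a * lookup v b else 0)"
  proof (intro sum.cong refl)
    fix k assume k: "k \<in> keys u"
    show "lookup u k * lookup v (a + b - k) = (if k = a then lookup u a * lookup v b else 0)"
    proof (cases "a + b - k \<in> keys v")
      case True
      then have "k = a" using assms(1)[OF k True] by simp
      then show ?thesis by simp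
    next
      case False
      then show ?thesis by (auto simp: in_keys_iff)
    qed
  qed
  also have "\<dots> = lookup u a * lookup v b" using a by simp
  finally show ?thesis .
qed

text \<open>Weights do not enlarge the support, whereas the largest and the smallest exponents add
  up in a product. So the support of \<open>q\<close> lies in \<open>{0}\<close>, and the weights
  are constant on the support of \<open>u\<close>. This decides when a logarithmic derivative is
  divisible by the function itself.\<close>

lemma diagonal_multiple_const:
  fixes u q :: countable_laurent
  assumes u: "u \<noteq> 0" and eq: "\<And>k. lookup (u * q) k = \<mu> k * lookup u k"
    and kl: "k \<in> keys u" "l \<in> keys u"
  shows "\<mu> k = \<mu> l"
proof (cases "q = 0")
  case True
  then show ?thesis using eq[of k] eq[of l] kl by (simp add: in_keys_iff)
next
  case False
  have ne: "keys u \<noteq> {}" "keys q \<noteq> {}" using u False by auto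
  have Max_sum: "lookup (u * q) (Max (keys u) + Max (keys q)) \<noteq> 0"
  proof (subst lookup_mult_extremal)
    fix k l assume "k \<in> keys u" "l \<in> keys q" and eq: "k + l = Max (keys u) + Max (keys q)"
    then have "k \<le> Max (keys u)" "l \<le> Max (keys q)" by auto
    then show "k = Max (keys u)" using eq by (metis add_less_le_mono less_irrefl order_le_less)
  qed (use ne Max_in[of "keys u"] Max_in[of "keys q"] in \<open>auto simp: in_keys_iff\<close>)
  have Min_sum: "lookup (u * q) (Min (keys u) + Min (keys q)) \<noteq> 0"
  proof (subst lookup_mult_extremal)
    fix k l assume "k \<in> keys u" "l \<in> keys q" and eq: "k + l = Min (keys u) + Min (keys q)"
    then have "k \<ge> Min (keys u)" "l \<ge> Min (keys q)" by auto
    then show "k = Min (keys u)" using eq by (metis add_less_le_mono less_irrefl order_le_less)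
  qed (use ne Min_in[of "keys u"] Min_in[of "keys q"] in \<open>auto simp: in_keys_iff\<close>)
  have mem: "Max (keys u) + Max (keys q) \<in> keys u" "Min (keys u) + Min (keys q) \<in> keys u"
    using Max_sum Min_sum eq by (auto simp: in_keys_iff)
  have "Max (keys u) + Max (keys q) \<le> Max (keys u)" "Min (keys u) \<le> Min (keys u) + Min (keys q)"
    using Max_ge[OF finite_keys mem(1)] Min_le[OF finite_keys mem(2)] .
  then have mm: "Max (keys q) \<le> 0" "0 \<le> Min (keys q)"
    using add_le_same_cancel1 le_add_same_cancel1 by blast+
  have "keys q \<subseteq> {0}"
  proof
    fix t assume "t \<in> keys q"
    then have "t \<le> Max (keys q)" "Min (keys q) \<le> t" by auto
    then have "t = 0" using mm by order
    then show "t \<in> {0}" by simp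
  qed
  then have "lookup (u * q) k = lookup q 0 * lookup u k" for k
    using conv_lookup[of q u k, where 'a = int]
      linear_eval_superset[of "{0}" q "\<lambda>l. lookup u (k - l)"]
    by (simp add: conv_def mult.commute)
  then show ?thesis using eq[of k] eq[of l] kl by (simp add: in_keys_iff)
qed

lemma exponent_embedding_exists:
  "\<exists>(\<theta> :: int ^ 'd::finite \<Rightarrow> (nat \<Rightarrow>\<^sub>0 int)) \<tau> N. exponent_embedding \<theta> \<tau> N"
proof -
  obtain e :: "'d \<Rightarrow> nat" where e: "bij_betw e UNIV {0..<CARD('d)}"
    using ex_bij_betw_finite_nat[of "UNIV :: 'd set"] by auto
  then have inj: "e i = e j \<longleftrightarrow> i = j" for i j by (auto simp: bij_betw_def inj_eq)
  have bound: "e i < CARD('d)" for i using e by (auto simp: bij_betw_def)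
  define \<theta> :: "int ^ 'd \<Rightarrow> (nat \<Rightarrow>\<^sub>0 int)" where "\<theta> k = (\<Sum>j\<in>UNIV. Poly_Mapping.single (e j) (k $ j))" for k
  define \<tau> :: "(nat \<Rightarrow>\<^sub>0 int) \<Rightarrow> int ^ 'd" where "\<tau> s = (\<chi> j. lookup s (e j))" for s
  have lk: "lookup (\<theta> k) (e j) = k $ j" for k j
    by (simp add: \<theta>_def lookup_sum lookup_single when_def inj)
  have out: "lookup (\<theta> k) i = 0" if "i \<notin> range e" for k i
    using that by (auto simp: \<theta>_def lookup_sum lookup_single when_def intro!: sum.neutral)
  have range: "i \<in> range e \<longleftrightarrow> i < CARD('d)" for i using e by (auto simp: bij_betw_def)
  have "exponent_embedding \<theta> \<tau> CARD('d)"
  proof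
    show "\<theta> (k + l) = \<theta> k + \<theta> l" for k l by (simp add: \<theta>_def single_add sum.distrib)
    show "\<tau> (s + t) = \<tau> s + \<tau> t" for s t by (simp add: \<tau>_def vec_eq_iff lookup_add)
    show "\<tau> (\<theta> k) = k" for k by (simp add: \<tau>_def vec_eq_iff lk)
    show "\<theta> (\<tau> s) = s" if "\<forall>i\<ge>CARD('d). lookup s i = 0" for s
    proof (rule poly_mapping_eqI)
      fix i show "lookup (\<theta> (\<tau> s)) i = lookup s i"
        using that lk[of "\<tau> s"] out[of i "\<tau> s"] range[of i] by (cases "i \<in> range e") (auto simp: \<tau>_def)
    qed
    show "lookup (\<theta> k) i = 0" if "i \<ge> CARD('d)" for i k using that out range by auto
  qed
  then show ?thesis by blast
qed

lemma laurent_irreducible_dvd_mult: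
  fixes f :: "'d::finite laurent"
  assumes "irreducible f" "f dvd a * b" shows "f dvd a \<or> f dvd b"
  using exponent_embedding_exists[where 'd = 'd] exponent_embedding.irreducible_dvd_mult assms
  by metis

lemma laurent_irreducible_dvd_power:
  fixes f :: "'d::finite laurent"
  assumes "irreducible f" "f dvd a ^ n" shows "f dvd a"
  using assms(2)
proof (induction n)
  case 0
  then show ?case using assms(1) by (auto simp: irreducible_def)
next
  case (Suc n)
  then show ?case using laurent_irreducible_dvd_mult[OF assms(1), of a "a ^ n"] by auto
qed

lemma laurent_no_zero_divisors:
  fixes a b :: "'d::finite laurent"
  assumes "a * b = 0" shows "a = 0 \<or> b = 0"
  using exponent_embedding_exists[where 'd = 'd] exponent_embedding.no_zero_divisors assms
  by metis

lemma laurent_diagonal_multiple_const: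
  fixes f g :: "'d::finite laurent"
  assumes "f dvd g" and eq: "\<And>k. lookup g k = \<mu> k * lookup f k"
    and kl: "k \<in> keys f" "l \<in> keys f"
  shows "\<mu> k = \<mu> l"
proof -
  obtain \<theta> :: "int ^ 'd \<Rightarrow> (nat \<Rightarrow>\<^sub>0 int)" and \<tau> N where "exponent_embedding \<theta> \<tau> N"
    using exponent_embedding_exists by blast
  then interpret exponent_embedding \<theta> \<tau> N .
  obtain q where q: "g = f * q" using assms(1) by blast
  have lk: "lookup (E h) (\<theta> s) = lookup h s" for h s by (rule lookup_map_exponents[OF \<theta>_inj])
  have out: "lookup (E h) t = 0" if "t \<notin> range \<theta>" for h t
    using keys_map_exponents[of \<theta> h] that by (auto simp: in_keys_iff)
  have h: "lookup (E f * E q) t = \<mu> (\<tau> t) * lookup (E f) t" for t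
  proof (cases "t \<in> range \<theta>")
    case True
    then obtain s where "t = \<theta> s" by blast
    then show ?thesis using eq[of s] by (simp add: q E_mult[symmetric] lk \<tau>_\<theta>)
  next
    case False
    then show ?thesis using out[of t] by (simp add: E_mult[symmetric])
  qed
  have "E f \<noteq> 0" using kl E_eq_0_iff[of f] by auto
  moreover have "\<theta> k \<in> keys (E f)" "\<theta> l \<in> keys (E f)" using kl by (auto simp: in_keys_iff lk)
  ultimately have "\<mu> (\<tau> (\<theta> k)) = \<mu> (\<tau> (\<theta> l))"
    using diagonal_multiple_const[of "E f" "E q" "\<lambda>t. \<mu> (\<tau> t)", OF _ h] by blast
  then show ?thesis by (simp add: \<tau>_\<theta>)
qed

subsection \<open>Sets of codimension 2 do not separate\<close>

text \<open>Brouwer's theorem applies to \<open>x - \<Psi> x\<close> clamped to the cube. At a fixed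
  point the signs on the faces exclude coordinates 1 and -1, and strictly between them the clamping
  is inactive, so \<open>\<Psi>\<close> vanishes.\<close>

lemma poincare_miranda:
  fixes \<Psi> :: "real ^ 'd::finite \<Rightarrow> real ^ 'd"
  assumes cont: "continuous_on (cbox (-1) 1) \<Psi>"
    and pos: "\<And>x j. x \<in> cbox (-1) 1 \<Longrightarrow> x $ j = 1 \<Longrightarrow> \<Psi> x $ j > 0"
    and neg: "\<And>x j. x \<in> cbox (-1) 1 \<Longrightarrow> x $ j = -1 \<Longrightarrow> \<Psi> x $ j < 0"
  shows "\<exists>x\<in>cbox (-1) 1. \<Psi> x = 0"
proof -
  define N :: "real ^ 'd \<Rightarrow> real ^ 'd" where "N x = (\<chi> j. max (-1) (min 1 (x $ j - \<Psi> x $ j)))" for x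
  have "N \<in> cbox (-1) 1 \<rightarrow> cbox (-1) 1"
    by (auto simp: N_def mem_box_cart)
  moreover have "continuous_on (cbox (-1) 1) N"
    unfolding N_def by (intro continuous_intros cont)
  moreover have "0 \<in> cbox (-1) (1 :: real ^ 'd)" by (simp add: mem_box_cart)
  then have "cbox (-1) (1 :: real ^ 'd) \<noteq> {}" by blast
  ultimately obtain x where x: "x \<in> cbox (-1) 1" "N x = x"
    using brouwer[of "cbox (-1) 1 :: (real ^ 'd) set" N] compact_cbox convex_box(1) by metis
  have "\<Psi> x $ j = 0" for j
  proof -
    have bd: "-1 \<le> x $ j" "x $ j \<le> 1" using x(1) by (auto simp: mem_box_cart)
    have eq: "max (-1) (min 1 (x $ j - \<Psi> x $ j)) = x $ j"
      using arg_cong[OF x(2), of "\<lambda>v. v $ j"] by (simp add: N_def)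
    consider "x $ j = 1" | "x $ j = -1" | "-1 < x $ j" "x $ j < 1" using bd by linarith
    then show ?thesis
    proof cases
      case 1 then show ?thesis using pos[OF x(1) 1] eq by linarith
    next
      case 2 then show ?thesis using neg[OF x(1) 2] eq by linarith
    next
      case 3 then show ?thesis using eq by linarith
    qed
  qed
  then show ?thesis using x(1) by (auto simp: vec_eq_iff)
qed

definition drop_coord :: "'d::finite \<Rightarrow> real ^ 'd \<Rightarrow> real ^ 'd" where
  "drop_coord j v = v - (v $ j) *\<^sub>R axis j 1"

lemma drop_coord_nth: "drop_coord j v $ i = (if i = j then 0 else v $ i)"
  by (simp add: drop_coord_def axis_def)

lemma bounded_linear_drop_coord: "bounded_linear (drop_coord j)"
  unfolding drop_coord_def
  by (intro bounded_linear_sub bounded_linear_ident bounded_linear_scaleR_const bounded_linear_vec_nth)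

lemma norm_drop_coord_le: "norm (drop_coord j v) \<le> 2 * norm v"
  using norm_triangle_ineq4[of v "(v $ j) *\<^sub>R axis j 1"] component_le_norm_cart[of v j]
  by (simp add: drop_coord_def)

text \<open>Codimension 2 enters here: a polynomial approximation of the inverse of the embedding,
  thickened along the axis \<open>j\<close>, still has a negligible image.\<close>

lemma perturb_off_axis:
  fixes g h :: "real ^ 'd::finite \<Rightarrow> real ^ 'd"
  assumes K: "compact K" and g: "continuous_on K g" and e: "e > 0"
    and h: "continuous_on K h" "inj_on h K" "j' \<noteq> j"
      "\<And>x. x \<in> K \<Longrightarrow> h x $ j = 0 \<and> h x $ j' = 0"
  shows "\<exists>\<delta>. continuous_on UNIV \<delta> \<and> (\<forall>x. norm (\<delta> x) \<le> e) \<and> (\<forall>x\<in>K. drop_coord j (g x + \<delta> x) \<noteq> 0)"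
proof -
  obtain k where k: "homeomorphism K (h ` K) h k"
    using homeomorphism_compact[OF K h(1) refl h(2)] by blast
  have "compact (h ` K)" using K h(1) compact_continuous_image by blast
  moreover have "continuous_on (h ` K) (g \<circ> k)"
    using k g by (metis continuous_on_compose homeomorphism_def)
  \<comment> \<open>The map \<open>g \<circ> k\<close> is merely continuous, so its image of a thin
    set could fill space. A polynomial map sends null sets to null sets.\<close>
  ultimately obtain P where P: "polynomial_function P"
    "\<And>y. y \<in> h ` K \<Longrightarrow> norm ((g \<circ> k) y - P y) < e / 2"
    using Stone_Weierstrass_polynomial_function[of "h ` K" "g \<circ> k" "e / 2"] e by auto
  have Ph: "norm (g x - P (h x)) < e / 2" if "x \<in> K" for x
    using P(2)[of "h x"] that k by (auto simp: homeomorphism_def)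
  define Q where "Q y = (P \<circ> drop_coord j) y + (y $ j) *\<^sub>R axis j 1" for y
  have "polynomial_function Q"
    unfolding Q_def
    by (intro polynomial_function_add polynomial_function_compose P(1)
        polynomial_function_bounded_linear bounded_linear_drop_coord
        bounded_linear_scaleR_const bounded_linear_vec_nth)
  then have "negligible (Q ` {y. y $ j' = 0})"
    by (intro negligible_differentiable_image_negligible[OF order_refl]
        negligible_standard_hyperplane_cart differentiable_on_polynomial_function)
  then have "\<not> ball 0 (e / 2) \<subseteq> Q ` {y. y $ j' = 0}"
    using e by (metis negligible_subset open_ball open_not_negligible ball_eq_empty half_gt_zero not_le)
  then obtain c where c_ball: "c \<in> ball 0 (e / 2)" and cQ: "c \<notin> Q ` {y. y $ j' = 0}" by blast
  have c: "norm c < e / 2" using c_ball by simp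
  \<comment> \<open>On \<open>K\<close> the perturbed map \<open>g + \<delta>0\<close> is
    \<open>P \<circ> h - c\<close>. If one of its values lay on the \<open>j\<close>-axis, then
    \<open>c\<close> would be a value of \<open>Q\<close> on the hyperplane.\<close>
  define \<delta>0 where "\<delta>0 x = P (h x) - g x - c" for x
  have "continuous_on K \<delta>0"
    unfolding \<delta>0_def
    by (intro continuous_intros g continuous_on_compose2[OF continuous_on_polymonial_function[OF P(1)] h(1)])
       auto
  moreover have "norm (\<delta>0 x) \<le> e" if "x \<in> K" for x
    using Ph[OF that] c norm_triangle_ineq4[of "P (h x) - g x" c]
    by (simp add: \<delta>0_def norm_minus_commute)
  ultimately obtain \<delta> where \<delta>: "continuous_on UNIV \<delta>" "\<And>x. x \<in> K \<Longrightarrow> \<delta> x = \<delta>0 x" "\<And>x. norm (\<delta> x) \<le> e"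
    using Tietze[of K \<delta>0 UNIV e] K e by (auto simp: compact_imp_closed)
  have "drop_coord j (g x + \<delta> x) \<noteq> 0" if x: "x \<in> K" for x
  proof
    assume "drop_coord j (g x + \<delta> x) = 0"
    then have 0: "drop_coord j (P (h x) - c) = 0" using \<delta>(2)[OF x] by (simp add: \<delta>0_def)
    define s where "s = (P (h x) - c) $ j"
    define y where "y = h x - s *\<^sub>R axis j 1"
    have "drop_coord j y = h x"
      using h(4)[OF x] by (simp add: vec_eq_iff drop_coord_nth y_def axis_def)
    moreover have "y $ j = - s" "y $ j' = 0"
      using h(3) h(4)[OF x] by (auto simp: y_def axis_def)
    moreover have "P (h x) - c = s *\<^sub>R axis j 1" using 0 by (simp add: drop_coord_def s_def)
    then have "c = P (h x) - s *\<^sub>R axis j 1" by (metis diff_diff_eq2 diff_add_cancel add_diff_cancel_left')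
    ultimately have "c = Q y" by (simp add: Q_def)
    then show False using cQ \<open>y $ j' = 0\<close> by blast
  qed
  then show ?thesis using \<delta> by blast
qed

text \<open>A purely topological form of codimension 2, since cells are known only up to
  homeomorphism; compactness makes the inverse of \<open>h\<close> continuous. The ambient space of
  \<open>K\<close> is left open because pieces of the variety in \<open>complex ^ 'd\<close> are
  pulled back to \<open>real ^ 'd\<close>.\<close>

definition embeds_codim_2 :: "'d::finite \<Rightarrow> 'a::topological_space set \<Rightarrow> bool" where
  "embeds_codim_2 j K \<longleftrightarrow> compact K \<and> (\<exists>(h :: 'a \<Rightarrow> real ^ 'd) j'. j' \<noteq> j \<and> continuous_on K h \<and>
     inj_on h K \<and> (\<forall>x\<in>K. h x $ j = 0 \<and> h x $ j' = 0))"

text \<open>Baire category in the complete space of bounded continuous maps: for each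
  \<open>K\<close> the suitable perturbations form an open set, by compactness, and a dense one, by
  \<open>perturb_off_axis\<close>. Countably many pieces must be treated because open cells are
  exhausted by compact cubes.\<close>

lemma perturb_off_axis_countable:
  fixes \<K> :: "(real ^ 'd::finite) set set"
  assumes "countable \<K>" and "e > 0"
    and K: "\<And>K. K \<in> \<K> \<Longrightarrow> embeds_codim_2 j K"
  shows "\<exists>\<delta>. continuous_on UNIV \<delta> \<and> (\<forall>x. norm (\<delta> x) < e) \<and> (\<forall>x\<in>\<Union>\<K>. drop_coord j (x + \<delta> x) \<noteq> 0)"
proof -
  define D :: "(real ^ 'd) set \<Rightarrow> ((real ^ 'd) \<Rightarrow>\<^sub>C (real ^ 'd)) set" where
    "D K = {\<delta>. \<forall>x\<in>K. drop_coord j (x + apply_bcontfun \<delta> x) \<noteq> 0}" for K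
  have "open (D K)" if KK: "K \<in> \<K>" for K
  proof (unfold open_dist, intro ballI)
    fix \<delta> assume \<delta>: "\<delta> \<in> D K"
    have 1: "continuous_on K (\<lambda>x. drop_coord j (x + apply_bcontfun \<delta> x))"
      by (intro bounded_linear.continuous_on[OF bounded_linear_drop_coord] continuous_intros) auto
    have 2: "\<not> (\<exists>x\<in>K. drop_coord j (x + apply_bcontfun \<delta> x) = 0)" using \<delta> by (auto simp: D_def)
    have 3: "compact K" using K[OF KK] by (simp add: embeds_codim_2_def)
    obtain d where d: "d > 0" "\<forall>x\<in>K. d \<le> norm (drop_coord j (x + apply_bcontfun \<delta> x))"
      using brouwer_compactness_lemma[OF 3 1 2] by blast
    have "\<delta>' \<in> D K" if "dist \<delta>' \<delta> < d / 2" for \<delta>'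
    proof -
      have "drop_coord j (x + apply_bcontfun \<delta>' x) \<noteq> 0" if "x \<in> K" for x
      proof
        assume 0: "drop_coord j (x + apply_bcontfun \<delta>' x) = 0"
        have "drop_coord j (apply_bcontfun \<delta> x - apply_bcontfun \<delta>' x) =
            drop_coord j (x + apply_bcontfun \<delta> x) - drop_coord j (x + apply_bcontfun \<delta>' x)"
          by (simp add: linear_diff[OF bounded_linear.linear[OF bounded_linear_drop_coord], symmetric])
        then have "d \<le> norm (drop_coord j (apply_bcontfun \<delta> x - apply_bcontfun \<delta>' x))"
          using d(2) \<open>x \<in> K\<close> 0 by simp
        also have "\<dots> \<le> 2 * dist (apply_bcontfun \<delta>' x) (apply_bcontfun \<delta> x)"
          by (metis dist_norm dist_commute norm_drop_coord_le)
        also have "\<dots> \<le> 2 * dist \<delta>' \<delta>" using dist_bounded by simp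
        finally show False using \<open>dist \<delta>' \<delta> < d / 2\<close> by simp
      qed
      then show ?thesis by (simp add: D_def)
    qed
    then show "\<exists>e>0. \<forall>\<delta>'. dist \<delta>' \<delta> < e \<longrightarrow> \<delta>' \<in> D K" using d(1) by (intro exI[of _ "d / 2"]) auto
  qed
  moreover have "closure (D K) = UNIV" if KK: "K \<in> \<K>" for K
  proof -
    have "\<exists>\<delta>'\<in>D K. dist \<delta>' \<delta> < r" if "r > 0" for r \<delta>
    proof -
      have "compact K" using K[OF KK] by (simp add: embeds_codim_2_def)
      obtain h :: "real ^ 'd \<Rightarrow> real ^ 'd" and j' where hj: "j' \<noteq> j" "continuous_on K h" "inj_on h K"
        "\<And>x. x \<in> K \<Longrightarrow> h x $ j = 0 \<and> h x $ j' = 0"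
        using K[OF KK] unfolding embeds_codim_2_def by metis
      have "continuous_on K (\<lambda>x. x + apply_bcontfun \<delta> x)" by (intro continuous_intros) auto
      then obtain \<eta> where \<eta>: "continuous_on UNIV \<eta>" "\<And>x. norm (\<eta> x) \<le> r / 2"
        "\<And>x. x \<in> K \<Longrightarrow> drop_coord j ((x + apply_bcontfun \<delta> x) + \<eta> x) \<noteq> 0"
        using perturb_off_axis[of K "\<lambda>x. x + apply_bcontfun \<delta> x" "r / 2" h j' j] hj \<open>compact K\<close> \<open>r > 0\<close>
        by auto
      have "\<eta> \<in> bcontfun" using \<eta>(1,2) by (rule bcontfun_normI)
      then have B: "apply_bcontfun (Bcontfun \<eta>) = \<eta>" by (simp add: Bcontfun_inverse)
      have "\<delta> + Bcontfun \<eta> \<in> D K" using \<eta>(3) by (simp add: D_def B add.assoc plus_bcontfun.rep_eq)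
      moreover have "dist (\<delta> + Bcontfun \<eta>) \<delta> \<le> r / 2"
      proof (rule dist_bound)
        show "dist (apply_bcontfun (\<delta> + Bcontfun \<eta>) x) (apply_bcontfun \<delta> x) \<le> r / 2" for x
          using \<eta>(2)[of x] by (simp add: dist_norm B plus_bcontfun.rep_eq)
      qed
      ultimately show ?thesis using \<open>r > 0\<close> by (intro bexI[of _ "\<delta> + Bcontfun \<eta>"]) auto
    qed
    then show ?thesis by (auto simp: closure_approachable)
  qed
  ultimately have "closure (\<Inter>(D ` \<K>)) = UNIV"
    using Met_TC.metric_Baire_category[of "D ` \<K>"] \<open>countable \<K>\<close>
    by (auto simp: Met_TC.mcomplete_def complete_UNIV Cauchy_convergent_iff convergent_def)
  then obtain \<delta> where \<delta>: "\<delta> \<in> \<Inter>(D ` \<K>)" "dist \<delta> 0 < e"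
    using \<open>e > 0\<close> by (metis UNIV_I closure_approachable)
  have "norm (apply_bcontfun \<delta> x) < e" for x
    using dist_bounded[of \<delta> x 0] \<delta>(2) by simp
  then show ?thesis using \<delta>(1) by (intro exI[of _ "apply_bcontfun \<delta>"]) (auto simp: D_def)
qed

text \<open>If the zero set of \<open>\<phi>\<close> is contained in the given sets, then replacing the \<open>j\<close>-th coordinate of a
  perturbation of the identity by \<open>\<phi>\<close> yields a map without zeros.\<close>

lemma codim_2_no_separation:
  fixes \<phi> :: "real ^ 'd::finite \<Rightarrow> real"
  assumes cont: "continuous_on (cbox (-1) 1) \<phi>"
    and pos: "\<And>x. x \<in> cbox (-1) 1 \<Longrightarrow> x $ j = 1 \<Longrightarrow> \<phi> x > 0"
    and neg: "\<And>x. x \<in> cbox (-1) 1 \<Longrightarrow> x $ j = -1 \<Longrightarrow> \<phi> x < 0"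
    and zeros: "{x \<in> cbox (-1) 1. \<phi> x = 0} \<subseteq> \<Union>\<K>" and "countable \<K>"
    and "\<And>K. K \<in> \<K> \<Longrightarrow> embeds_codim_2 j K"
  shows False
proof -
  obtain \<delta> :: "real ^ 'd \<Rightarrow> real ^ 'd" where \<delta>: "continuous_on UNIV \<delta>" "\<And>x. norm (\<delta> x) < 1"
    "\<And>x. x \<in> \<Union>\<K> \<Longrightarrow> drop_coord j (x + \<delta> x) \<noteq> 0"
    using perturb_off_axis_countable[OF \<open>countable \<K>\<close> zero_less_one assms(6)] by metis
  define \<Psi> where "\<Psi> x = drop_coord j (x + \<delta> x) + \<phi> x *\<^sub>R axis j 1" for x
  have \<Psi>_nth: "\<Psi> x $ i = (if i = j then \<phi> x else x $ i + \<delta> x $ i)" for x i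
    by (simp add: \<Psi>_def drop_coord_nth axis_def)
  \<comment> \<open>A perturbation smaller than 1 does not change the sign of a coordinate on the
    faces where it is 1 or -1.\<close>
  have \<delta>_nth: "\<bar>\<delta> x $ i\<bar> < 1" for x i
    using component_le_norm_cart[of "\<delta> x" i] \<delta>(2)[of x] by linarith
  have "\<exists>x\<in>cbox (-1) 1. \<Psi> x = 0"
  proof (rule poincare_miranda)
    show "continuous_on (cbox (- 1) 1) \<Psi>" unfolding \<Psi>_def
      by (intro continuous_intros cont bounded_linear.continuous_on[OF bounded_linear_drop_coord]
          continuous_on_subset[OF \<delta>(1)]) auto
    show "\<Psi> x $ i > 0" if "x \<in> cbox (-1) 1" "x $ i = 1" for x i
      using pos that \<delta>_nth[of x i] by (auto simp: \<Psi>_nth)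
    show "\<Psi> x $ i < 0" if "x \<in> cbox (-1) 1" "x $ i = -1" for x i
      using neg that \<delta>_nth[of x i] by (auto simp: \<Psi>_nth)
  qed
  then obtain x where x: "x \<in> cbox (-1) 1" "\<Psi> x = 0" by blast
  then have "\<Psi> x $ i = 0" for i by simp
  then have "\<phi> x = 0" "drop_coord j (x + \<delta> x) = 0"
    using \<Psi>_nth by (auto simp: vec_eq_iff drop_coord_nth split: if_splits) metis+
  then show False using \<delta>(3) zeros x(1) by blast
qed

subsection \<open>Laurent polynomials on the torus\<close>

text \<open>Angles range over the covering space with period \<open>2 * pi\<close>. Square roots of
  characters exist there as continuous functions even if they do not descend to the torus.\<close>

definition character :: "int ^ 'd::finite \<Rightarrow> real ^ 'd \<Rightarrow> complex" where
  "character n t = cis (\<Sum>j\<in>UNIV. of_int (n $ j) * t $ j)"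

definition torus_eval :: "'d::finite laurent \<Rightarrow> real ^ 'd \<Rightarrow> complex" where
  "torus_eval f t = linear_eval f (\<lambda>n. character n t)"

definition torus_point :: "real ^ 'd::finite \<Rightarrow> complex ^ 'd" where
  "torus_point t = (\<chi> j. cis (t $ j))"

text \<open>For the weights \<open>\<lambda>n. n $ j\<close> this is the Euler operator
  \<open>x_j d/dx_j\<close>, which is differentiation in the \<open>j\<close>-th angle up to the
  factor \<open>\<i>\<close>.\<close>

definition diagonal :: "('k \<Rightarrow> int) \<Rightarrow> ('k \<Rightarrow>\<^sub>0 int) \<Rightarrow> ('k \<Rightarrow>\<^sub>0 int)" where
  "diagonal \<mu> = frag_extend (\<lambda>k. frag_cmul (\<mu> k) (frag_of k))"

definition coeff_norm :: "('k \<Rightarrow>\<^sub>0 int) \<Rightarrow> real" where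
  "coeff_norm f = (\<Sum>k\<in>keys f. \<bar>of_int (lookup f k)\<bar>)"

lemma norm_linear_eval_le:
  fixes w :: "'k \<Rightarrow> 'b::{comm_ring_1, real_normed_div_algebra}"
  assumes "\<And>k. k \<in> keys f \<Longrightarrow> norm (w k) \<le> c"
  shows "norm (linear_eval f w) \<le> coeff_norm f * c"
  unfolding linear_eval_def coeff_norm_def sum_distrib_right
  by (intro sum_norm_le) (auto simp: norm_mult intro!: mult_left_mono assms)

lemma coeff_norm_nonneg: "coeff_norm f \<ge> 0"
  by (simp add: coeff_norm_def sum_nonneg)

lemma lookup_diagonal: "lookup (diagonal \<mu> f) k = \<mu> k * lookup f k"
  by (induction f rule: laurent_induct)
     (auto simp: diagonal_def frag_extend_diff lookup_minus right_diff_distrib)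

lemma linear_eval_diagonal: "linear_eval (diagonal \<mu> f) w = linear_eval f (\<lambda>k. of_int (\<mu> k) * w k)"
proof -
  have "keys (diagonal \<mu> f) \<subseteq> keys f" by (auto simp: in_keys_iff lookup_diagonal)
  then show ?thesis
    by (simp add: linear_eval_superset[of "keys f"] lookup_diagonal mult_ac)
qed

lemma norm_character [simp]: "norm (character n t) = 1"
  by (simp add: character_def)

lemma character_add: "character (m + n) t = character m t * character n t"
  by (simp add: character_def cis_mult distrib_right sum.distrib)

lemma character_0 [simp]: "character 0 t = 1"
  by (simp add: character_def)

lemma cnj_character: "cnj (character n t) = character (-n) t"
  by (simp add: character_def cis_cnj sum_negf)

lemma cis_power_int: "cis x powi n = cis (of_int n * x)"
  by (cases n rule: int_cases2) (auto simp: power_int_minus Complex.DeMoivre)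

lemma cis_sum: "finite A \<Longrightarrow> cis (\<Sum>a\<in>A. g a) = (\<Prod>a\<in>A. cis (g a))"
  by (induction A rule: finite_induct) (auto simp: cis_mult[symmetric])

lemma laurent_eval_torus_point: "laurent_eval f (torus_point t) = torus_eval f t"
  unfolding laurent_eval_def torus_eval_def linear_eval_def character_def
  by (simp add: torus_point_def cis_power_int cis_sum)

lemma torus_point_mem_variety: "torus_point t \<in> unitary_variety f \<longleftrightarrow> torus_eval f t = 0"
  by (simp add: unitary_variety_def laurent_eval_torus_point) (simp add: torus_point_def)

lemma torus_eval_diff: "torus_eval (p - q) t = torus_eval p t - torus_eval q t"
  by (simp add: torus_eval_def linear_eval_diff)

lemma torus_eval_frag_of [simp]: "torus_eval (frag_of k) t = character k t"
  by (simp add: torus_eval_def)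

lemma torus_eval_0 [simp]: "torus_eval 0 t = 0"
  by (simp add: torus_eval_def)

lemma torus_eval_1 [simp]: "torus_eval 1 t = 1"
  by (metis character_0 single_one torus_eval_frag_of)

lemma torus_eval_mult: "torus_eval (p * q) t = torus_eval p t * torus_eval q t"
proof (induction p rule: laurent_induct)
  case (monomial k)
  show ?case
    by (induction q rule: laurent_induct)
       (simp_all add: frag_of_mult character_add right_diff_distrib torus_eval_diff)
qed (simp_all add: left_diff_distrib torus_eval_diff)

lemma torus_eval_power: "torus_eval (p ^ n) t = torus_eval p t ^ n"
  by (induction n) (simp_all add: torus_eval_mult)

lemma norm_torus_eval_le: "norm (torus_eval f t) \<le> coeff_norm f"
  using norm_linear_eval_le[of f "\<lambda>n. character n t" 1] by (simp add: torus_eval_def)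

lemma continuous_on_torus_eval [continuous_intros]: "continuous_on S (torus_eval f)"
  unfolding torus_eval_def linear_eval_def character_def by (intro continuous_intros)

definition reflect :: "'d::finite laurent \<Rightarrow> 'd laurent" where
  "reflect = map_exponents uminus"

lemma reflect_mult: "reflect (p * q) = reflect p * reflect q"
  unfolding reflect_def by (rule map_exponents_mult) simp

lemma reflect_reflect: "reflect (reflect p) = p"
  by (simp add: reflect_def map_exponents_compose comp_def map_exponents_ident)

lemma lookup_reflect: "lookup (reflect p) (-k) = lookup p k"
  unfolding reflect_def by (rule lookup_map_exponents) (simp add: inj_on_def)

lemma torus_eval_reflect: "torus_eval (reflect p) t = cnj (torus_eval p t)"
  by (induction p rule: laurent_induct)
     (simp_all add: reflect_def torus_eval_diff cnj_character)

lemma character_axis: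
  "character n (t + s *\<^sub>R axis j 1) = character n t * cis (of_int (n $ j) * s)"
proof -
  have "(\<Sum>i\<in>UNIV. of_int (n $ i) * (t + s *\<^sub>R axis j 1) $ i) =
        (\<Sum>i\<in>UNIV. of_int (n $ i) * t $ i) + (\<Sum>i\<in>UNIV. if i = j then of_int (n $ i) * s else 0)"
    by (subst sum.distrib[symmetric], intro sum.cong) (auto simp: axis_def algebra_simps)
  then show ?thesis by (simp add: character_def cis_mult)
qed

lemma has_vector_derivative_cis_linear:
  "((\<lambda>s. cis (a * s)) has_vector_derivative (\<i> * of_real a * cis (a * s))) (at s within S)"
  unfolding cis_conv_exp
  by (auto intro!: derivative_eq_intros has_vector_derivative_real_field simp: algebra_simps)

lemma torus_eval_has_vector_derivative:
  "((\<lambda>s. torus_eval f (t + s *\<^sub>R axis j 1)) has_vector_derivative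
     \<i> * torus_eval (diagonal (\<lambda>n. n $ j) f) (t + s *\<^sub>R axis j 1)) (at s within S)"
proof -
  have "((\<lambda>s. \<Sum>n\<in>keys f. of_int (lookup f n) * (character n t * cis (of_int (n $ j) * s)))
     has_vector_derivative (\<Sum>n\<in>keys f. of_int (lookup f n) *
       (character n t * (\<i> * of_real (of_int (n $ j)) * cis (of_int (n $ j) * s))))) (at s within S)"
    by (intro has_vector_derivative_sum has_vector_derivative_mult_right has_vector_derivative_cis_linear)
  also have "(\<Sum>n\<in>keys f. of_int (lookup f n) *
       (character n t * (\<i> * of_real (of_int (n $ j)) * cis (of_int (n $ j) * s)))) =
     \<i> * torus_eval (diagonal (\<lambda>n. n $ j) f) (t + s *\<^sub>R axis j 1)"
    unfolding torus_eval_def linear_eval_diagonal unfolding linear_eval_def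
    by (simp add: sum_distrib_left character_axis mult_ac)
  finally show ?thesis by (simp add: torus_eval_def linear_eval_def character_axis)
qed

text \<open>Coordinates of two points in such a ball differ by at most 2, which is less than the
  period \<open>2 * pi\<close>.\<close>

lemma torus_point_inject:
  assumes "torus_point x = torus_point y" "x \<in> cball v 1" "y \<in> cball v 1"
  shows "x = y"
proof -
  have "x $ j = y $ j" for j
  proof -
    have "cis (x $ j) = cis (y $ j)"
      using arg_cong[OF assms(1), of "\<lambda>v. v $ j"] by (simp add: torus_point_def)
    then have "sin (x $ j) = sin (y $ j) \<and> cos (x $ j) = cos (y $ j)"
      by (auto simp: complex_eq_iff)
    then obtain n :: int where n: "x $ j = y $ j + 2 * pi * n"
      by (auto simp: sin_cos_eq_iff)
    have "norm (x - y) \<le> 2"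
      using assms(2,3) norm_triangle_ineq4[of "v - y" "v - x"] by (auto simp: dist_norm)
    then have "\<bar>x $ j - y $ j\<bar> \<le> 2" using component_le_norm_cart[of "x - y" j] by simp
    then have le: "2 * pi * \<bar>of_int n\<bar> \<le> 2" by (simp add: n abs_mult)
    have "n = 0"
    proof (rule ccontr)
      assume "n \<noteq> 0"
      then have "1 \<le> \<bar>real_of_int n\<bar>" by linarith
      then have "2 * pi * 1 \<le> 2 * pi * \<bar>of_int n\<bar>" by (intro mult_left_mono) auto
      then show False using le pi_gt3 by linarith
    qed
    then show ?thesis using n by simp
  qed
  then show ?thesis by (simp add: vec_eq_iff)
qed

section \<open>Compact pieces of the unitary variety and absence of sign changes\<close>

lemma open_cube_exhaustion:
  fixes B :: "'a::euclidean_space set"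
  assumes "B \<subseteq> Basis"
  shows "open_cube B = (\<Union>m. cbox (\<Sum>b\<in>B. inverse (real (Suc m)) *\<^sub>R b) (\<Sum>b\<in>B. (1 - inverse (real (Suc m))) *\<^sub>R b))"
proof -
  have fin: "finite B" using assms finite_subset finite_Basis by blast
  have inner: "(\<Sum>b\<in>B. c *\<^sub>R b) \<bullet> i = (if i \<in> B then c else 0)" if "i \<in> Basis" for c :: real and i
  proof -
    have "(\<Sum>b\<in>B. c *\<^sub>R b) \<bullet> i = (\<Sum>b\<in>B. if b = i then c else 0)"
      unfolding inner_sum_left using that assms
      by (intro sum.cong refl) (auto simp: inner_Basis)
    then show ?thesis using fin by simp
  qed
  have mem: "x \<in> cbox (\<Sum>b\<in>B. e *\<^sub>R b) (\<Sum>b\<in>B. (1 - e) *\<^sub>R b) \<longleftrightarrow>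
    (\<forall>b\<in>B. e \<le> x \<bullet> b \<and> x \<bullet> b \<le> 1 - e) \<and> (\<forall>b\<in>Basis - B. x \<bullet> b = 0)" for x and e :: real
    using assms by (auto simp: mem_box inner split: if_splits intro: antisym)
  show ?thesis
  proof (intro equalityI subsetI)
    fix x assume x: "x \<in> open_cube B"
    define r where "r = Min (insert 1 ((\<lambda>b. min (x \<bullet> b) (1 - x \<bullet> b)) ` B))"
    have "r > 0" using x fin unfolding r_def by (subst Min_gr_iff) (auto simp: open_cube_def)
    then obtain m where m: "inverse (real (Suc m)) < r" using reals_Archimedean by blast
    have "r \<le> min (x \<bullet> b) (1 - x \<bullet> b)" if "b \<in> B" for b
      unfolding r_def using fin that by (intro Min_le) auto
    then have "x \<in> cbox (\<Sum>b\<in>B. inverse (real (Suc m)) *\<^sub>R b) (\<Sum>b\<in>B. (1 - inverse (real (Suc m))) *\<^sub>R b)"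
      unfolding mem using x m by (fastforce simp: open_cube_def)
    then show "x \<in> (\<Union>m. cbox (\<Sum>b\<in>B. inverse (real (Suc m)) *\<^sub>R b) (\<Sum>b\<in>B. (1 - inverse (real (Suc m))) *\<^sub>R b))"
      by blast
  next
    fix x assume "x \<in> (\<Union>m. cbox (\<Sum>b\<in>B. inverse (real (Suc m)) *\<^sub>R b) (\<Sum>b\<in>B. (1 - inverse (real (Suc m))) *\<^sub>R b))"
    then obtain m where "x \<in> cbox (\<Sum>b\<in>B. inverse (real (Suc m)) *\<^sub>R b) (\<Sum>b\<in>B. (1 - inverse (real (Suc m))) *\<^sub>R b)"
      by blast
    then have m: "\<forall>b\<in>B. inverse (real (Suc m)) \<le> x \<bullet> b \<and> x \<bullet> b \<le> 1 - inverse (real (Suc m))"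
      "\<forall>b\<in>Basis - B. x \<bullet> b = 0" unfolding mem by auto
    have e: "inverse (real (Suc m)) > 0" by simp
    have "0 < x \<bullet> b \<and> x \<bullet> b < 1" if "b \<in> B" for b
    proof -
      have "inverse (real (Suc m)) \<le> x \<bullet> b" "x \<bullet> b \<le> 1 - inverse (real (Suc m))"
        using m(1) that by blast+
      then show ?thesis using e by linarith
    qed
    then show "x \<in> open_cube B" using m(2) by (simp add: open_cube_def)
  qed
qed

text \<open>The \<open>k\<close> directions in \<open>B\<close> can be relabelled injectively by
  coordinates other than \<open>j\<close> and one further \<open>j'\<close>, because
  \<open>k + 2 \<le> CARD('d)\<close>. The pieces are the preimages of the compact cubes that
  exhaust the open cube.\<close>

lemma cell_compact_pieces:
  fixes C :: "(complex ^ 'd::finite) set" and j :: 'd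
  assumes "semialg_cell C k" "k + 2 \<le> CARD('d)"
  shows "\<exists>\<L>. countable \<L> \<and> \<Union>\<L> = C \<and> (\<forall>L\<in>\<L>. embeds_codim_2 j L)"
proof -
  obtain B :: "(complex ^ 'd) set" and h g where
    B: "B \<subseteq> Basis" "card B = k" and hom: "homeomorphism C (open_cube B) h g"
    using assms(1) unfolding semialg_cell_def by blast
  have fin: "finite B" using B finite_subset finite_Basis by blast
  have "card (UNIV - {j}) > 0" using assms(2) by (simp add: card_Diff_singleton)
  then obtain j' where j': "j' \<noteq> j" by (metis card_gt_0_iff DiffD2 ex_in_conv singletonI)
  have "card B \<le> card (UNIV - {j, j'})"
    using assms(2) B j' by (subst card_Diff_subset) auto
  then obtain \<iota> where \<iota>: "\<iota> ` B \<subseteq> UNIV - {j, j'}" "inj_on \<iota> B"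
    using card_le_inj[OF fin, of "UNIV - {j, j'}"] by auto
  define h' :: "complex ^ 'd \<Rightarrow> real ^ 'd" where "h' x = (\<Sum>b\<in>B. (h x \<bullet> b) *\<^sub>R axis (\<iota> b) 1)" for x
  have h'_\<iota>: "h' x $ (\<iota> b) = h x \<bullet> b" if "b \<in> B" for x b
  proof -
    have "h' x $ (\<iota> b) = (\<Sum>c\<in>B. if c = b then h x \<bullet> b else 0)"
      unfolding h'_def sum_component using \<iota>(2) that
      by (intro sum.cong refl) (auto simp: axis_def inj_on_def)
    then show ?thesis using fin that by simp
  qed
  have h'_0: "h' x $ i = 0" if "i \<notin> \<iota> ` B" for x i
    unfolding h'_def sum_component using that by (intro sum.neutral) (auto simp: axis_def)
  define Q where "Q m = cbox (\<Sum>b\<in>B. inverse (real (Suc m)) *\<^sub>R b) (\<Sum>b\<in>B. (1 - inverse (real (Suc m))) *\<^sub>R b)" for m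
  have Q: "open_cube B = (\<Union>m. Q m)" unfolding Q_def by (rule open_cube_exhaustion[OF B(1)])
  define \<L> where "\<L> = range (\<lambda>m. g ` Q m)"
  have "\<Union>\<L> = g ` open_cube B" by (auto simp: \<L>_def Q)
  then have "\<Union>\<L> = C" using hom by (auto simp: homeomorphism_def)
  moreover have "embeds_codim_2 j L" if L: "L \<in> \<L>" for L
    unfolding embeds_codim_2_def
  proof (intro conjI exI[of _ h'] exI[of _ j'] ballI j')
    obtain m where m: "L = g ` Q m" using L by (auto simp: \<L>_def)
    have "continuous_on (Q m) g"
      using hom Q by (auto simp: homeomorphism_def intro: continuous_on_subset)
    then show "compact L" unfolding m Q_def by (intro compact_continuous_image compact_cbox)
    have LC: "L \<subseteq> C" using L \<open>\<Union>\<L> = C\<close> by blast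
    have "continuous_on L h" using hom LC by (auto simp: homeomorphism_def intro: continuous_on_subset)
    then show "continuous_on L h'" unfolding h'_def by (intro continuous_intros)
    show "inj_on h' L"
    proof (rule inj_onI)
      fix x y assume xy: "x \<in> L" "y \<in> L" "h' x = h' y"
      have "h x \<in> open_cube B" "h y \<in> open_cube B" using xy LC hom by (auto simp: homeomorphism_def)
      then have "h x \<bullet> b = h y \<bullet> b" if "b \<in> Basis" for b
        using that xy(3) h'_\<iota>[of b x] h'_\<iota>[of b y] by (cases "b \<in> B") (auto simp: open_cube_def)
      then have "h x = h y" by (rule euclidean_eqI)
      then show "x = y" using xy LC hom unfolding homeomorphism_def by (metis subsetD)
    qed
    show "h' x $ j = 0" "h' x $ j' = 0" for x using \<iota>(1) by (auto intro!: h'_0)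
  qed
  moreover have "countable \<L>" by (simp add: \<L>_def)
  ultimately show ?thesis by blast
qed

lemma atoral_compact_pieces:
  fixes f :: "'d::finite laurent" and j :: 'd
  assumes "atoral f"
  shows "\<exists>\<L>. countable \<L> \<and> \<Union>\<L> = unitary_variety f \<and> (\<forall>L\<in>\<L>. embeds_codim_2 j L)"
proof -
  obtain \<C> \<delta> k where C: "finite \<C>" "\<Union>\<C> = unitary_variety f" "\<forall>C\<in>\<C>. semialg_cell C (\<delta> C)"
    "k = (if \<C> = {} then -1 else int (Max (\<delta> ` \<C>)))" "k \<le> int CARD('d) - 2"
    using assms unfolding atoral_def semialg_dim_def by blast
  have "\<delta> C + 2 \<le> CARD('d)" if "C \<in> \<C>" for C
  proof -
    have "\<delta> C \<le> Max (\<delta> ` \<C>)" using that C(1) by simp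
    then show ?thesis using C(4,5) that by (auto split: if_splits)
  qed
  then have "\<forall>C\<in>\<C>. \<exists>\<L>. countable \<L> \<and> \<Union>\<L> = C \<and> (\<forall>L\<in>\<L>. embeds_codim_2 j L)"
    using C(3) by (auto intro!: cell_compact_pieces)
  then obtain LL where LL: "\<forall>C\<in>\<C>. countable (LL C) \<and> \<Union>(LL C) = C \<and> (\<forall>L\<in>LL C. embeds_codim_2 j L)"
    by (rule bchoice[THEN exE])
  have "\<Union>(\<Union>C\<in>\<C>. LL C) = unitary_variety f" using C(2) LL by blast
  moreover have "countable (\<Union>C\<in>\<C>. LL C)" using C(1) LL by (intro countable_UN) (auto simp: countable_finite)
  ultimately show ?thesis using LL by (intro exI[of _ "\<Union>C\<in>\<C>. LL C"]) auto
qed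

lemma continuous_on_torus_point: "continuous_on S torus_point"
  unfolding torus_point_def by (intro continuous_intros)

text \<open>The affine map \<open>T\<close> sends the cube to a thin box around the segment between
  the two points. The face \<open>x $ j = 1\<close> lands near the point where \<open>\<phi>\<close>
  is positive and the opposite face near the one where it is negative, so the zeros in the box would
  separate the two faces.\<close>

lemma atoral_no_sign_change:
  fixes f :: "'d::finite laurent" and \<phi> :: "real ^ 'd \<Rightarrow> real"
  assumes f: "atoral f" and cont: "continuous_on UNIV \<phi>"
    and zero: "\<And>t. \<phi> t = 0 \<longleftrightarrow> torus_eval f t = 0"
    and pos: "\<phi> t > 0" and neg: "\<phi> (t + s *\<^sub>R axis j 1) < 0"
  shows False
proof -
  have "s \<noteq> 0" using pos neg by auto
  have open_pos: "open {x. \<phi> x > 0}" and open_neg: "open {x. \<phi> x < 0}"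
    using cont by (auto intro!: open_Collect_less continuous_intros)
  obtain r where r: "r > 0" "ball t r \<subseteq> {x. \<phi> x > 0}"
    using open_pos pos by (auto elim: openE)
  obtain r' where r': "r' > 0" "ball (t + s *\<^sub>R axis j 1) r' \<subseteq> {x. \<phi> x < 0}"
    using open_neg neg by (auto elim: openE)
  obtain b where b: "b > 0" "\<And>x. x \<in> cbox (-1) (1 :: real ^ 'd) \<Longrightarrow> norm x \<le> b"
    using bounded_cbox[of "-1" "1 :: real ^ 'd"] by (auto simp: bounded_pos)
  \<comment> \<open>Dropping a coordinate at most doubles the norm; the factor 3 in place of 2 makes
    the estimate strict.\<close>
  define d where "d = min r r' / (3 * b)"
  have d: "d > 0" using r r' b by (simp add: d_def)
  have small: "norm (d *\<^sub>R drop_coord j x) < min r r'" if "x \<in> cbox (-1) 1" for x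
  proof -
    have "norm (d *\<^sub>R drop_coord j x) \<le> d * (2 * b)"
      using d norm_drop_coord_le[of j x] b(2)[OF that] by (simp add: mult_left_mono)
    also have "\<dots> < d * (3 * b)" using d b by simp
    also have "\<dots> = min r r'" using b by (simp add: d_def)
    finally show ?thesis .
  qed
  define T where "T x = (t + (s / 2) *\<^sub>R axis j 1) + (d *\<^sub>R drop_coord j x - (s / 2 * x $ j) *\<^sub>R axis j 1)" for x
  have T_inj: "inj T"
  proof (rule injI)
    fix x y assume "T x = T y"
    then have eq: "d *\<^sub>R drop_coord j x - (s / 2 * x $ j) *\<^sub>R axis j 1 = d *\<^sub>R drop_coord j y - (s / 2 * y $ j) *\<^sub>R axis j 1"
      by (simp add: T_def)
    have "x $ i = y $ i" for i
      using arg_cong[OF eq, of "\<lambda>v. v $ i"] \<open>s \<noteq> 0\<close> d by (cases "i = j") (auto simp: drop_coord_nth axis_def)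
    then show "x = y" by (simp add: vec_eq_iff)
  qed
  have T_cont: "continuous_on S T" for S
    unfolding T_def by (intro continuous_intros bounded_linear.continuous_on[OF bounded_linear_drop_coord])
  obtain \<L> where \<L>: "countable \<L>" "\<Union>\<L> = unitary_variety f" "\<And>L. L \<in> \<L> \<Longrightarrow> embeds_codim_2 j L"
    using atoral_compact_pieces[OF f, of j] by metis
  have "compact (T ` cbox (-1) 1)" by (intro compact_continuous_image T_cont compact_cbox)
  then obtain V where V: "finite V" "T ` cbox (-1) 1 \<subseteq> (\<Union>v\<in>V. ball v 1)"
    using compact_eq_totally_bounded[of "T ` cbox (-1) 1"] zero_less_one by metis
  \<comment> \<open>Within a ball of radius 1 \<open>torus_point\<close> is injective, so the pulled
    back pieces inherit the embeddings of the pieces of the variety.\<close>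
  define K where "K L v = {x \<in> cbox (-1) 1. torus_point (T x) \<in> L \<and> T x \<in> cball v 1}" for L v
  define \<K> where "\<K> = (\<lambda>(L, v). K L v) ` (\<L> \<times> V)"
  show False
  proof (rule codim_2_no_separation[of "\<phi> \<circ> T" j \<K>])
    show "continuous_on (cbox (- 1) 1) (\<phi> \<circ> T)"
      by (intro continuous_on_compose T_cont continuous_on_subset[OF cont]) auto
    show "(\<phi> \<circ> T) x > 0" if "x \<in> cbox (-1) 1" "x $ j = 1" for x
    proof -
      have "T x = t + d *\<^sub>R drop_coord j x" using that(2) by (simp add: T_def)
      then have "T x \<in> ball t r" using small[OF that(1)] by (simp add: dist_norm)
      then show ?thesis using r by auto
    qed
    show "(\<phi> \<circ> T) x < 0" if "x \<in> cbox (-1) 1" "x $ j = -1" for x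
    proof -
      have "T x = (t + s *\<^sub>R axis j 1) + d *\<^sub>R drop_coord j x"
        using that(2) by (auto simp: T_def vec_eq_iff axis_def)
      then have "T x \<in> ball (t + s *\<^sub>R axis j 1) r'" using small[OF that(1)] by (simp add: dist_norm)
      then show ?thesis using r' by auto
    qed
    show "countable \<K>" using \<L>(1) V(1) by (auto simp: \<K>_def countable_finite)
    show "{x \<in> cbox (- 1) 1. (\<phi> \<circ> T) x = 0} \<subseteq> \<Union>\<K>"
    proof
      fix x assume "x \<in> {x \<in> cbox (- 1) 1. (\<phi> \<circ> T) x = 0}"
      then have x: "x \<in> cbox (-1) 1" "torus_point (T x) \<in> unitary_variety f"
        by (auto simp: zero torus_point_mem_variety)
      then obtain L where "L \<in> \<L>" "torus_point (T x) \<in> L" using \<L>(2) by blast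
      moreover obtain v where "v \<in> V" "T x \<in> ball v 1" using V x(1) by blast
      ultimately have "x \<in> K L v" "K L v \<in> \<K>" using x(1) by (auto simp: \<K>_def K_def)
      then show "x \<in> \<Union>\<K>" by blast
    qed
    fix M assume "M \<in> \<K>"
    then obtain L v where M: "L \<in> \<L>" "M = K L v" by (auto simp: \<K>_def)
    obtain h :: "complex ^ 'd \<Rightarrow> real ^ 'd" and j' where h: "compact L" "j' \<noteq> j"
      "continuous_on L h" "inj_on h L" "\<forall>x\<in>L. h x $ j = 0 \<and> h x $ j' = 0"
      using \<L>(3)[OF M(1)] unfolding embeds_codim_2_def by blast
    have "closed L" using h(1) compact_imp_closed by blast
    have "M = cbox (-1) 1 \<inter> ((\<lambda>x. torus_point (T x)) -` L \<inter> T -` cball v 1)"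
      by (auto simp: M K_def)
    moreover have "closed ((\<lambda>x. torus_point (T x)) -` L)" "closed (T -` cball v 1)"
      using \<open>closed L\<close>
      by (auto intro!: closed_vimage T_cont continuous_on_compose2[OF continuous_on_torus_point T_cont])
    ultimately have "compact M" by (metis closed_Int compact_Int_closed compact_cbox)
    moreover have "continuous_on M (\<lambda>x. h (torus_point (T x)))"
      by (rule continuous_on_compose2[OF h(3)])
         (auto simp: M K_def intro: continuous_on_compose2[OF continuous_on_torus_point T_cont])
    moreover have "inj_on (\<lambda>x. h (torus_point (T x))) M"
    proof (rule inj_onI)
      fix x y assume "x \<in> M" "y \<in> M" "h (torus_point (T x)) = h (torus_point (T y))"
      then have "torus_point (T x) = torus_point (T y)" "T x \<in> cball v 1" "T y \<in> cball v 1"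
        using h(4) by (auto simp: M K_def inj_on_def)
      then show "x = y" using torus_point_inject T_inj by (metis injD)
    qed
    moreover have "\<forall>x\<in>M. h (torus_point (T x)) $ j = 0 \<and> h (torus_point (T x)) $ j' = 0"
      using h(5) by (auto simp: M K_def)
    ultimately show "embeds_codim_2 j M" using h(2) unfolding embeds_codim_2_def by blast
  qed
qed

subsection \<open>A multiple of controlled size\<close>

lemma sign_preserving_derivative_bound:
  fixes \<psi> :: "real \<Rightarrow> real"
  assumes d1: "\<And>s. (\<psi> has_real_derivative \<psi>' s) (at s)"
    and d2: "\<And>s. (\<psi>' has_real_derivative \<psi>'' s) (at s)"
    and B: "\<And>s. \<bar>\<psi>'' s\<bar> \<le> B" "B > 0"
    and sign: "\<And>s s'. \<not> (\<psi> s > 0 \<and> \<psi> s' < 0)"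
  shows "(\<psi>' 0)\<^sup>2 \<le> 2 * B * \<bar>\<psi> 0\<bar>"
proof -
  have nonneg: "(\<xi>' 0)\<^sup>2 \<le> 2 * B * \<xi> 0"
    if d: "\<And>s. (\<xi> has_real_derivative \<xi>' s) (at s)" "\<And>s. (\<xi>' has_real_derivative \<xi>'' s) (at s)"
      and b: "\<And>s. \<bar>\<xi>'' s\<bar> \<le> B" and nn: "\<And>s. \<xi> s \<ge> 0" for \<xi> \<xi>' \<xi>'' :: "real \<Rightarrow> real"
  proof (cases "\<xi>' 0 = 0")
    case True
    then show ?thesis using nn[of 0] B(2) by simp
  next
    case False
    \<comment> \<open>The minimum of the Taylor bound
      \<open>\<xi> 0 + \<xi>' 0 * x + B / 2 * x\<^sup>2\<close>, which has to be nonnegative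
      there.\<close>
    define x where "x = - \<xi>' 0 / B"
    have x: "x \<noteq> 0" using False B(2) by (simp add: x_def)
    define diff where "diff m = (if m = 0 then \<xi> else if m = 1 then \<xi>' else \<xi>'')" for m :: nat
    have "\<exists>t. (if x < 0 then x < t \<and> t < 0 else 0 < t \<and> t < x) \<and>
        \<xi> x = (\<Sum>m<2. diff m 0 / fact m * (x - 0) ^ m) + diff 2 t / fact 2 * (x - 0) ^ 2"
    proof (rule Taylor[where a = "min x 0" and b = "max x 0"])
      show "\<forall>m t. m < 2 \<and> min x 0 \<le> t \<and> t \<le> max x 0 \<longrightarrow> DERIV (diff m) t :> diff (Suc m) t"
        using d by (auto simp: diff_def less_2_cases_iff)
    qed (use x in \<open>auto simp: diff_def\<close>)
    then obtain t where "\<xi> x = \<xi> 0 + \<xi>' 0 * x + \<xi>'' t / 2 * x\<^sup>2"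
      by (auto simp: diff_def numeral_2_eq_2)
    moreover have "\<xi>'' t / 2 * x\<^sup>2 \<le> B / 2 * x\<^sup>2"
      using b[of t] by (intro mult_right_mono) auto
    ultimately have "0 \<le> \<xi> 0 + \<xi>' 0 * x + B / 2 * x\<^sup>2" using nn[of x] by linarith
    also have "\<dots> = \<xi> 0 - (\<xi>' 0)\<^sup>2 / (2 * B)"
      using B(2) by (simp add: x_def power2_eq_square field_simps)
    finally show ?thesis using B(2) by (simp add: field_simps)
  qed
  consider "\<And>s. \<psi> s \<ge> 0" | "\<And>s. \<psi> s \<le> 0" using sign by (meson not_le)
  then show ?thesis
  proof cases
    case 1
    then show ?thesis using nonneg[of \<psi> \<psi>' \<psi>''] d1 d2 B(1) 1[of 0] by simp
  next
    case 2
    have "(- \<psi>' 0)\<^sup>2 \<le> 2 * B * (- \<psi> 0)"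
    proof (rule nonneg)
      show "((\<lambda>s. - \<psi> s) has_real_derivative - \<psi>' s) (at s)" for s
        using d1 by (rule DERIV_minus)
      show "((\<lambda>s. - \<psi>' s) has_real_derivative - \<psi>'' s) (at s)" for s
        using d2 by (rule DERIV_minus)
    qed (use B 2 in auto)
    then show ?thesis using 2[of 0] by simp
  qed
qed

text \<open>The quotient satisfies \<open>q * reflect q = 1\<close>, and the constant coefficient of
  this product is the sum of the squares of the coefficients of \<open>q\<close>. A sum of nonzero
  integer squares equal to 1 has a single term.\<close>

lemma unit_of_reflect_dvd:
  fixes f :: "'d::finite laurent"
  assumes "f \<noteq> 0" "f dvd reflect f"
  shows "\<exists>u n. (u = 1 \<or> u = -1) \<and> reflect f = frag_cmul u (frag_of n) * f"
proof -
  obtain q where q: "reflect f = f * q" using assms(2) by blast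
  then have "f = reflect f * reflect q" by (metis reflect_mult reflect_reflect)
  then have "f * (1 - q * reflect q) = 0" by (simp add: q algebra_simps)
  then have "q * reflect q = 1" using laurent_no_zero_divisors assms(1) by fastforce
  then have "1 = conv q (lookup (reflect q)) 0"
    using conv_lookup[of q "reflect q" 0, where 'a = int] by simp
  also have "\<dots> = (\<Sum>k\<in>keys q. (lookup q k)\<^sup>2)"
    using lookup_reflect[of q] by (simp add: conv_def linear_eval_def power2_eq_square)
  finally have sum: "(\<Sum>k\<in>keys q. (lookup q k)\<^sup>2) = 1" by simp
  then have "keys q \<noteq> {}" by auto
  then obtain n where n: "n \<in> keys q" by blast
  have pos: "(lookup q k)\<^sup>2 \<ge> 1" if "k \<in> keys q" for k
    using that by (simp add: in_keys_iff) (metis int_one_le_iff_zero_less zero_less_power2)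
  have split: "(\<Sum>k\<in>keys q. (lookup q k)\<^sup>2) = (lookup q n)\<^sup>2 + (\<Sum>k\<in>keys q - {n}. (lookup q k)\<^sup>2)"
    using n by (intro sum.remove) auto
  have "(\<Sum>k\<in>keys q - {n}. (lookup q k)\<^sup>2) \<ge> (\<Sum>k\<in>keys q - {n}. 1)"
    using pos by (intro sum_mono) auto
  then have ge: "(\<Sum>k\<in>keys q - {n}. (lookup q k)\<^sup>2) \<ge> int (card (keys q - {n}))" by simp
  then have "card (keys q - {n}) = 0" using split sum pos[OF n] by linarith
  then have "keys q - {n} = {}" by (subst (asm) card_eq_0_iff) auto
  then have keys: "keys q = {n}" using n by blast
  then have sq: "(lookup q n)\<^sup>2 = 1" using sum by simp
  have "q = frag_cmul (lookup q n) (frag_of n)"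
  proof (rule poly_mapping_eqI)
    fix k
    have "lookup q k = 0" if "k \<noteq> n" using that keys by (metis in_keys_iff singletonD)
    then show "lookup q k = lookup (frag_cmul (lookup q n) (frag_of n)) k" by simp
  qed
  moreover have "lookup q n = 1 \<or> lookup q n = -1" using sq by (simp add: power2_eq_1_iff)
  ultimately show ?thesis using q by (metis mult.commute)
qed

lemma torus_eval_frag_cmul: "torus_eval (frag_cmul u p) t = of_int u * torus_eval p t"
proof -
  have "keys (frag_cmul u p) \<subseteq> keys p" by (rule keys_cmul)
  then show ?thesis
    by (simp add: torus_eval_def linear_eval_superset[of "keys p"] sum_distrib_left mult_ac)
qed

text \<open>Conjugation multiplies \<open>f\<close> on the torus by \<open>u\<close> and the
  character of \<open>n\<close>. A square root of that character, together with \<open>\<i>\<close>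
  if \<open>u = -1\<close>, makes \<open>f\<close> real. Differentiating the square root contributes
  \<open>n $ j / 2\<close>, and doubling gives the integral weights
  \<open>2 * m $ j + n $ j\<close>.\<close>

lemma self_reflected_dominated:
  fixes f :: "'d::finite laurent"
  assumes f: "irreducible f" "atoral f"
    and u: "u = 1 \<or> u = -1" and refl: "reflect f = frag_cmul u (frag_of n) * f"
  shows "\<exists>C. \<forall>t. (norm (torus_eval (diagonal (\<lambda>m. 2 * m $ j + n $ j) f) t))\<^sup>2 \<le> C * norm (torus_eval f t)"
proof -
  define D where "D = diagonal (\<lambda>m. 2 * m $ j + n $ j)"
  define \<alpha> :: complex where "\<alpha> = (if u = 1 then 1 else \<i>)"
  define half where "half t = cis ((\<Sum>i\<in>UNIV. of_int (n $ i) * t $ i) / 2)" for t :: "real ^ 'd"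
  have half_sq: "half t * half t = character n t" for t
    by (simp add: half_def character_def cis_mult)
  have half_axis: "half (t + s *\<^sub>R axis j 1) = half t * cis (of_int (n $ j) / 2 * s)" for t s
  proof -
    have "(\<Sum>i\<in>UNIV. of_int (n $ i) * (t + s *\<^sub>R axis j 1) $ i) =
          (\<Sum>i\<in>UNIV. of_int (n $ i) * t $ i) + (\<Sum>i\<in>UNIV. if i = j then of_int (n $ i) * s else 0)"
      by (subst sum.distrib[symmetric], intro sum.cong) (auto simp: axis_def algebra_simps)
    then show ?thesis by (simp add: half_def cis_mult add_divide_distrib)
  qed
  have norm_half: "norm (half t) = 1" "norm \<alpha> = 1" for t by (auto simp: half_def \<alpha>_def)
  define Z where "Z h t = \<alpha> * half t * torus_eval h t" for h t
  have norm_Z: "norm (Z h t) = norm (torus_eval h t)" for h t by (simp add: Z_def norm_mult norm_half)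
  have "cnj (Z f t) = Z f t" for t
  proof -
    have "cnj (torus_eval f t) = of_int u * character n t * torus_eval f t"
      using torus_eval_reflect[of f t] by (simp add: refl torus_eval_mult torus_eval_frag_cmul)
    then have "cnj (Z f t) = (cnj \<alpha> * of_int u) * (cnj (half t) * half t) * half t * torus_eval f t"
      by (simp add: Z_def half_sq[symmetric] mult_ac)
    also have "cnj (half t) * half t = 1"
      using complex_norm_square[of "half t"] by (simp add: norm_half mult.commute)
    also have "cnj \<alpha> * of_int u = \<alpha>" using u by (auto simp: \<alpha>_def)
    finally show ?thesis by (simp add: Z_def)
  qed
  then have real_Z: "Im (Z f t) = 0" for t by (metis Reals_cnj_iff complex_is_Real_iff)
  have deriv: "((\<lambda>s. Z h (t + s *\<^sub>R axis j 1)) has_vector_derivative \<i> / 2 * Z (D h) (t + s *\<^sub>R axis j 1)) (at s)"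
    for h t s
  proof -
    have 1: "((\<lambda>s. half (t + s *\<^sub>R axis j 1)) has_vector_derivative
       half t * (\<i> * of_real (of_int (n $ j) / 2) * cis (of_int (n $ j) / 2 * s))) (at s)"
      unfolding half_axis by (intro has_vector_derivative_mult_right has_vector_derivative_cis_linear)
    have DD: "torus_eval (D h) x = 2 * torus_eval (diagonal (\<lambda>n. n $ j) h) x + of_int (n $ j) * torus_eval h x" for x
      unfolding D_def torus_eval_def linear_eval_diagonal unfolding linear_eval_def
      by (simp add: sum_distrib_left sum.distrib[symmetric] algebra_simps)
    have "((\<lambda>s. \<alpha> * (half (t + s *\<^sub>R axis j 1) * torus_eval h (t + s *\<^sub>R axis j 1))) has_vector_derivative
       \<alpha> * (half (t + s *\<^sub>R axis j 1) * (\<i> * torus_eval (diagonal (\<lambda>n. n $ j) h) (t + s *\<^sub>R axis j 1)) +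
       half t * (\<i> * of_real (of_int (n $ j) / 2) * cis (of_int (n $ j) / 2 * s)) * torus_eval h (t + s *\<^sub>R axis j 1))) (at s)"
      by (intro has_vector_derivative_mult_right has_vector_derivative_mult 1 torus_eval_has_vector_derivative)
    also have "\<alpha> * (half (t + s *\<^sub>R axis j 1) * (\<i> * torus_eval (diagonal (\<lambda>n. n $ j) h) (t + s *\<^sub>R axis j 1)) +
       half t * (\<i> * of_real (of_int (n $ j) / 2) * cis (of_int (n $ j) / 2 * s)) * torus_eval h (t + s *\<^sub>R axis j 1))
       = \<i> / 2 * Z (D h) (t + s *\<^sub>R axis j 1)"
      by (simp add: Z_def DD half_axis algebra_simps)
    finally show ?thesis by (simp add: Z_def mult.assoc)
  qed
  define B where "B = coeff_norm (D (D f)) + 1"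
  have B: "B > 0" using coeff_norm_nonneg[of "D (D f)"] by (simp add: B_def)
  have cont: "continuous_on UNIV (\<lambda>t. Re (Z f t))"
    unfolding Z_def half_def by (intro continuous_intros) simp
  have zero: "Re (Z f t) = 0 \<longleftrightarrow> torus_eval f t = 0" for t
    using real_Z[of t] norm_Z[of f t] by (metis complex_eq_iff norm_eq_zero zero_complex.simps)
  have "(norm (torus_eval (D f) t))\<^sup>2 \<le> 8 * B * norm (torus_eval f t)" for t
  proof -
    define L where "L s = t + s *\<^sub>R axis j 1" for s
    have comp: "((\<lambda>s. Re (Z h (L s))) has_real_derivative Re (\<i> / 2 * Z (D h) (L s))) (at s)"
      "((\<lambda>s. Im (Z h (L s))) has_real_derivative Im (\<i> / 2 * Z (D h) (L s))) (at s)" for h s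
      using bounded_linear.has_vector_derivative[OF bounded_linear_Re deriv[of h t s]]
        bounded_linear.has_vector_derivative[OF bounded_linear_Im deriv[of h t s]]
      unfolding L_def has_real_derivative_iff_has_vector_derivative by blast+
    \<comment> \<open>The derivative of the real function \<open>Z f\<close> is real, so an estimate
      of its real part controls its norm.\<close>
    have "Im (\<i> / 2 * Z (D f) (L s)) = 0" for s
    proof -
      have "((\<lambda>s. 0) has_real_derivative Im (\<i> / 2 * Z (D f) (L s))) (at s)"
        using comp(2)[of f s] by (simp add: real_Z)
      then show ?thesis using DERIV_unique DERIV_const by blast
    qed
    then have re: "Re (Z (D f) (L s)) = 0" for s by simp
    have bound: "(Re (\<i> / 2 * Z (D f) (L 0)))\<^sup>2 \<le> 2 * B * \<bar>Re (Z f (L 0))\<bar>"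
    proof (rule sign_preserving_derivative_bound[where \<psi> = "\<lambda>s. Re (Z f (L s))"
          and \<psi>' = "\<lambda>s. Re (\<i> / 2 * Z (D f) (L s))" and \<psi>'' = "\<lambda>s. Re (\<i> / 2 * (\<i> / 2 * Z (D (D f)) (L s)))"])
      show "((\<lambda>s. Re (\<i> / 2 * Z (D f) (L s))) has_real_derivative
          Re (\<i> / 2 * (\<i> / 2 * Z (D (D f)) (L s)))) (at s)" for s
        using bounded_linear.has_vector_derivative[OF bounded_linear_Re has_vector_derivative_mult_right[OF deriv[of "D f" t s], of "\<i> / 2"]]
        unfolding L_def has_real_derivative_iff_has_vector_derivative .
      show "\<bar>Re (\<i> / 2 * (\<i> / 2 * Z (D (D f)) (L s)))\<bar> \<le> B" for s
      proof -
        have "\<bar>Re (\<i> / 2 * (\<i> / 2 * Z (D (D f)) (L s)))\<bar> \<le> norm (\<i> / 2 * (\<i> / 2 * Z (D (D f)) (L s)))"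
          by (rule abs_Re_le_cmod)
        also have "\<dots> = norm (torus_eval (D (D f)) (L s)) / 4"
          by (simp add: norm_mult norm_divide norm_Z)
        also have "\<dots> \<le> B"
          using norm_torus_eval_le[of "D (D f)" "L s"] coeff_norm_nonneg[of "D (D f)"] by (simp add: B_def)
        finally show ?thesis .
      qed
      show "\<not> (Re (Z f (L s)) > 0 \<and> Re (Z f (L s')) < 0)" for s s'
      proof
        assume a: "Re (Z f (L s)) > 0 \<and> Re (Z f (L s')) < 0"
        have "L s' = L s + (s' - s) *\<^sub>R axis j 1" by (simp add: L_def algebra_simps)
        then show False
          using atoral_no_sign_change[OF f(2) cont zero, of "L s" "s' - s" j] a by simp
      qed
    qed (use comp B in auto)
    have "norm (Z (D f) t) = \<bar>Im (Z (D f) t)\<bar>"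
      using re[of 0] by (simp add: L_def cmod_def)
    then have "(norm (torus_eval (D f) t))\<^sup>2 = 4 * (Re (\<i> / 2 * Z (D f) (L 0)))\<^sup>2"
      by (simp add: norm_Z[symmetric] L_def power2_eq_square)
    moreover have "\<bar>Re (Z f (L 0))\<bar> = norm (torus_eval f t)"
      using cmod_eq_Re[OF real_Z[of t]] norm_Z[of f t] by (simp add: L_def)
    ultimately show ?thesis using bound by simp
  qed
  then show ?thesis unfolding D_def by blast
qed

lemma dominated_coprime_exists:
  fixes f :: "'d::finite laurent"
  assumes f: "irreducible f" "atoral f"
  shows "\<exists>g C. \<not> f dvd g \<and> (\<forall>t. (norm (torus_eval g t))\<^sup>2 \<le> C * norm (torus_eval f t))"
proof (cases "f dvd reflect f")
  case False
  have "(norm (torus_eval (reflect f) t))\<^sup>2 \<le> coeff_norm f * norm (torus_eval f t)" for t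
    using norm_torus_eval_le[of f t]
    by (simp add: torus_eval_reflect power2_eq_square mult_right_mono)
  then show ?thesis using False by blast
next
  case True
  have f0: "f \<noteq> 0" using f(1) by (auto simp: irreducible_def)
  obtain u n where un: "u = 1 \<or> u = -1" "reflect f = frag_cmul u (frag_of n) * f"
    using unit_of_reflect_dvd[OF f0 True] by blast
  show ?thesis
  proof (cases "\<exists>j. \<not> f dvd diagonal (\<lambda>m. 2 * m $ j + n $ j) f")
    case True
    then show ?thesis using self_reflected_dominated[OF f un] by blast
  next
    case False
    \<comment> \<open>If all these weighted polynomials are divisible by \<open>f\<close>, the
      weights are constant on its support, which is therefore a single point. Then
      \<open>|f|\<close> is a positive integer on the torus and \<open>g = 1\<close> will
      do.\<close>
    have same: "k = l" if "k \<in> keys f" "l \<in> keys f" for k l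
    proof -
      have "2 * k $ j + n $ j = 2 * l $ j + n $ j" for j
        by (rule laurent_diagonal_multiple_const[of f "diagonal (\<lambda>m. 2 * m $ j + n $ j) f" "\<lambda>m. 2 * m $ j + n $ j"])
           (use False that in \<open>auto simp: lookup_diagonal\<close>)
      then show ?thesis by (simp add: vec_eq_iff)
    qed
    obtain k where "k \<in> keys f" using f0 by fastforce
    then have k: "keys f = {k}" using same by blast
    then have "norm (torus_eval f t) = \<bar>of_int (lookup f k)\<bar>" for t
      by (simp add: torus_eval_def linear_eval_def norm_mult)
    moreover have "lookup f k \<noteq> 0" using k by (auto simp: in_keys_iff)
    ultimately have "norm (torus_eval f t) \<ge> 1" for t by simp
    then have "(norm (torus_eval 1 t))\<^sup>2 \<le> 1 * norm (torus_eval f t)" for t by simp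
    moreover have "\<not> f dvd 1" using f(1) by (auto simp: irreducible_def)
    ultimately show ?thesis by blast
  qed
qed

subsection \<open>Fourier coefficients of a quotient\<close>

text \<open>Up to linear combinations this family is closed under differentiation
  (\<open>ratio_deriv\<close>). The number \<open>i - 2 * l\<close> of spare factors
  \<open>g\<close> drops by at most 2: by 1 if \<open>g\<close> is differentiated, by 2 if the
  denominator is.\<close>

definition ratio :: "'d::finite laurent \<Rightarrow> 'd laurent \<Rightarrow> 'd laurent \<Rightarrow> nat \<Rightarrow> nat \<Rightarrow> real ^ 'd \<Rightarrow> complex" where
  "ratio f g c i l t = torus_eval c t * torus_eval g t ^ i / torus_eval f t ^ l"

text \<open>Differences take the place of derivatives in the estimate of Fourier coefficients, so
  translation invariance of the mean is used instead of integration by parts.\<close>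

primrec iterated_difference :: "'d \<Rightarrow> real \<Rightarrow> nat \<Rightarrow> (real ^ 'd::finite \<Rightarrow> complex) \<Rightarrow> real ^ 'd \<Rightarrow> complex" where
  "iterated_difference j h 0 U t = U t"
| "iterated_difference j h (Suc r) U t =
     iterated_difference j h r U (t + h *\<^sub>R axis j 1) - iterated_difference j h r U t"

lemma iterated_difference_add:
  "iterated_difference j h r (\<lambda>t. U t + V t) t = iterated_difference j h r U t + iterated_difference j h r V t"
  by (induction r arbitrary: t) (simp_all add: algebra_simps)

lemma iterated_difference_mult:
  "iterated_difference j h r (\<lambda>t. a * U t) t = a * iterated_difference j h r U t"
  by (induction r arbitrary: t) (simp_all add: algebra_simps)

lemma iterated_difference_has_vector_derivative:
  assumes "\<And>t s. ((\<lambda>s. U (t + s *\<^sub>R axis j 1)) has_vector_derivative U' (t + s *\<^sub>R axis j 1)) (at s)"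
  shows "((\<lambda>s. iterated_difference j h r U (t + s *\<^sub>R axis j 1)) has_vector_derivative
     iterated_difference j h r U' (t + s *\<^sub>R axis j 1)) (at s)"
proof (induction r arbitrary: t)
  case 0
  then show ?case using assms by simp
next
  case (Suc r)
  have eq: "t + s *\<^sub>R axis j 1 + h *\<^sub>R axis j 1 = (t + h *\<^sub>R axis j 1) + s *\<^sub>R axis j 1" for s
    by (simp add: algebra_simps)
  show ?case unfolding iterated_difference.simps eq
    by (intro has_vector_derivative_diff Suc)
qed

lemma norm_difference_le:
  fixes V :: "real \<Rightarrow> complex"
  assumes d: "\<And>s. (V has_vector_derivative V' s) (at s)" and b: "\<And>s. norm (V' s) \<le> B"
  shows "norm (V h - V 0) \<le> B * \<bar>h\<bar>"
proof -
  have "norm (V h - V 0) \<le> B * norm (h - 0)"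
  proof (rule differentiable_bound[of UNIV V "\<lambda>s x. x *\<^sub>R V' s"])
    show "(V has_derivative (\<lambda>x. x *\<^sub>R V' s)) (at s within UNIV)" for s
      using d[of s] by (simp add: has_vector_derivative_def)
    show "onorm (\<lambda>x. x *\<^sub>R V' s) \<le> B" for s
      by (rule onorm_le) (metis abs_ge_zero b mult.commute mult_left_mono norm_scaleR real_norm_def)
  qed auto
  then show ?thesis by simp
qed

locale dominated =
  fixes f g :: "'d::finite laurent" and C :: real
  assumes C_nonneg: "C \<ge> 0"
    and dominated: "(norm (torus_eval g t))\<^sup>2 \<le> C * norm (torus_eval f t)"
begin

lemma zero_imp_zero: "torus_eval f t = 0 \<Longrightarrow> torus_eval g t = 0"
  using dominated[of t] by simp

text \<open>Each \<open>f\<close> in the denominator is absorbed by two factors \<open>g\<close> at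
  the cost of a factor \<open>C\<close>.\<close>

lemma ratio_bound:
  assumes "2 * l \<le> i"
  shows "norm (ratio f g c i l t) \<le> coeff_norm c * (C ^ l * norm (torus_eval g t) ^ (i - 2 * l))"
proof -
  have gpow: "norm (torus_eval g t) ^ i = norm (torus_eval g t) ^ (i - 2 * l) * ((norm (torus_eval g t))\<^sup>2) ^ l"
    using assms by (simp add: power_mult[symmetric] power_add[symmetric])
  have "norm (torus_eval g t) ^ i / norm (torus_eval f t) ^ l \<le> C ^ l * norm (torus_eval g t) ^ (i - 2 * l)"
  proof (cases "torus_eval f t = 0")
    case True
    then show ?thesis using zero_imp_zero[OF True] assms C_nonneg by (cases "l = 0") (auto simp: power_0_left)
  next
    case False
    then have pos: "norm (torus_eval f t) > 0" by simp
    have "((norm (torus_eval g t))\<^sup>2) ^ l \<le> (C * norm (torus_eval f t)) ^ l"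
      by (intro power_mono dominated) auto
    then have "norm (torus_eval g t) ^ i \<le> norm (torus_eval g t) ^ (i - 2 * l) * (C ^ l * norm (torus_eval f t) ^ l)"
      unfolding gpow power_mult_distrib by (intro mult_left_mono) auto
    then show ?thesis using pos by (simp add: divide_le_eq mult_ac)
  qed
  then have "norm (torus_eval c t) * (norm (torus_eval g t) ^ i / norm (torus_eval f t) ^ l) \<le>
      coeff_norm c * (C ^ l * norm (torus_eval g t) ^ (i - 2 * l))"
    by (intro mult_mono norm_torus_eval_le coeff_norm_nonneg) auto
  then show ?thesis by (simp add: ratio_def norm_mult norm_divide norm_power)
qed

text \<open>One spare factor \<open>g\<close> forces the ratio to tend to 0 at the zeros of
  \<open>f\<close>, and its value there is 0 as well.\<close>

lemma continuous_on_ratio: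
  assumes "2 * l + 1 \<le> i"
  shows "continuous_on UNIV (ratio f g c i l)"
proof (subst continuous_on_eq_continuous_at[OF open_UNIV], intro ballI)
  fix t :: "real ^ 'd"
  have ev: "isCont (torus_eval p) t" for p
    using continuous_on_torus_eval[of UNIV p] by (simp add: continuous_on_eq_continuous_at)
  show "isCont (ratio f g c i l) t"
  proof (cases "torus_eval f t = 0")
    case False
    then show ?thesis unfolding ratio_def by (intro continuous_intros ev) auto
  next
    case True
    then have g0: "torus_eval g t = 0" by (rule zero_imp_zero)
    have "((\<lambda>t. coeff_norm c * (C ^ l * norm (torus_eval g t) ^ (i - 2 * l))) \<longlongrightarrow>
        coeff_norm c * (C ^ l * norm (torus_eval g t) ^ (i - 2 * l))) (at t)"
      using ev[of g] unfolding isCont_def by (intro tendsto_intros)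
    then have "((\<lambda>t. coeff_norm c * (C ^ l * norm (torus_eval g t) ^ (i - 2 * l))) \<longlongrightarrow> 0) (at t)"
      using assms by (simp add: g0 power_0_left)
    then have "(ratio f g c i l \<longlongrightarrow> 0) (at t)"
      by (rule Lim_null_comparison[rotated]) (use assms in \<open>auto intro!: always_eventually ratio_bound\<close>)
    moreover have "ratio f g c i l t = 0" using assms g0 by (simp add: ratio_def)
    ultimately show ?thesis by (simp add: isCont_def)
  qed
qed

abbreviation weight :: "'d \<Rightarrow> 'd laurent \<Rightarrow> 'd laurent" where
  "weight j \<equiv> diagonal (\<lambda>n. n $ j)"

definition ratio_deriv :: "'d \<Rightarrow> 'd laurent \<Rightarrow> nat \<Rightarrow> nat \<Rightarrow> real ^ 'd \<Rightarrow> complex" where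
  "ratio_deriv j c i l t = \<i> * (ratio f g (weight j c) i l t
     + (of_nat i * ratio f g (c * weight j g) (i - 1) l t
     + (- of_nat l) * ratio f g (c * weight j f) i (l + 1) t))"

text \<open>At a zero of \<open>f\<close> all ratios vanish (also because \<open>x / 0 = 0\<close>), and the derivative is 0 since
  the ratio is dominated by \<open>|g|\<^sup>2\<close>.\<close>

lemma ratio_has_vector_derivative:
  assumes il: "2 * l + 2 \<le> i"
  shows "((\<lambda>s. ratio f g c i l (t + s *\<^sub>R axis j 1)) has_vector_derivative
     ratio_deriv j c i l (t + s *\<^sub>R axis j 1)) (at s)"
proof -
  define L where "L s = t + s *\<^sub>R axis j 1" for s
  have ev: "((\<lambda>s. torus_eval p (L s)) has_vector_derivative \<i> * torus_eval (weight j p) (L s)) (at s)" for p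
    unfolding L_def by (rule torus_eval_has_vector_derivative)
  show ?thesis
  proof (cases "torus_eval f (L s) = 0")
    case False
    have inv: "((\<lambda>s. inverse (torus_eval f (L s) ^ l)) has_vector_derivative
       (\<i> * torus_eval (weight j f) (L s)) * (- (of_nat l * torus_eval f (L s) ^ (l - 1) * inverse ((torus_eval f (L s) ^ l)\<^sup>2)))) (at s)"
    proof -
      have "((\<lambda>z. inverse (z ^ l)) has_field_derivative
          (- (of_nat l * torus_eval f (L s) ^ (l - 1) * inverse ((torus_eval f (L s) ^ l)\<^sup>2)))) (at (torus_eval f (L s)))"
        using False by (auto intro!: derivative_eq_intros simp: power2_eq_square)
      from field_vector_diff_chain_at[OF ev this] show ?thesis by (simp add: comp_def)
    qed
    have pw: "((\<lambda>s. torus_eval g (L s) ^ i) has_vector_derivative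
       (\<i> * torus_eval (weight j g) (L s)) * (of_nat i * torus_eval g (L s) ^ (i - 1))) (at s)"
    proof -
      have "((\<lambda>z. z ^ i) has_field_derivative (of_nat i * torus_eval g (L s) ^ (i - 1))) (at (torus_eval g (L s)))"
        by (auto intro!: derivative_eq_intros)
      from field_vector_diff_chain_at[OF ev this] show ?thesis by (simp add: comp_def)
    qed
    note d = has_vector_derivative_mult[OF has_vector_derivative_mult[OF ev[of c] pw] inv]
    have fl: "torus_eval f (L s) ^ (l - 1) * inverse ((torus_eval f (L s) ^ l)\<^sup>2) * of_nat l
        = of_nat l / torus_eval f (L s) ^ (l + 1)"
      using False by (cases l) (simp_all add: field_simps power2_eq_square)
    have "torus_eval c (L s) * torus_eval g (L s) ^ i *
       ((\<i> * torus_eval (weight j f) (L s)) * (- (of_nat l * torus_eval f (L s) ^ (l - 1) * inverse ((torus_eval f (L s) ^ l)\<^sup>2)))) +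
      (torus_eval c (L s) * ((\<i> * torus_eval (weight j g) (L s)) * (of_nat i * torus_eval g (L s) ^ (i - 1))) +
       \<i> * torus_eval (weight j c) (L s) * torus_eval g (L s) ^ i) * inverse (torus_eval f (L s) ^ l)
      = ratio_deriv j c i l (L s)"
    proof -
      have eq: "torus_eval c (L s) * torus_eval g (L s) ^ i *
       ((\<i> * torus_eval (weight j f) (L s)) * (- (of_nat l * torus_eval f (L s) ^ (l - 1) * inverse ((torus_eval f (L s) ^ l)\<^sup>2))))
       = - (\<i> * torus_eval c (L s) * torus_eval g (L s) ^ i * torus_eval (weight j f) (L s) *
        (torus_eval f (L s) ^ (l - 1) * inverse ((torus_eval f (L s) ^ l)\<^sup>2) * of_nat l))"
        by (simp add: mult_ac)
      show ?thesis unfolding eq fl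
        by (simp add: ratio_deriv_def ratio_def torus_eval_mult divide_inverse algebra_simps)
    qed
    with d have "((\<lambda>s. torus_eval c (L s) * torus_eval g (L s) ^ i * inverse (torus_eval f (L s) ^ l))
       has_vector_derivative ratio_deriv j c i l (L s)) (at s)" by simp
    then show ?thesis by (simp add: ratio_def L_def divide_inverse)
  next
    case True
    then have g0: "torus_eval g (L s) = 0" by (rule zero_imp_zero)
    have U0: "ratio f g c i l (L s) = 0" using il g0 by (simp add: ratio_def)
    have "ratio_deriv j c i l (L s) = 0" using il True g0 by (simp add: ratio_deriv_def ratio_def power_0_left)
    moreover have "((\<lambda>s. ratio f g c i l (L s)) has_vector_derivative 0) (at s)"
    proof -
      obtain K where K: "\<And>t. norm (ratio f g c i l t) \<le> K * (norm (torus_eval g t))\<^sup>2"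
      proof
        fix t
        have "norm (torus_eval g t) ^ (i - 2 * l) = (norm (torus_eval g t))\<^sup>2 * norm (torus_eval g t) ^ (i - 2 * l - 2)"
          using il by (auto simp: power_add power2_eq_square dest!: le_Suc_ex)
        also have "\<dots> \<le> (norm (torus_eval g t))\<^sup>2 * coeff_norm g ^ (i - 2 * l - 2)"
          by (intro mult_left_mono power_mono norm_torus_eval_le) auto
        finally have "C ^ l * norm (torus_eval g t) ^ (i - 2 * l) \<le> C ^ l * ((norm (torus_eval g t))\<^sup>2 * coeff_norm g ^ (i - 2 * l - 2))"
          using C_nonneg by (intro mult_left_mono) auto
        then have "coeff_norm c * (C ^ l * norm (torus_eval g t) ^ (i - 2 * l)) \<le>
          coeff_norm c * (C ^ l * ((norm (torus_eval g t))\<^sup>2 * coeff_norm g ^ (i - 2 * l - 2)))"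
          by (rule mult_left_mono[OF _ coeff_norm_nonneg])
        then show "norm (ratio f g c i l t) \<le>
           (coeff_norm c * (C ^ l * coeff_norm g ^ (i - 2 * l - 2))) * (norm (torus_eval g t))\<^sup>2"
          using ratio_bound[of l i c t] il by (simp add: mult_ac)
      qed
      define M where "M = coeff_norm (weight j g)"
      \<comment> \<open>Since \<open>g\<close> vanishes at \<open>L s\<close> and is Lipschitz along
        the line, its square is of second order in \<open>y - s\<close>.\<close>
      have gL: "norm (torus_eval g (L y)) \<le> M * \<bar>y - s\<bar>" for y
      proof -
        have "norm (torus_eval g (L s + (y - s) *\<^sub>R axis j 1) - torus_eval g (L s + 0 *\<^sub>R axis j 1)) \<le> M * \<bar>y - s\<bar>"
          by (rule norm_difference_le[where V = "\<lambda>u. torus_eval g (L s + u *\<^sub>R axis j 1)"])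
             (auto intro!: torus_eval_has_vector_derivative simp: norm_mult norm_torus_eval_le M_def)
        moreover have "L s + (y - s) *\<^sub>R axis j 1 = L y" by (simp add: L_def algebra_simps)
        ultimately show ?thesis using g0 by simp
      qed
      have K0: "K * (norm (torus_eval g (L y)))\<^sup>2 \<le> \<bar>K\<bar> * (M * \<bar>y - s\<bar>)\<^sup>2" for y
        by (intro mult_mono power_mono gL) auto
      have "((\<lambda>y. norm (ratio f g c i l (L y)) / norm (y - s)) \<longlongrightarrow> 0) (at s)"
      proof (rule Lim_null_comparison)
        show "\<forall>\<^sub>F y in at s. norm (norm (ratio f g c i l (L y)) / norm (y - s)) \<le> \<bar>K\<bar> * M\<^sup>2 * \<bar>y - s\<bar>"
        proof (rule always_eventually, intro allI)
          fix y
          have "norm (ratio f g c i l (L y)) \<le> (\<bar>K\<bar> * M\<^sup>2 * \<bar>y - s\<bar>) * \<bar>y - s\<bar>"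
            using K[of "L y"] K0[of y] by (simp add: power2_eq_square mult_ac)
          then show "norm (norm (ratio f g c i l (L y)) / norm (y - s)) \<le> \<bar>K\<bar> * M\<^sup>2 * \<bar>y - s\<bar>"
            by (cases "y = s") (simp_all add: divide_le_eq)
        qed
        have "((\<lambda>y. \<bar>K\<bar> * M\<^sup>2 * \<bar>y - s\<bar>) \<longlongrightarrow> \<bar>K\<bar> * M\<^sup>2 * \<bar>s - s\<bar>) (at s)"
          by (intro tendsto_intros)
        then show "((\<lambda>y. \<bar>K\<bar> * M\<^sup>2 * \<bar>y - s\<bar>) \<longlongrightarrow> 0) (at s)" by simp
      qed
      then show ?thesis
        unfolding has_vector_derivative_def has_derivative_iff_norm
        by (simp add: U0)
    qed
    ultimately show ?thesis by (simp add: L_def)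
  qed
qed

text \<open>One difference is bounded by \<open>|h|\<close> times a derivative. This derivative
  commutes with the remaining differences and turns the ratio into ratios with at most two spare
  factors fewer, to which the induction hypothesis applies.\<close>

lemma iterated_difference_ratio_bound:
  "2 * l + 2 * r \<le> i \<Longrightarrow> \<exists>K. \<forall>t h. norm (iterated_difference j h r (ratio f g c i l) t) \<le> K * \<bar>h\<bar> ^ r"
proof (induction r arbitrary: c i l)
  case 0
  have "norm (ratio f g c i l t) \<le> coeff_norm c * (C ^ l * coeff_norm g ^ (i - 2 * l))" for t
  proof -
    have "C ^ l * norm (torus_eval g t) ^ (i - 2 * l) \<le> C ^ l * coeff_norm g ^ (i - 2 * l)"
      using C_nonneg by (intro mult_left_mono power_mono norm_torus_eval_le) auto
    then have "coeff_norm c * (C ^ l * norm (torus_eval g t) ^ (i - 2 * l)) \<le>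
      coeff_norm c * (C ^ l * coeff_norm g ^ (i - 2 * l))"
      by (rule mult_left_mono[OF _ coeff_norm_nonneg])
    then show ?thesis using ratio_bound[of l i c t] 0 by simp
  qed
  then show ?case by auto
next
  case (Suc r)
  obtain K1 where K1: "\<And>t h. norm (iterated_difference j h r (ratio f g (weight j c) i l) t) \<le> K1 * \<bar>h\<bar> ^ r"
    using Suc.IH[of l i "weight j c"] Suc.prems by auto
  obtain K2 where K2: "\<And>t h. norm (iterated_difference j h r (ratio f g (c * weight j g) (i - 1) l) t) \<le> K2 * \<bar>h\<bar> ^ r"
  proof -
    have "2 * l + 2 * r \<le> i - 1" using Suc.prems by simp
    then show ?thesis using Suc.IH[of l "i - 1" "c * weight j g"] that by blast
  qed
  obtain K3 where K3: "\<And>t h. norm (iterated_difference j h r (ratio f g (c * weight j f) i (l + 1)) t) \<le> K3 * \<bar>h\<bar> ^ r"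
    using Suc.IH[of "l + 1" i "c * weight j f"] Suc.prems by auto
  define K where "K = K1 + (real i * K2 + real l * K3)"
  have deriv_bound: "norm (iterated_difference j h r (ratio_deriv j c i l) t) \<le> K * \<bar>h\<bar> ^ r" for t h
  proof -
    have "norm (iterated_difference j h r (ratio_deriv j c i l) t) \<le>
      norm (iterated_difference j h r (ratio f g (weight j c) i l) t) +
      (real i * norm (iterated_difference j h r (ratio f g (c * weight j g) (i - 1) l) t) +
       real l * norm (iterated_difference j h r (ratio f g (c * weight j f) i (l + 1)) t))"
      unfolding ratio_deriv_def[abs_def] iterated_difference_mult iterated_difference_add
      by (simp only: norm_mult norm_ii mult_1)
         (intro order_trans[OF norm_triangle_ineq] add_mono order_refl, simp_all add: norm_mult)
    also have "\<dots> \<le> K1 * \<bar>h\<bar> ^ r + (real i * (K2 * \<bar>h\<bar> ^ r) + real l * (K3 * \<bar>h\<bar> ^ r))"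
      by (intro add_mono mult_left_mono K1 K2 K3) auto
    finally show ?thesis by (simp add: K_def algebra_simps)
  qed
  have "norm (iterated_difference j h (Suc r) (ratio f g c i l) t) \<le> K * \<bar>h\<bar> ^ Suc r" for t h
  proof -
    have "norm (iterated_difference j h r (ratio f g c i l) (t + h *\<^sub>R axis j 1) -
       iterated_difference j h r (ratio f g c i l) (t + 0 *\<^sub>R axis j 1)) \<le> (K * \<bar>h\<bar> ^ r) * \<bar>h\<bar>"
      by (rule norm_difference_le[where V = "\<lambda>s. iterated_difference j h r (ratio f g c i l) (t + s *\<^sub>R axis j 1)"])
         (use Suc.prems in \<open>auto intro!: iterated_difference_has_vector_derivative ratio_has_vector_derivative deriv_bound\<close>)
    then show ?thesis by (simp add: mult_ac)
  qed
  then show ?case by blast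
qed

end

section \<open>Means over a period and Fourier coefficients\<close>

abbreviation period_box :: "(real ^ 'd::finite) set" where
  "period_box \<equiv> cbox 0 (\<chi> i. 2 * pi)"

definition torus_mean :: "(real ^ 'd::finite \<Rightarrow> complex) \<Rightarrow> complex" where
  "torus_mean G = integral period_box G /\<^sub>R measure lborel (period_box :: (real ^ 'd) set)"

lemma measure_period_box_pos: "measure lborel (period_box :: (real ^ 'd::finite) set) > 0"
proof (subst content_pos_lt_eq, intro ballI)
  fix b :: "real ^ 'd" assume "b \<in> Basis"
  then obtain j where "b = axis j 1" by (auto simp: Basis_vec_def)
  then show "0 \<bullet> b < (\<chi> i. 2 * pi) \<bullet> b" by (simp add: cart_eq_inner_axis[symmetric])
qed

lemma torus_mean_const: "torus_mean (\<lambda>t. c) = c"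
  using measure_period_box_pos[where 'd = 'a] by (simp add: torus_mean_def)

lemma continuous_integrable: "continuous_on UNIV G \<Longrightarrow> G integrable_on cbox a b"
  for G :: "real ^ 'd::finite \<Rightarrow> complex"
  by (meson continuous_on_subset integrable_continuous subset_UNIV)

lemma torus_mean_diff:
  assumes "continuous_on UNIV G" "continuous_on UNIV H"
  shows "torus_mean (\<lambda>t. G t - H t) = torus_mean G - torus_mean H"
  using assms by (simp add: torus_mean_def integral_diff continuous_integrable scaleR_right_diff_distrib)

lemma torus_mean_mult: "torus_mean (\<lambda>t. c * G t) = c * torus_mean G"
  by (simp add: torus_mean_def)

lemma torus_mean_sum:
  assumes "finite A" "\<And>a. a \<in> A \<Longrightarrow> continuous_on UNIV (G a)"
  shows "torus_mean (\<lambda>t. \<Sum>a\<in>A. G a t) = (\<Sum>a\<in>A. torus_mean (G a))"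
  using assms by (simp add: torus_mean_def integral_sum continuous_integrable scaleR_sum_right)

lemma norm_torus_mean_le:
  fixes G :: "real ^ 'd::finite \<Rightarrow> complex"
  assumes "continuous_on UNIV G" "\<And>t. norm (G t) \<le> B"
  shows "norm (torus_mean G) \<le> B"
proof -
  have "0 \<le> B" using assms(2)[of 0] norm_ge_zero order_trans by blast
  then have "norm (integral period_box G) \<le> B * measure lborel (period_box :: (real ^ 'd) set)"
    using assms by (intro has_integral_bound[of B G]) (auto intro: integrable_integral continuous_integrable)
  then show ?thesis using measure_period_box_pos[where 'd = 'd]
    by (simp add: torus_mean_def field_simps)
qed

text \<open>The shifted box is cut at \<open>2 * pi\<close> in the direction \<open>j\<close>. The
  part beyond the cut is a translate by one period of the part that was lost.\<close>

lemma torus_mean_shift: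
  fixes G :: "real ^ 'd::finite \<Rightarrow> complex"
  assumes cont: "continuous_on UNIV G"
    and periodic: "\<And>t. G (t + (2 * pi) *\<^sub>R axis j 1) = G t"
    and h: "0 \<le> h" "h \<le> 2 * pi"
  shows "torus_mean (\<lambda>t. G (t + h *\<^sub>R axis j 1)) = torus_mean G"
proof -
  let ?a = "axis j (1::real) :: real ^ 'd"
  let ?P = "(\<chi> i. 2 * pi) :: real ^ 'd"
  let ?H = "(\<chi> i. if i = j then h else 2 * pi) :: real ^ 'd"
  have basis: "?a \<in> Basis" by (auto simp: Basis_vec_def)
  have coord: "x \<bullet> ?a = x $ j" for x by (simp add: cart_eq_inner_axis)
  have mem: "x \<in> cbox a b \<longleftrightarrow> (a $ j \<le> x $ j \<and> x $ j \<le> b $ j) \<and>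
      (\<forall>i. i \<noteq> j \<longrightarrow> a $ i \<le> x $ i \<and> x $ i \<le> b $ i)" for x a b :: "real ^ 'd"
    unfolding mem_box_cart by metis
  have boxes: "cbox 0 ?P \<inter> {x. x \<bullet> ?a \<le> h} = cbox 0 ?H"
    "cbox 0 ?P \<inter> {x. x \<bullet> ?a \<ge> h} = cbox (h *\<^sub>R ?a) ?P"
    "cbox (h *\<^sub>R ?a) (?P + h *\<^sub>R ?a) \<inter> {x. x \<bullet> ?a \<le> 2 * pi} = cbox (h *\<^sub>R ?a) ?P"
    "cbox (h *\<^sub>R ?a) (?P + h *\<^sub>R ?a) \<inter> {x. x \<bullet> ?a \<ge> 2 * pi} = cbox ((2 * pi) *\<^sub>R ?a) (?P + h *\<^sub>R ?a)"
    unfolding coord using h by (auto simp: set_eq_iff mem axis_def)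
  define i1 where "i1 = integral (cbox 0 ?H) G"
  define i2 where "i2 = integral (cbox (h *\<^sub>R ?a) ?P) G"
  have i1: "(G has_integral i1) (cbox 0 ?H)" and i2: "(G has_integral i2) (cbox (h *\<^sub>R ?a) ?P)"
    unfolding i1_def i2_def using cont by (auto intro: integrable_integral continuous_integrable)
  have total: "(G has_integral (i1 + i2)) (cbox 0 ?P)"
    using has_integral_split[of G i1 0 ?P ?a h i2] i1 i2 boxes basis by simp
  have "G (t + - ((2 * pi) *\<^sub>R ?a)) = G t" for t
    using periodic[of "t - (2 * pi) *\<^sub>R ?a"] by simp
  moreover have "?H + (2 * pi) *\<^sub>R ?a = ?P + h *\<^sub>R ?a"
    by (simp add: vec_eq_iff axis_def)
  ultimately have "(G has_integral i1) (cbox ((2 * pi) *\<^sub>R ?a) (?P + h *\<^sub>R ?a))"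
    using has_integral_affinity'[OF i1, of 1 "- ((2 * pi) *\<^sub>R ?a)"] by simp
  then have "(G has_integral (i2 + i1)) (cbox (h *\<^sub>R ?a) (?P + h *\<^sub>R ?a))"
    using has_integral_split[of G i2 "h *\<^sub>R ?a" "?P + h *\<^sub>R ?a" ?a "2 * pi" i1] i2 boxes basis by simp
  then have "((\<lambda>t. G (t + h *\<^sub>R ?a)) has_integral (i2 + i1)) (cbox 0 ?P)"
    using has_integral_affinity'[of G "i2 + i1" "h *\<^sub>R ?a" "?P + h *\<^sub>R ?a" 1 "h *\<^sub>R ?a"] by simp
  then show ?thesis using total by (simp add: torus_mean_def integral_unique add.commute)
qed

lemma continuous_on_character [continuous_intros]: "continuous_on S (character n)"
  unfolding character_def by (intro continuous_intros)

lemma character_periodic: "character n (t + (2 * pi) *\<^sub>R axis j 1) = character n t"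
  using cis_multiple_2pi[of "of_int (n $ j)"] by (simp add: character_axis mult.commute)

lemma torus_eval_periodic: "torus_eval f (t + (2 * pi) *\<^sub>R axis j 1) = torus_eval f t"
  by (simp add: torus_eval_def character_periodic)

text \<open>At this step size the factor \<open>cis (n h) - 1\<close> produced by a difference is
  -2, the largest possible in absolute value.\<close>

lemma cis_half_period: "n \<noteq> 0 \<Longrightarrow> cis (of_int n * (pi / \<bar>of_int n\<bar>)) = - 1"
  by (cases "n > 0") (auto simp: complex_eq_iff)

lemma half_period_bounds:
  assumes "n \<noteq> (0::int)"
  shows "0 \<le> pi / \<bar>of_int n\<bar>" "pi / \<bar>of_int n\<bar> \<le> 2 * pi"
proof -
  have "1 \<le> \<bar>real_of_int n\<bar>" using assms by linarith
  then have "pi / \<bar>of_int n\<bar> \<le> pi / 1" by (intro divide_left_mono) auto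
  then show "pi / \<bar>of_int n\<bar> \<le> 2 * pi" using pi_gt_zero by linarith
qed auto

text \<open>For \<open>n \<noteq> 0\<close> a translation by half a period changes the sign of the
  character but not its mean.\<close>

lemma torus_mean_character:
  fixes n :: "int ^ 'd::finite"
  shows "torus_mean (character n) = (if n = 0 then 1 else 0)"
proof (cases "n = 0")
  case True
  moreover have "character 0 = (\<lambda>t :: real ^ 'd. 1)" by (simp add: fun_eq_iff)
  ultimately show ?thesis using torus_mean_const[of 1, where 'a = 'd] by simp
next
  case False
  then obtain j where j: "n $ j \<noteq> 0" by (auto simp: vec_eq_iff)
  define h where "h = pi / \<bar>real_of_int (n $ j)\<bar>"
  have "torus_mean (\<lambda>t. character n (t + h *\<^sub>R axis j 1)) = torus_mean (character n)"
    unfolding h_def using j by (intro torus_mean_shift continuous_intros character_periodic half_period_bounds)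
  moreover have "character n (t + h *\<^sub>R axis j 1) = (-1) * character n t" for t
    using cis_half_period[OF j] by (simp add: character_axis h_def)
  ultimately have "(-1) * torus_mean (character n) = torus_mean (character n)"
    using torus_mean_mult[of "-1" "character n"] by simp
  then show ?thesis using False by simp
qed

definition fourier_coeff :: "(real ^ 'd::finite \<Rightarrow> complex) \<Rightarrow> int ^ 'd \<Rightarrow> complex" where
  "fourier_coeff G n = torus_mean (\<lambda>t. G t * character (- n) t)"

lemma fourier_coeff_torus_eval: "fourier_coeff (torus_eval p) n = of_int (lookup p n)"
proof -
  have "fourier_coeff (torus_eval p) n = torus_mean (\<lambda>t. \<Sum>k\<in>keys p. of_int (lookup p k) * character (k - n) t)"
    unfolding fourier_coeff_def torus_eval_def linear_eval_def
    by (simp add: sum_distrib_right mult.assoc character_add[symmetric])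
  also have "\<dots> = (\<Sum>k\<in>keys p. of_int (lookup p k) * (if k = n then 1 else 0))"
    by (subst torus_mean_sum) (auto intro!: continuous_intros sum.cong simp: torus_mean_mult torus_mean_character)
  also have "\<dots> = (\<Sum>k\<in>keys p. if k = n then of_int (lookup p n) else 0)"
    by (intro sum.cong) auto
  also have "\<dots> = of_int (lookup p n)" by (simp add: in_keys_iff)
  finally show ?thesis .
qed

lemma conv_fourier_coeff:
  assumes "continuous_on UNIV G"
  shows "conv p (fourier_coeff G) n = fourier_coeff (\<lambda>t. torus_eval p t * G t) n"
proof -
  have "fourier_coeff (\<lambda>t. torus_eval p t * G t) n =
      torus_mean (\<lambda>t. \<Sum>k\<in>keys p. of_int (lookup p k) * (G t * character (- (n - k)) t))"
  proof -
    have ch: "character (- (n - k)) t = character k t * character (-n) t" for k t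
      by (simp add: character_add[symmetric])
    have "torus_eval p t * G t * character (- n) t =
        (\<Sum>k\<in>keys p. of_int (lookup p k) * (G t * character (- (n - k)) t))" for t
      unfolding torus_eval_def linear_eval_def sum_distrib_right ch
      by (intro sum.cong refl) (simp only: mult_ac)
    then show ?thesis by (simp only: fourier_coeff_def)
  qed
  also have "\<dots> = (\<Sum>k\<in>keys p. of_int (lookup p k) * fourier_coeff G (n - k))"
    using assms
    by (subst torus_mean_sum) (auto intro!: continuous_intros simp: torus_mean_mult fourier_coeff_def)
  finally show ?thesis by (simp add: conv_def linear_eval_def)
qed

lemma continuous_on_iterated_difference:
  assumes "continuous_on UNIV U" shows "continuous_on UNIV (iterated_difference j h r U)"
proof (induction r)
  case 0
  then show ?case using assms by simp
next
  case (Suc r)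
  have "continuous_on UNIV (\<lambda>t. iterated_difference j h r U (t + h *\<^sub>R axis j 1))"
    by (rule continuous_on_compose2[OF Suc]) (auto intro!: continuous_intros)
  then show ?case using Suc by (auto intro!: continuous_intros)
qed

lemma iterated_difference_periodic:
  assumes "\<And>t. U (t + p) = U t"
  shows "iterated_difference j h r U (t + p) = iterated_difference j h r U t"
proof (induction r arbitrary: t)
  case (Suc r)
  have "t + p + h *\<^sub>R axis j 1 = (t + h *\<^sub>R axis j 1) + p" by (simp add: algebra_simps)
  then show ?case by (simp only: iterated_difference.simps Suc)
qed (simp add: assms)

lemma fourier_coeff_iterated_difference:
  fixes G :: "real ^ 'd::finite \<Rightarrow> complex"
  assumes cont: "continuous_on UNIV G" and periodic: "\<And>t. G (t + (2 * pi) *\<^sub>R axis j 1) = G t"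
    and h: "0 \<le> h" "h \<le> 2 * pi"
  shows "fourier_coeff (iterated_difference j h r G) n = (cis (of_int (n $ j) * h) - 1) ^ r * fourier_coeff G n"
proof (induction r)
  case 0
  then show ?case by (simp add: fourier_coeff_def)
next
  case (Suc r)
  let ?D = "iterated_difference j h r G"
  have contD: "continuous_on UNIV ?D" by (rule continuous_on_iterated_difference[OF cont])
  have contS: "continuous_on UNIV (\<lambda>t. ?D (t + h *\<^sub>R axis j 1))"
    by (rule continuous_on_compose2[OF contD]) (auto intro!: continuous_intros)
  have "fourier_coeff (iterated_difference j h (Suc r) G) n =
      torus_mean (\<lambda>t. ?D (t + h *\<^sub>R axis j 1) * character (- n) t - ?D t * character (- n) t)"
    by (simp add: fourier_coeff_def left_diff_distrib)
  also have "\<dots> = torus_mean (\<lambda>t. ?D (t + h *\<^sub>R axis j 1) * character (- n) t) - fourier_coeff ?D n"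
    unfolding fourier_coeff_def by (intro torus_mean_diff continuous_intros contD contS)
  also have "torus_mean (\<lambda>t. ?D (t + h *\<^sub>R axis j 1) * character (- n) t) =
      torus_mean (\<lambda>t. cis (of_int (n $ j) * h) * (?D (t + h *\<^sub>R axis j 1) * character (- n) (t + h *\<^sub>R axis j 1)))"
  proof -
    have "character (- n) t = cis (of_int (n $ j) * h) * character (- n) (t + h *\<^sub>R axis j 1)" for t
    proof -
      have "character (- n) (t + h *\<^sub>R axis j 1) = character (- n) t * cis (- (of_int (n $ j) * h))"
        by (simp add: character_axis)
      moreover have "cis (of_int (n $ j) * h) * cis (- (of_int (n $ j) * h)) = 1" by (simp add: cis_mult)
      ultimately show ?thesis by (metis mult.left_commute mult.right_neutral)
    qed
    then have "?D (t + h *\<^sub>R axis j 1) * character (- n) t = cis (of_int (n $ j) * h) *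
        (?D (t + h *\<^sub>R axis j 1) * character (- n) (t + h *\<^sub>R axis j 1))" for t
      by (metis mult.left_commute)
    then show ?thesis by (intro arg_cong[of _ _ torus_mean] ext)
  qed
  also have "\<dots> = cis (of_int (n $ j) * h) * fourier_coeff ?D n"
    unfolding torus_mean_mult fourier_coeff_def
    by (subst torus_mean_shift[where G = "\<lambda>t. ?D t * character (- n) t"])
       (auto intro!: continuous_intros contD h simp: iterated_difference_periodic[where U = G and p = "(2 * pi) *\<^sub>R axis j 1", OF periodic] character_periodic)
  finally show ?case by (simp add: Suc algebra_simps)
qed

subsection \<open>Divisibility of separated summands\<close>

text \<open>With \<open>h\<close> half a period in direction \<open>j\<close>, the
  \<open>r\<close>-th difference multiplies the coefficient by \<open>(-2) ^ r\<close>, while its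
  size is of order \<open>h ^ r\<close>. The exponent of \<open>g\<close> covers
  \<open>2 * 1 + 2 * r\<close> for the differences as well as \<open>2 * 1 + 1\<close> for
  continuity.\<close>

lemma (in dominated) fourier_coeff_decay:
  assumes "2 * r + 3 \<le> i"
  shows "\<exists>K. \<forall>n j. n $ j \<noteq> 0 \<longrightarrow> norm (fourier_coeff (ratio f g 1 i 1) n) * \<bar>of_int (n $ j)\<bar> ^ r \<le> K"
proof -
  define G where "G = ratio f g 1 i 1"
  have cont: "continuous_on UNIV G" unfolding G_def using assms by (intro continuous_on_ratio) simp
  have periodic: "G (t + (2 * pi) *\<^sub>R axis j 1) = G t" for t j
    by (simp add: G_def ratio_def torus_eval_periodic)
  have "\<exists>K. \<forall>t h. norm (iterated_difference j h r G t) \<le> K * \<bar>h\<bar> ^ r" for j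
    unfolding G_def using assms by (intro iterated_difference_ratio_bound) simp
  then obtain K where K: "\<And>j t h. norm (iterated_difference j h r G t) \<le> K j * \<bar>h\<bar> ^ r" by metis
  have K_nonneg: "K j \<ge> 0" for j
    using order_trans[OF norm_ge_zero K[of j 1 0]] by simp
  have "norm (fourier_coeff G n) * \<bar>of_int (n $ j)\<bar> ^ r \<le> (\<Sum>j\<in>UNIV. K j * pi ^ r)" if j: "n $ j \<noteq> 0" for n j
  proof -
    define h where "h = pi / \<bar>real_of_int (n $ j)\<bar>"
    have h: "0 \<le> h" "h \<le> 2 * pi" unfolding h_def using half_period_bounds[OF j] by auto
    have "(-2) ^ r * fourier_coeff G n = fourier_coeff (iterated_difference j h r G) n"
      using cis_half_period[OF j] by (subst fourier_coeff_iterated_difference[OF cont periodic h]) (simp add: h_def)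
    moreover have "norm (fourier_coeff (iterated_difference j h r G) n) \<le> K j * \<bar>h\<bar> ^ r"
      unfolding fourier_coeff_def
      by (intro norm_torus_mean_le continuous_intros continuous_on_iterated_difference cont)
         (simp add: norm_mult K)
    ultimately have "norm ((-2) ^ r * fourier_coeff G n) \<le> K j * h ^ r" using h by simp
    then have "2 ^ r * norm (fourier_coeff G n) \<le> K j * h ^ r" by (simp add: norm_mult norm_power)
    moreover have "1 * norm (fourier_coeff G n) \<le> 2 ^ r * norm (fourier_coeff G n)"
      by (intro mult_right_mono) auto
    ultimately have "norm (fourier_coeff G n) \<le> K j * h ^ r" by linarith
    then have "norm (fourier_coeff G n) * \<bar>of_int (n $ j)\<bar> ^ r \<le> K j * h ^ r * \<bar>of_int (n $ j)\<bar> ^ r"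
      by (intro mult_right_mono) auto
    also have "\<dots> = K j * pi ^ r" using j by (simp add: h_def power_divide)
    also have "\<dots> \<le> (\<Sum>j\<in>UNIV. K j * pi ^ r)"
      using K_nonneg by (intro member_le_sum) auto
    finally show ?thesis .
  qed
  then show ?thesis unfolding G_def by blast
qed

lemma sum_inverse_squares_int_bounded:
  "\<exists>S. \<forall>N::nat. (\<Sum>k\<in>{- int N..int N}. inverse ((1 + \<bar>real_of_int k\<bar>)\<^sup>2)) \<le> S"
proof -
  have "summable (\<lambda>m. inverse ((real (Suc m))\<^sup>2))"
    using inverse_power_summable[of 2, where 'a = real] by (subst summable_Suc_iff) simp
  then have le: "(\<Sum>m\<le>N. inverse ((1 + real m)\<^sup>2)) \<le> suminf (\<lambda>m. inverse ((real (Suc m))\<^sup>2))" for N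
    using sum_le_suminf[of "\<lambda>m. inverse ((real (Suc m))\<^sup>2)" "{..N}"] by simp
  have "(\<Sum>k\<in>{- int N..int N}. inverse ((1 + \<bar>real_of_int k\<bar>)\<^sup>2)) \<le> 2 * suminf (\<lambda>m. inverse ((real (Suc m))\<^sup>2))" for N :: nat
  proof -
    have sub: "{- int N..int N} \<subseteq> int ` {..N} \<union> (\<lambda>m. - int m) ` {..N}"
    proof
      fix k assume "k \<in> {- int N..int N}"
      then show "k \<in> int ` {..N} \<union> (\<lambda>m. - int m) ` {..N}"
        by (cases k rule: int_cases2) auto
    qed
    have "(\<Sum>k\<in>{- int N..int N}. inverse ((1 + \<bar>real_of_int k\<bar>)\<^sup>2)) \<le>
        (\<Sum>k\<in>int ` {..N} \<union> (\<lambda>m. - int m) ` {..N}. inverse ((1 + \<bar>real_of_int k\<bar>)\<^sup>2))"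
      by (rule sum_mono2[OF _ sub]) auto
    also have "\<dots> \<le> (\<Sum>k\<in>int ` {..N}. inverse ((1 + \<bar>real_of_int k\<bar>)\<^sup>2)) +
        (\<Sum>k\<in>(\<lambda>m. - int m) ` {..N}. inverse ((1 + \<bar>real_of_int k\<bar>)\<^sup>2))"
      by (subst sum.union_inter[symmetric]) (auto intro!: sum_nonneg)
    also have "\<dots> = 2 * (\<Sum>m\<le>N. inverse ((1 + real m)\<^sup>2))"
      by (simp add: sum.reindex inj_on_def)
    finally show ?thesis using le[of N] by simp
  qed
  then show ?thesis by blast
qed

text \<open>Decay of order \<open>2 * CARD('d)\<close> in the largest coordinate is at least as
  strong as decay like the product of all \<open>(1 + |n_i|)^-2\<close>. The sum of these products
  over a cube factors into one-dimensional sums.\<close>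

lemma decay_imp_bounded_sums:
  fixes w :: "int ^ 'd::finite \<Rightarrow> complex"
  assumes decay: "\<And>n j. n $ j \<noteq> 0 \<Longrightarrow> norm (w n) * \<bar>of_int (n $ j)\<bar> ^ (2 * CARD('d)) \<le> K"
  shows "\<exists>S. \<forall>A. finite A \<longrightarrow> (\<Sum>n\<in>A. norm (w n)) \<le> S"
proof -
  let ?d = "CARD('d)"
  let ?a = "\<lambda>k::int. inverse ((1 + \<bar>real_of_int k\<bar>)\<^sup>2)"
  \<comment> \<open>The first entry serves \<open>n = 0\<close>, where the decay hypothesis says
    nothing; the second contains \<open>(2 * |n_j|)^2\<close> for each of the coordinates.\<close>
  define L where "L = max (norm (w 0)) (4 ^ ?d * K)"
  have L: "L \<ge> 0" by (simp add: L_def le_max_iff_disj)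
  have pointwise: "norm (w n) \<le> L * (\<Prod>i\<in>UNIV. ?a (n $ i))" for n
  proof (cases "n = 0")
    case True
    then show ?thesis by (simp add: L_def)
  next
    case False
    have "Max (range (\<lambda>i. \<bar>n $ i\<bar>)) \<in> range (\<lambda>i. \<bar>n $ i\<bar>)" by (intro Max_in) auto
    then obtain j where j: "Max (range (\<lambda>i. \<bar>n $ i\<bar>)) = \<bar>n $ j\<bar>" by (rule imageE)
    have le: "\<bar>n $ i\<bar> \<le> \<bar>n $ j\<bar>" for i unfolding j[symmetric] by (intro Max_ge) auto
    have nj: "n $ j \<noteq> 0"
    proof
      assume "n $ j = 0"
      then have "n $ i = 0" for i using le[of i] by simp
      then show False using False by (simp add: vec_eq_iff)
    qed
    have "(\<Prod>i\<in>UNIV. (1 + \<bar>real_of_int (n $ i)\<bar>)\<^sup>2) \<le> (\<Prod>i\<in>(UNIV::'d set). (2 * \<bar>real_of_int (n $ j)\<bar>)\<^sup>2)"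
    proof (intro prod_mono conjI power_mono)
      fix i
      have "real_of_int \<bar>n $ i\<bar> \<le> real_of_int \<bar>n $ j\<bar>" using le[of i] by (subst of_int_le_iff)
      moreover have "1 \<le> real_of_int \<bar>n $ j\<bar>" using nj by (subst of_int_1[symmetric], subst of_int_le_iff) linarith
      ultimately show "1 + \<bar>real_of_int (n $ i)\<bar> \<le> 2 * \<bar>real_of_int (n $ j)\<bar>" by simp
    qed auto
    also have "\<dots> = 4 ^ ?d * \<bar>real_of_int (n $ j)\<bar> ^ (2 * ?d)"
      by (simp add: power_mult_distrib power_mult)
    finally have "norm (w n) * (\<Prod>i\<in>UNIV. (1 + \<bar>real_of_int (n $ i)\<bar>)\<^sup>2) \<le> norm (w n) * (4 ^ ?d * \<bar>real_of_int (n $ j)\<bar> ^ (2 * ?d))"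
      by (intro mult_left_mono) auto
    also have "\<dots> \<le> 4 ^ ?d * K"
      using mult_left_mono[OF decay[OF nj], of "4 ^ ?d"] by (simp add: mult_ac)
    also have "\<dots> \<le> L" by (simp add: L_def)
    finally have "norm (w n) * (\<Prod>i\<in>UNIV. (1 + \<bar>real_of_int (n $ i)\<bar>)\<^sup>2) \<le> L" .
    moreover have "(\<Prod>i\<in>UNIV. (1 + \<bar>real_of_int (n $ i)\<bar>)\<^sup>2) > 0"
      by (intro prod_pos) (auto intro!: add_pos_nonneg)
    ultimately have "norm (w n) \<le> L / (\<Prod>i\<in>UNIV. (1 + \<bar>real_of_int (n $ i)\<bar>)\<^sup>2)"
      by (simp add: pos_le_divide_eq)
    then show ?thesis by (simp add: divide_inverse prod_inversef[unfolded comp_def])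
  qed
  obtain S where S: "\<And>N::nat. (\<Sum>k\<in>{- int N..int N}. ?a k) \<le> S"
    using sum_inverse_squares_int_bounded by blast
  have "(\<Sum>n\<in>A. norm (w n)) \<le> L * S ^ ?d" if A: "finite A" for A
  proof -
    define N where "N = nat (\<Sum>n\<in>A. \<Sum>i\<in>UNIV. \<bar>n $ i\<bar>)"
    let ?B = "PiE (UNIV :: 'd set) (\<lambda>_. {- int N..int N})"
    let ?v = "\<lambda>h. (\<chi> i. h i) :: int ^ 'd"
    have fin: "finite ?B" by (intro finite_PiE) auto
    have "A \<subseteq> ?v ` ?B"
    proof
      fix n assume n: "n \<in> A"
      have "\<bar>n $ i\<bar> \<le> int N" for i
      proof -
        have "\<bar>n $ i\<bar> \<le> (\<Sum>i\<in>UNIV. \<bar>n $ i\<bar>)" by (intro member_le_sum) auto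
        also have "\<dots> \<le> (\<Sum>n\<in>A. \<Sum>i\<in>UNIV. \<bar>n $ i\<bar>)"
          using n A by (intro member_le_sum[of n A "\<lambda>n. \<Sum>i\<in>UNIV. \<bar>n $ i\<bar>"]) (auto intro: sum_nonneg)
        finally have le: "\<bar>n $ i\<bar> \<le> (\<Sum>n\<in>A. \<Sum>i\<in>UNIV. \<bar>n $ i\<bar>)" .
        from order_trans[OF abs_ge_zero this] le show ?thesis unfolding N_def by simp
      qed
      then have "(\<lambda>i. n $ i) \<in> ?B" by (auto simp: abs_le_iff minus_le_iff)
      moreover have "n = ?v (\<lambda>i. n $ i)" by (simp add: vec_eq_iff)
      ultimately show "n \<in> ?v ` ?B" by blast
    qed
    then have "(\<Sum>n\<in>A. norm (w n)) \<le> (\<Sum>n\<in>?v ` ?B. norm (w n))"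
      using fin by (intro sum_mono2) auto
    also have "\<dots> \<le> (\<Sum>n\<in>?v ` ?B. L * (\<Prod>i\<in>UNIV. ?a (n $ i)))" by (intro sum_mono pointwise)
    also have "\<dots> = (\<Sum>h\<in>?B. L * (\<Prod>i\<in>UNIV. ?a (h i)))"
      by (subst sum.reindex) (auto simp: inj_on_def vec_eq_iff fun_eq_iff)
    also have "\<dots> = L * (\<Prod>i\<in>(UNIV::'d set). \<Sum>k\<in>{- int N..int N}. ?a k)"
      by (subst prod_sum_PiE) (auto simp: sum_distrib_left)
    also have "\<dots> \<le> L * S ^ ?d"
      using L S[of N] by (auto intro!: mult_left_mono power_mono sum_nonneg)
    finally show ?thesis .
  qed
  then show ?thesis by blast
qed

lemma summable_inverse_exists:
  fixes f :: "'d::finite laurent"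
  assumes f: "irreducible f" "atoral f"
  shows "\<exists>g (w :: int ^ 'd \<Rightarrow> real). \<not> f dvd g \<and> (\<exists>S. \<forall>A. finite A \<longrightarrow> (\<Sum>n\<in>A. \<bar>w n\<bar>) \<le> S) \<and>
     conv f w = (\<lambda>n. of_int (lookup g n))"
proof -
  obtain g C where g: "\<not> f dvd g" and C: "\<And>t. (norm (torus_eval g t))\<^sup>2 \<le> C * norm (torus_eval f t)"
    using dominated_coprime_exists[OF f] by blast
  interpret dominated f g "max C 0"
  proof
    fix t
    have "C * norm (torus_eval f t) \<le> max C 0 * norm (torus_eval f t)" by (intro mult_right_mono) auto
    then show "(norm (torus_eval g t))\<^sup>2 \<le> max C 0 * norm (torus_eval f t)" using C[of t] by linarith
  qed auto
  \<comment> \<open>This is \<open>2 * r + 3\<close> with the order of decay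
    \<open>r = 2 * CARD('d)\<close> that summability requires.\<close>
  define i where "i = 2 * (2 * CARD('d)) + 3"
  define G where "G = ratio f g 1 i 1"
  define W where "W = fourier_coeff G"
  have "continuous_on UNIV G" unfolding G_def i_def by (intro continuous_on_ratio) simp
  then have "conv f W n = fourier_coeff (\<lambda>t. torus_eval f t * G t) n" for n
    unfolding W_def by (rule conv_fourier_coeff)
  \<comment> \<open>At zeros of \<open>f\<close> both sides vanish because \<open>g\<close> does
    too.\<close>
  moreover have "torus_eval f t * G t = torus_eval (g ^ i) t" for t
  proof -
    have "i \<noteq> 0" by (simp add: i_def)
    then show ?thesis using zero_imp_zero[of t]
      by (cases "torus_eval f t = 0") (simp_all add: G_def ratio_def torus_eval_power power_0_left)
  qed
  ultimately have conv: "conv f W n = of_int (lookup (g ^ i) n)" for n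
    by (simp add: fourier_coeff_torus_eval)
  obtain K where K: "\<And>n j. n $ j \<noteq> 0 \<Longrightarrow> norm (W n) * \<bar>of_int (n $ j)\<bar> ^ (2 * CARD('d)) \<le> K"
    unfolding W_def G_def using fourier_coeff_decay[of "2 * CARD('d)" i] by (auto simp: i_def)
  then obtain S where S: "\<And>A. finite A \<Longrightarrow> (\<Sum>n\<in>A. norm (W n)) \<le> S"
    using decay_imp_bounded_sums[of W K] by blast
  \<comment> \<open>Rounding needs real values. Taking real parts respects the convolution identity
    since \<open>f\<close> and \<open>g ^ i\<close> have integer coefficients.\<close>
  have "(\<Sum>n\<in>A. \<bar>Re (W n)\<bar>) \<le> S" if "finite A" for A
    using sum_mono[of A "\<lambda>n. \<bar>Re (W n)\<bar>" "\<lambda>n. norm (W n)"] abs_Re_le_cmod S[OF that] by force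
  moreover have "conv f (\<lambda>n. Re (W n)) n = of_int (lookup (g ^ i) n)" for n
    using arg_cong[OF conv[of n], of Re] by (simp add: conv_def linear_eval_def)
  moreover have "\<not> f dvd g ^ i" using laurent_irreducible_dvd_power[OF f(1)] g by blast
  ultimately show ?thesis
    by (intro exI[of _ "g ^ i"] exI[of _ "\<lambda>n. Re (W n)"]) auto
qed

section \<open>Rounding and separation of supports\<close>

lemma bounded_sums_small_tail:
  fixes w :: "'k \<Rightarrow> real"
  assumes S: "\<And>A. finite A \<Longrightarrow> (\<Sum>n\<in>A. \<bar>w n\<bar>) \<le> S" and "e > 0"
  shows "\<exists>T. finite T \<and> (\<forall>A. finite A \<longrightarrow> A \<inter> T = {} \<longrightarrow> (\<Sum>n\<in>A. \<bar>w n\<bar>) \<le> e)"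
proof -
  define V where "V = (\<lambda>A. \<Sum>n\<in>A. \<bar>w n\<bar>) ` {A. finite A}"
  have bdd: "bdd_above V" using S by (auto simp: V_def bdd_above_def)
  have "V \<noteq> {}" by (auto simp: V_def)
  then obtain T where T: "finite T" "Sup V - e < (\<Sum>n\<in>T. \<bar>w n\<bar>)"
    using less_cSup_iff[of V "Sup V - e"] bdd \<open>e > 0\<close> by (auto simp: V_def)
  have "(\<Sum>n\<in>A. \<bar>w n\<bar>) \<le> e" if A: "finite A" "A \<inter> T = {}" for A
  proof -
    have "(\<Sum>n\<in>A \<union> T. \<bar>w n\<bar>) \<le> Sup V"
      using A T by (intro cSup_upper[OF _ bdd]) (auto simp: V_def)
    then show ?thesis using A T by (simp add: sum.union_disjoint)
  qed
  then show ?thesis using T by blast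
qed

lemma lattice_norm_nonneg: "lattice_norm n \<ge> 0"
proof -
  have "\<bar>n $ j\<bar> \<le> lattice_norm n" for j unfolding lattice_norm_def by (intro Max_ge) auto
  from order_trans[OF abs_ge_zero this] show ?thesis .
qed

lemma lattice_dist_le: "s \<in> S \<Longrightarrow> t \<in> T \<Longrightarrow> lattice_dist S T \<le> lattice_norm (s - t)"
  unfolding lattice_dist_def
  by (intro cInf_lower bdd_belowI[of _ 0]) (auto simp: lattice_norm_nonneg)

lemma abs_lookup_le_sup_coeff: "\<bar>lookup p k\<bar> \<le> sup_coeff p"
proof -
  have "range (\<lambda>n. \<bar>lookup p n\<bar>) \<subseteq> insert 0 ((\<lambda>n. \<bar>lookup p n\<bar>) ` keys p)"
    by (auto simp: in_keys_iff)
  then have "finite (range (\<lambda>n. \<bar>lookup p n\<bar>))" by (rule finite_subset) auto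
  then show ?thesis unfolding sup_coeff_def by (intro Max_ge) auto
qed

lemma conv_sum: "conv (sum p I) w n = (\<Sum>i\<in>I. conv (p i) w n)"
  by (simp add: conv_def linear_eval_sum)

lemma near_integer_convolution:
  fixes f g p :: "'d::finite laurent" and w :: "int ^ 'd \<Rightarrow> real"
  assumes w: "conv f w = (\<lambda>n. of_int (lookup g n))"
    and near: "\<And>n. \<bar>conv p w n - of_int (round (conv p w n))\<bar> \<le> e"
    and support: "finite N" "\<And>n. n \<notin> N \<Longrightarrow> \<bar>conv p w n\<bar> < 1 / 2"
    and e: "coeff_norm f * e < 1"
  shows "f dvd p * g"
proof -
  define \<rho> where "\<rho> n = round (conv p w n)" for n
  \<comment> \<open>Values below 1/2 round to 0, so the rounded function is finitely supported and
    defines a Laurent polynomial.\<close>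
  have "\<rho> n = 0" if "n \<notin> N" for n
    unfolding \<rho>_def using support(2)[OF that] by (intro round_unique') simp
  then have "finite {n. \<rho> n \<noteq> 0}" using support(1) by (auto intro: finite_subset)
  then have lookup_q: "lookup (Abs_poly_mapping \<rho>) = \<rho>" by simp
  define q where "q = Abs_poly_mapping \<rho>"
  have "f * q = p * g"
  proof (rule poly_mapping_eqI)
    fix n
    have "real_of_int (lookup (p * g) n) = conv (p * f) w n"
      by (simp add: conv_mult w conv_lookup)
    also have "\<dots> = conv f (conv p w) n" by (simp add: mult.commute[of p] conv_mult)
    finally have pg: "real_of_int (lookup (p * g) n) = conv f (conv p w) n" .
    have "real_of_int (lookup (f * q) n - lookup (p * g) n) =
        linear_eval f (\<lambda>k. of_int (\<rho> (n - k)) - conv p w (n - k))"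
      using conv_lookup[of f q n, where 'a = real]
      by (simp add: pg linear_eval_diff_right conv_def[of f] q_def lookup_q)
    also have "\<bar>\<dots>\<bar> \<le> coeff_norm f * e"
      using norm_linear_eval_le[of f "\<lambda>k. of_int (\<rho> (n - k)) - conv p w (n - k)" e] near
      by (simp add: \<rho>_def abs_minus_commute)
    finally have "\<bar>real_of_int (lookup (f * q) n - lookup (p * g) n)\<bar> < 1" using e by linarith
    then have "\<bar>lookup (f * q) n - lookup (p * g) n\<bar> < 1" by linarith
    then show "lookup (f * q) n = lookup (p * g) n" by simp
  qed
  then show ?thesis by (metis dvd_triv_left)
qed

theorem corollary1p6:
  fixes f :: "'d::finite laurent" and H :: int
  assumes "irreducible f" and "atoral f" and "H \<ge> 1"
  shows "\<exists>M :: real. M \<ge> 1 \<and>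
    (\<forall>(I :: nat set) (S :: nat \<Rightarrow> (int ^ 'd) set) (F :: nat set) (p :: nat \<Rightarrow> 'd laurent).
      (\<forall>i\<in>I. S i \<noteq> {}) \<longrightarrow>
      (\<forall>i\<in>I. \<forall>j\<in>I. i \<noteq> j \<longrightarrow> M \<le> real_of_int (lattice_dist (S i) (S j))) \<longrightarrow>
      finite F \<longrightarrow> F \<subseteq> I \<longrightarrow>
      (\<forall>i\<in>F. p i \<in> bounded_laurent (S i) H) \<longrightarrow>
      f dvd (\<Sum>i\<in>F. p i) \<longrightarrow>
      (\<forall>i\<in>F. f dvd p i))"
proof -
  obtain g and w :: "int ^ 'd \<Rightarrow> real" and B where g: "\<not> f dvd g"
    and B: "\<And>A. finite A \<Longrightarrow> (\<Sum>n\<in>A. \<bar>w n\<bar>) \<le> B" and w: "conv f w = (\<lambda>n. of_int (lookup g n))"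
    using summable_inverse_exists[OF assms(1,2)] by metis
  \<comment> \<open>Chosen so that the rounding error stays below 1 after multiplication by
    \<open>f\<close>, and so that values of size at most \<open>e\<close> round to 0.\<close>
  define e where "e = 1 / (4 * (1 + coeff_norm f))"
  have pos: "1 + coeff_norm f > 0" using coeff_norm_nonneg[of f] by simp
  have e: "e > 0" "e \<le> 1 / 4" "coeff_norm f * e < 1"
    using pos coeff_norm_nonneg[of f] by (auto simp: e_def field_simps)
  have "e / real_of_int H > 0" using e assms(3) by simp
  then obtain T where T: "finite T" "\<And>A. finite A \<Longrightarrow> A \<inter> T = {} \<Longrightarrow> (\<Sum>n\<in>A. \<bar>w n\<bar>) \<le> e / real_of_int H"
    using bounded_sums_small_tail[of w B "e / real_of_int H"] B by metis
  \<comment> \<open>A crude strict bound for the diameter of \<open>T\<close>, the finite set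
    carrying all of \<open>w\<close> but a tail of sum at most \<open>e / H\<close>. It depends on
    \<open>f\<close> and \<open>H\<close> only.\<close>
  define M where "M = 1 + (\<Sum>a\<in>T. \<Sum>b\<in>T. lattice_norm (a - b))"
  have M: "lattice_norm (a - b) < M" if "a \<in> T" "b \<in> T" for a b
  proof -
    have "lattice_norm (a - b) \<le> (\<Sum>b\<in>T. lattice_norm (a - b))"
      using that T(1) by (intro member_le_sum) (auto simp: lattice_norm_nonneg)
    also have "\<dots> \<le> (\<Sum>a\<in>T. \<Sum>b\<in>T. lattice_norm (a - b))"
      using that T(1)
      by (intro member_le_sum[of a T "\<lambda>a. \<Sum>b\<in>T. lattice_norm (a - b)"]) (auto simp: lattice_norm_nonneg sum_nonneg)
    finally show ?thesis by (simp add: M_def)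
  qed
  have M1: "M \<ge> 1" by (simp add: M_def sum_nonneg lattice_norm_nonneg)
  show ?thesis
  proof (intro exI[of _ "real_of_int M"] conjI allI impI ballI)
    show "1 \<le> real_of_int M" using M1 by simp
    fix I :: "nat set" and S F and p :: "nat \<Rightarrow> 'd laurent" and i
    assume "\<forall>i\<in>I. S i \<noteq> {}"
      and sep: "\<forall>i\<in>I. \<forall>j\<in>I. i \<noteq> j \<longrightarrow> real_of_int M \<le> real_of_int (lattice_dist (S i) (S j))"
      and F: "finite F" "F \<subseteq> I" and p: "\<forall>i\<in>F. p i \<in> bounded_laurent (S i) H"
      and dvd: "f dvd (\<Sum>i\<in>F. p i)" and i: "i \<in> F"
    have far: "M \<le> lattice_norm (s - t)" if "i \<in> F" "j \<in> F" "i \<noteq> j" "s \<in> keys (p i)" "t \<in> keys (p j)" for i j s t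
    proof -
      have "i \<in> I" "j \<in> I" using F(2) that(1,2) by blast+
      then have "real_of_int M \<le> real_of_int (lattice_dist (S i) (S j))" using sep that(3) by blast
      then have "M \<le> lattice_dist (S i) (S j)" by simp
      also have "\<dots> \<le> lattice_norm (s - t)"
        using p that by (intro lattice_dist_le) (auto simp: bounded_laurent_def)
      finally show ?thesis .
    qed
    have coeff_le: "\<bar>lookup (p i) k\<bar> \<le> H" if "i \<in> F" for i k
      using abs_lookup_le_sup_coeff[of "p i" k] p that by (force simp: bounded_laurent_def)
    \<comment> \<open>Only for \<open>n\<close> near \<open>i\<close> can
      \<open>conv (p i) w n\<close> involve values of \<open>w\<close> on \<open>T\<close>. As
      \<open>M\<close> exceeds the diameter of \<open>T\<close>, no \<open>n\<close> is near two
      different indices.\<close>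
    define near where "near i n \<longleftrightarrow> (\<exists>s\<in>keys (p i). n - s \<in> T)" for i n
    have near_unique: "i = j" if ij: "i \<in> F" "j \<in> F" "near i n" "near j n" for i j n
    proof (rule ccontr)
      assume "i \<noteq> j"
      obtain s t where "s \<in> keys (p i)" "n - s \<in> T" "t \<in> keys (p j)" "n - t \<in> T"
        using ij unfolding near_def by blast
      then show False using far[of i j s t] M[of "n - t" "n - s"] ij \<open>i \<noteq> j\<close> by simp
    qed
    \<comment> \<open>The supports are disjoint because \<open>M \<ge> 1\<close>, so all these
      convolutions together meet every value of \<open>w\<close> at most once, and only outside
      \<open>T\<close>. Hence the bound depends neither on the number of summands nor on the size of
      their supports.\<close>
    have tail: "(\<Sum>i\<in>J. \<bar>conv (p i) w n\<bar>) \<le> e" if J: "J \<subseteq> F" "\<And>i. i \<in> J \<Longrightarrow> \<not> near i n" for J n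
    proof -
      have finJ: "finite J" using J F finite_subset by blast
      have H: "real_of_int H > 0" using assms(3) by simp
      have "\<bar>conv (p i) w n\<bar> \<le> (\<Sum>s\<in>keys (p i). real_of_int H * \<bar>w (n - s)\<bar>)" if "i \<in> J" for i
      proof -
        have "\<bar>conv (p i) w n\<bar> \<le> (\<Sum>s\<in>keys (p i). \<bar>real_of_int (lookup (p i) s) * w (n - s)\<bar>)"
          unfolding conv_def linear_eval_def by (rule sum_abs)
        also have "\<dots> \<le> (\<Sum>s\<in>keys (p i). real_of_int H * \<bar>w (n - s)\<bar>)"
        proof (rule sum_mono)
          fix s
          have "\<bar>real_of_int (lookup (p i) s)\<bar> \<le> real_of_int H"
            using coeff_le[of i s] that J by (metis of_int_abs of_int_le_iff subsetD)
          then show "\<bar>real_of_int (lookup (p i) s) * w (n - s)\<bar> \<le> real_of_int H * \<bar>w (n - s)\<bar>"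
            unfolding abs_mult by (intro mult_right_mono) auto
        qed
        finally show ?thesis .
      qed
      then have "(\<Sum>i\<in>J. \<bar>conv (p i) w n\<bar>) \<le> (\<Sum>i\<in>J. \<Sum>s\<in>keys (p i). real_of_int H * \<bar>w (n - s)\<bar>)"
        by (rule sum_mono)
      also have "\<dots> = (\<Sum>s\<in>(\<Union>i\<in>J. keys (p i)). real_of_int H * \<bar>w (n - s)\<bar>)"
      proof (rule sum.UNION_disjoint[symmetric, OF finJ])
        show "\<forall>i\<in>J. \<forall>j\<in>J. i \<noteq> j \<longrightarrow> keys (p i) \<inter> keys (p j) = {}"
        proof (intro ballI impI equals0I)
          fix i j s assume ij: "i \<in> J" "j \<in> J" "i \<noteq> j" "s \<in> keys (p i) \<inter> keys (p j)"
          have "i \<in> F" "j \<in> F" using ij(1,2) J(1) by blast+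
          then have "M \<le> lattice_norm (s - s)" using far[of i j s s] ij(3,4) by blast
          then show False using M1 by (simp add: lattice_norm_def)
        qed
      qed auto
      also have "\<dots> = real_of_int H * (\<Sum>m\<in>(\<lambda>s. n - s) ` (\<Union>i\<in>J. keys (p i)). \<bar>w m\<bar>)"
        by (subst sum.reindex) (auto simp: inj_on_def sum_distrib_left)
      also have "\<dots> \<le> real_of_int H * (e / real_of_int H)"
        using finJ J(2) H by (intro mult_left_mono T(2)) (auto simp: near_def)
      finally show ?thesis using H by simp
    qed
    obtain Q where Q: "(\<Sum>i\<in>F. p i) = Q * f" using dvd by (metis dvdE mult.commute)
    \<comment> \<open>Here the divisibility enters: convolving \<open>w\<close> with
      \<open>Q * f\<close> gives the coefficients of \<open>Q * g\<close>, which are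
      integers.\<close>
    have total: "(\<Sum>i\<in>F. conv (p i) w n) = of_int (lookup (Q * g) n)" for n
      by (simp add: conv_sum[symmetric] Q conv_mult w conv_lookup)
    have "f dvd p i * g"
    proof (rule near_integer_convolution[OF w _ _ _ e(3)])
      show "\<bar>conv (p i) w n - of_int (round (conv (p i) w n))\<bar> \<le> e" for n
      proof -
        \<comment> \<open>If \<open>n\<close> is near \<open>i\<close>, it is near no other index,
          the other summands add up to at most \<open>e\<close>, and the integral total is the
          witness. Otherwise the value itself is small and 0 is.\<close>
        have "\<exists>z. \<bar>conv (p i) w n - of_int z\<bar> \<le> e"
        proof (cases "near i n")
          case True
          have "conv (p i) w n - of_int (lookup (Q * g) n) = - (\<Sum>j\<in>F - {i}. conv (p j) w n)"
            using total[of n] F(1) i by (simp add: sum.remove)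
          also have "\<bar>\<dots>\<bar> \<le> (\<Sum>j\<in>F - {i}. \<bar>conv (p j) w n\<bar>)" by (simp add: sum_abs)
          also have "\<dots> \<le> e" using near_unique i True by (intro tail) auto
          finally show ?thesis by blast
        next
          case False
          then show ?thesis using tail[of "{i}" n] i by (intro exI[of _ 0]) auto
        qed
        then show ?thesis using round_diff_minimal[of "conv (p i) w n"] order_trans by blast
      qed
      show "finite ((\<lambda>(s, t). s + t) ` (keys (p i) \<times> T))" using T(1) by auto
      show "\<bar>conv (p i) w n\<bar> < 1 / 2" if "n \<notin> (\<lambda>(s, t). s + t) ` (keys (p i) \<times> T)" for n
      proof -
        have "\<not> near i n"
        proof
          assume "near i n"
          then obtain s where "s \<in> keys (p i)" "n - s \<in> T" by (auto simp: near_def)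
          then have "(\<lambda>(s, t). s + t) (s, n - s) \<in> (\<lambda>(s, t). s + t) ` (keys (p i) \<times> T)" by blast
          then show False using that by simp
        qed
        then show ?thesis using tail[of "{i}" n] i e by auto
      qed
    qed
    then show "f dvd p i" using laurent_irreducible_dvd_mult[OF assms(1)] g by blast
  qed
qed

end
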